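(* Let $T>0$, and let $b:\mathbb{R}^d\to\mathbb{R}^d$ and $\sigma:\mathbb{R}^d\to\mathbb{R}^d\otimes\mathbb{R}^m$ satisfy: (A1) $\|b\|_\infty:=\sup_{x\in\mathbb{R}^d}|b(x)|<\infty$ and there is $p_0>\frac d2$ such that $|b|^2\in L^{p_0}(\mathbb{R}^d)$; (A3) there exist constants $\breve\lambda_0,\hat\lambda_0,L_0>0$ such that $\breve\lambda_0|\xi|^2\le\langle(\sigma\sigma^* )(x)\xi,\xi\rangle\le\hat\lambda_0|\xi|^2$ and $\|\sigma(x)-\sigma(y)\|_{\rm HS}\le L_0|x-y|$ for all $x,y,\xi\in\mathbb{R}^d$. Let $\delta\in(0,1)$ and let $(X^{(\delta)}_t)_{t\ge0}$ be the Euler–Maruyama scheme defined in the context. Then, for all $p,q\in(1,\infty)$ with $\frac dp+\frac2q<2$, every $f\in L^p_q(T)$ and every $\lambda>0$, $$\mathbb{E}\exp\Big(\lambda\int_0^T|f_t(X^{(\delta)}_t)|\,dt\Big)\le 2^{1+T\left(2\lambda\alpha_0\|f\|_{L^p_q(T)}\right)^{\gamma_0}},$$ where $\gamma_0:=\frac{1}{1-1/q-d/(2p)}$ and $$\alpha_0:=\frac{(1-1/p)^{\frac d2(1-1/p)}}{\left(\breve\lambda_0(2\pi)^{\frac1p}\right)^{\frac d2}}\Big\{\hat\lambda_0^{\frac d2(1-1/p)}+\Lambda_3\,(\gamma_0(1-1/q))^{\frac{q-1}{q}}(\kappa_0/2)^{\frac d2(1-1/p)}\Big\},$$ with $\kappa_0$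 and $\Lambda_3$ the constants defined in the context.
   Context: $(W_t)_{t\ge0}$ is an $m$-dimensional Brownian motion on a filtered probability space. For $\delta\in(0,1)$ the Euler–Maruyama (EM) scheme is $dX^{(\delta)}_t=b(X^{(\delta)}_{t_\delta})\,dt+\sigma(X^{(\delta)}_{t_\delta})\,dW_t$, $t\ge0$, $X^{(\delta)}_0=x\in\mathbb{R}^d$, where $t_\delta:=\lfloor t/\delta\rfloor\delta$. $\|\cdot\|_{\rm HS}$ is the Hilbert–Schmidt norm, $\sigma^*$ is the transpose of $\sigma$. $L^p_q(T)$ is the family of all Borel measurable $f:[0,T]\times\mathbb{R}^d\to\mathbb{R}^d$ with $\|f\|_{L^p_q(T)}:=\Big(\int_0^T\big(\int_{\mathbb{R}^d}|f_t(x)|^p\,dx\big)^{q/p}\,dt\Big)^{1/q}<\infty$. Constants ($a\vee b=\max(a,b)$, $\Gamma$ is the Gamma function): $$\Lambda_1:=\max\{A,B\},$$ $$A:=2\Big\{\frac{\|b\|_\infty}{\sqrt{\breve\lambda_0}}+2\sqrt d\,L_0\Big(\frac{\hat\lambda_0}{\breve\lambda_0}\Big)^{2}+d^{\frac d2+1}d!\Big(\frac{\hat\lambda_0}{\breve\lambda_0}\Big)^{d}L_0\Big\}e^{\frac{\|b\|_\infty^2T}{\hat\lambda_0}},$$ $$B:=\Big\{2\sqrt{\hat\lambda_0}\,\|b\|_\infty+(\|b\|_\infty^2+2\hat\lambda_0L_0\sqrt d)(\sqrt d+2)+2^{m+11}\breve\lambda_0^{-1}(L_0+2\|b\|_\infty)\Big((\|b\|_\infty^3+(d\hat\lambda_0)^{\frac32})+\breve\lambda_0^{\frac12}(\|b\|_\infty^2+d\hat\lambda_0)\Big)\Big\}\frac{2^{\frac{d+1}{2}}}{\breve\lambda_0}e^{\frac{(\|b\|_\infty+\|b\|_\infty^2)T}{\hat\lambda_0}},$$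 $$\Lambda_2:=e^{\frac{\|b\|_\infty T}{2\hat\lambda_0}}\sum_{i=0}^\infty\frac{\Big(\Lambda_1\sqrt{\pi T}\,\big((1+24d)\hat\lambda_0/\breve\lambda_0\big)^d\Big)^i}{\Gamma(1+\frac i2)},$$ $$\kappa_0:=4(1+24d)\hat\lambda_0,\qquad \Lambda_3:=\Lambda_2\,e^{\frac{\|b\|_\infty^2}{2\hat\lambda_0}}\Big(\frac{\kappa_0}{2\breve\lambda_0}\Big)^{d/2}.$$ *)

theory Defs
  imports "HOL-Probability.Probability"
begin

text \<open>Time is a real parameter throughout; only times in \<open>[0, \<infinity>)\<close> are constrained.\<close>

definition filtered_prob_space :: "'w measure \<Rightarrow> (real \<Rightarrow> 'w measure) \<Rightarrow> bool" where
  "filtered_prob_space M F \<longleftrightarrow> prob_space M \<and>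
     (\<forall>t\<ge>0. subalgebra M (F t)) \<and>
     (\<forall>s t. 0 \<le> s \<and> s \<le> t \<longrightarrow> subalgebra (F t) (F s))"

definition adapted_to ::
    "(real \<Rightarrow> 'w measure) \<Rightarrow> (real \<Rightarrow> 'w \<Rightarrow> 'e::topological_space) \<Rightarrow> bool" where
  "adapted_to F X \<longleftrightarrow> (\<forall>t\<ge>0. X t \<in> borel_measurable (F t))"

text \<open>
  The increment \<open>W t - W s\<close> has law \<open>N(0, (t - s) I)\<close>, i.e. its Lebesgue density is the product
  of the one-dimensional centred normal densities with standard deviation \<open>sqrt (t - s)\<close>.
\<close>

definition brownian_motion ::
    "'w measure \<Rightarrow> (real \<Rightarrow> 'w measure) \<Rightarrow> (real \<Rightarrow> 'w \<Rightarrow> real ^ 'm) \<Rightarrow> bool" where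
  "brownian_motion M F W \<longleftrightarrow>
     adapted_to F W \<and>
     (AE \<omega> in M. W 0 \<omega> = 0) \<and>
     (AE \<omega> in M. continuous_on {0..} (\<lambda>t. W t \<omega>)) \<and>
     (\<forall>s t. 0 \<le> s \<and> s < t \<longrightarrow>
        prob_space.indep_set M (sets (F s))
          (sets (vimage_algebra (space M) (\<lambda>\<omega>. W t \<omega> - W s \<omega>) borel)) \<and>
        distributed M lborel (\<lambda>\<omega>. W t \<omega> - W s \<omega>)
          (\<lambda>z. ennreal (\<Prod>i\<in>UNIV. normal_density 0 (sqrt (t - s)) (z $ i))))"

definition grid_floor :: "real \<Rightarrow> real \<Rightarrow> real" where
  "grid_floor \<delta> t = of_int \<lfloor>t / \<delta>\<rfloor> * \<delta>"

text \<open>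
  Ito integral over \<open>[0, t]\<close> of the elementary integrand \<open>s \<mapsto> H (grid_floor \<delta> s)\<close>, which is
  constant on each \<open>[k \<delta>, (k + 1) \<delta>)\<close>: by definition it is the sum of the products with the
  increments of \<open>W\<close>. The last summand is the incomplete step from \<open>grid_floor \<delta> t\<close> to \<open>t\<close>.
\<close>

definition elementary_ito_integral ::
    "real \<Rightarrow> (real \<Rightarrow> 'w \<Rightarrow> real ^ 'm ^ 'd) \<Rightarrow> (real \<Rightarrow> 'w \<Rightarrow> real ^ 'm) \<Rightarrow> real \<Rightarrow> 'w \<Rightarrow> real ^ 'd" where
  "elementary_ito_integral \<delta> H W t \<omega> =
     (\<Sum>k\<le>nat \<lfloor>t / \<delta>\<rfloor>. H (real k * \<delta>) \<omega> *v
        (W (min t (real (k + 1) * \<delta>)) \<omega> - W (min t (real k * \<delta>)) \<omega>))"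

definition euler_maruyama ::
    "'w measure \<Rightarrow> (real \<Rightarrow> 'w measure) \<Rightarrow> (real \<Rightarrow> 'w \<Rightarrow> real ^ 'm) \<Rightarrow>
     (real ^ 'd \<Rightarrow> real ^ 'd) \<Rightarrow> (real ^ 'd \<Rightarrow> real ^ 'm ^ 'd) \<Rightarrow> real \<Rightarrow> real ^ 'd \<Rightarrow>
     (real \<Rightarrow> 'w \<Rightarrow> real ^ 'd) \<Rightarrow> bool" where
  "euler_maruyama M F W b \<sigma> \<delta> x X \<longleftrightarrow>
     adapted_to F X \<and>
     (AE \<omega> in M. \<forall>t\<ge>0. X t \<omega> =
        x + (LINT s:{0..t}|lborel. b (X (grid_floor \<delta> s) \<omega>))
          + elementary_ito_integral \<delta> (\<lambda>s \<omega>. \<sigma> (X s \<omega>)) W t \<omega>)"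

definition sup_norm :: "(real ^ 'd \<Rightarrow> real ^ 'd) \<Rightarrow> real" where
  "sup_norm b = (SUP x. norm (b x))"

definition Lp_class :: "real \<Rightarrow> (real ^ 'd \<Rightarrow> real) set" where
  "Lp_class p = {g \<in> borel_measurable borel. (\<integral>\<^sup>+x. ennreal (\<bar>g x\<bar> powr p) \<partial>lborel) < \<infinity>}"

definition assumption_A1 :: "(real ^ 'd \<Rightarrow> real ^ 'd) \<Rightarrow> bool" where
  "assumption_A1 b \<longleftrightarrow>
     b \<in> borel_measurable borel \<and> bdd_above (range (\<lambda>x. norm (b x))) \<and>
     (\<exists>p0. p0 > real CARD('d) / 2 \<and> (\<lambda>x. (norm (b x))\<^sup>2) \<in> Lp_class p0)"

text \<open>The norm of \<^typ>\<open>real ^ 'm ^ 'd\<close> is the Hilbert--Schmidt norm.\<close>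

definition assumption_A3 ::
    "(real ^ 'd \<Rightarrow> real ^ 'm ^ 'd) \<Rightarrow> real \<Rightarrow> real \<Rightarrow> real \<Rightarrow> bool" where
  "assumption_A3 \<sigma> lmin lmax L0 \<longleftrightarrow>
     lmin > 0 \<and> lmax > 0 \<and> L0 > 0 \<and>
     (\<forall>x \<xi>. lmin * (norm \<xi>)\<^sup>2 \<le> ((\<sigma> x ** transpose (\<sigma> x)) *v \<xi>) \<bullet> \<xi> \<and>
            ((\<sigma> x ** transpose (\<sigma> x)) *v \<xi>) \<bullet> \<xi> \<le> lmax * (norm \<xi>)\<^sup>2) \<and>
     (\<forall>x y. norm (\<sigma> x - \<sigma> y) \<le> L0 * norm (x - y))"

text \<open>Positive powers and the exponential on \<open>[0, \<infinity>]\<close>, with value \<open>\<infinity>\<close> at \<open>\<infinity>\<close>.\<close>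

definition ennpowr :: "ennreal \<Rightarrow> real \<Rightarrow> ennreal" where
  "ennpowr u a = (if u = \<infinity> then \<infinity> else ennreal (enn2real u powr a))"

definition ennexp :: "ennreal \<Rightarrow> ennreal" where
  "ennexp u = (if u = \<infinity> then \<infinity> else ennreal (exp (enn2real u)))"

definition Lpq_norm :: "real \<Rightarrow> real \<Rightarrow> real \<Rightarrow> (real \<Rightarrow> real ^ 'd \<Rightarrow> real ^ 'd) \<Rightarrow> ennreal" where
  "Lpq_norm p q T f =
     ennpowr (\<integral>\<^sup>+t\<in>{0..T}. ennpowr (\<integral>\<^sup>+x. ennreal (norm (f t x) powr p) \<partial>lborel) (q / p) \<partial>lborel)
       (1 / q)"

definition Lpq_class :: "real \<Rightarrow> real \<Rightarrow> real \<Rightarrow> (real \<Rightarrow> real ^ 'd \<Rightarrow> real ^ 'd) set" where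
  "Lpq_class p q T =
     {f. (\<lambda>(t, x). f t x) \<in> borel_measurable (restrict_space borel ({0..T} \<times> UNIV)) \<and>
         Lpq_norm p q T f < \<infinity>}"

text \<open>
  The constants depend on the dimensions \<open>d\<close> and \<open>m\<close>, the sup norm \<open>nb\<close> of the drift, the
  ellipticity bounds \<open>lmin \<le> lmax\<close>, the Lipschitz constant \<open>L0\<close> and the time horizon \<open>T\<close>.
\<close>

definition Lambda1A :: "nat \<Rightarrow> real \<Rightarrow> real \<Rightarrow> real \<Rightarrow> real \<Rightarrow> real \<Rightarrow> real" where
  "Lambda1A d nb lmin lmax L0 T =
     2 * (nb / sqrt lmin
          + 2 * sqrt (real d) * L0 * (lmax / lmin) ^ 2
          + real d powr (real d / 2 + 1) * fact d * (lmax / lmin) ^ d * L0)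
       * exp (nb ^ 2 * T / lmax)"

definition Lambda1B :: "nat \<Rightarrow> nat \<Rightarrow> real \<Rightarrow> real \<Rightarrow> real \<Rightarrow> real \<Rightarrow> real \<Rightarrow> real" where
  "Lambda1B d m nb lmin lmax L0 T =
     (2 * sqrt lmax * nb
      + (nb ^ 2 + 2 * lmax * L0 * sqrt (real d)) * (sqrt (real d) + 2)
      + 2 ^ (m + 11) * inverse lmin * (L0 + 2 * nb)
          * ((nb ^ 3 + (real d * lmax) powr (3 / 2))
             + lmin powr (1 / 2) * (nb ^ 2 + real d * lmax)))
       * (2 powr ((real d + 1) / 2) / lmin)
       * exp ((nb + nb ^ 2) * T / lmax)"

definition Lambda1 :: "nat \<Rightarrow> nat \<Rightarrow> real \<Rightarrow> real \<Rightarrow> real \<Rightarrow> real \<Rightarrow> real \<Rightarrow> real" where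
  "Lambda1 d m nb lmin lmax L0 T =
     max (Lambda1A d nb lmin lmax L0 T) (Lambda1B d m nb lmin lmax L0 T)"

definition Lambda2 :: "nat \<Rightarrow> nat \<Rightarrow> real \<Rightarrow> real \<Rightarrow> real \<Rightarrow> real \<Rightarrow> real \<Rightarrow> real" where
  "Lambda2 d m nb lmin lmax L0 T =
     exp (nb * T / (2 * lmax)) *
     (\<Sum>i. (Lambda1 d m nb lmin lmax L0 T * sqrt (pi * T)
              * ((1 + 24 * real d) * lmax / lmin) ^ d) ^ i
            / Gamma (1 + real i / 2))"

definition kappa0 :: "nat \<Rightarrow> real \<Rightarrow> real" where
  "kappa0 d lmax = 4 * (1 + 24 * real d) * lmax"

definition Lambda3 :: "nat \<Rightarrow> nat \<Rightarrow> real \<Rightarrow> real \<Rightarrow> real \<Rightarrow> real \<Rightarrow> real \<Rightarrow> real" where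
  "Lambda3 d m nb lmin lmax L0 T =
     Lambda2 d m nb lmin lmax L0 T * exp (nb ^ 2 / (2 * lmax))
       * (kappa0 d lmax / (2 * lmin)) powr (real d / 2)"

definition gamma0 :: "nat \<Rightarrow> real \<Rightarrow> real \<Rightarrow> real" where
  "gamma0 d p q = 1 / (1 - 1 / q - real d / (2 * p))"

definition alpha0 ::
    "nat \<Rightarrow> nat \<Rightarrow> real \<Rightarrow> real \<Rightarrow> real \<Rightarrow> real \<Rightarrow> real \<Rightarrow> real \<Rightarrow> real \<Rightarrow> real" where
  "alpha0 d m nb lmin lmax L0 T p q =
     (1 - 1 / p) powr (real d / 2 * (1 - 1 / p))
       / (lmin * (2 * pi) powr (1 / p)) powr (real d / 2)
     * (lmax powr (real d / 2 * (1 - 1 / p))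
        + Lambda3 d m nb lmin lmax L0 T
          * (gamma0 d p q * (1 - 1 / q)) powr ((q - 1) / q)
          * (kappa0 d lmax / 2) powr (real d / 2 * (1 - 1 / p)))"

end

theory Submission
  imports Defs
begin

text \<open>
  The law of the scheme, given the past up to time \<open>s\<close>, has at a later time \<open>r\<close> a density bounded by
  a constant times \<open>(2 * pi * lmin * (r - s)) powr (- d / 2)\<close>. On the grid this is the parametrix
  method: freezing the covariance at the terminal point \<open>z\<close> turns the chain into a Gaussian one, and
  one step of the difference costs a factor \<open>\<delta> / sqrt t\<close>, since \<open>\<sigma>\<close> is Lipschitz and the kernel at
  time \<open>t\<close> has width \<open>sqrt t\<close>. These errors sum to a multiple of \<open>sqrt t\<close>, hence are absorbed by
  induction on the number of steps for small times; the Markov property extends the bound to all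
  times. Hoelder's inequality in space and time then yields Krylov's estimate
  \<open>E (\<integral>\<^sub>s\<^sup>t \<bar>f\<bar> | F s) \<le> alpha0 * \<parallel>f\<parallel> * (t - s) powr (1 / gamma0)\<close>, and Khasminskii's lemma on
  intervals over which the right-hand side, times \<open>lam\<close>, is at most \<open>1 / 2\<close> gives a factor \<open>2\<close> for
  each of them.
\<close>

section \<open>Gaussian densities with elliptic covariance\<close>

text \<open>Only the supremum of the density is estimated, never its tails, and this lets the
  induction close: an error kernel is either bounded by its maximum or integrated against the law at
  an earlier time. No density is known to exist beforehand, so the induction speaks of integrals of
  narrow Gaussian kernels around \<open>z\<close>; a mollifier with covariance
  \<open>lmin * \<epsilon>\<close> acts like an additional time \<open>\<epsilon>\<close>. The
  constants found this way differ in form from the prescribed ones: the density constant grows like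
  \<open>T powr (d / 2)\<close>, while the series in \<open>Lambda2\<close> dominates
  \<open>exp (z\<^sup>2)\<close> for some number \<open>z\<close> of order at least
  \<open>sqrt T\<close>. This gap, together with the dimensional factors \<open>1 + 24 * d\<close>,
  leaves the room for the comparison. Two regularity problems remain: the scheme is only adapted,
  whereas Fubini's theorem needs joint measurability in time and path, and the iteration behind
  Khasminskii's lemma needs some finite bound to start from, so \<open>f\<close> is
  truncated.\<close>

definition elliptic :: "real \<Rightarrow> real \<Rightarrow> real ^ 'n ^ 'n \<Rightarrow> bool" where
  "elliptic lo hi A \<longleftrightarrow> 0 < lo \<and> transpose A = A \<and>
     (\<forall>\<xi>. lo * (\<xi> \<bullet> \<xi>) \<le> \<xi> \<bullet> (A *v \<xi>) \<and> \<xi> \<bullet> (A *v \<xi>) \<le> hi * (\<xi> \<bullet> \<xi>))"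

definition inv_form :: "real ^ 'n ^ 'n \<Rightarrow> real ^ 'n \<Rightarrow> real" where
  "inv_form A v = v \<bullet> (matrix_inv A *v v)"

text \<open>For elliptic \<open>A\<close> this is
  \<open>(2 * pi) powr (n / 2) * sqrt (det A)\<close>. With the integral as definition, estimates of
  it follow by comparing quadratic forms under the integral sign, and determinants never
  occur.\<close>

definition gauss_mass :: "real ^ 'n ^ 'n \<Rightarrow> real" where
  "gauss_mass A = enn2real (\<integral>\<^sup>+v. ennreal (exp (- inv_form A v / 2)) \<partial>lborel)"

definition gauss :: "real ^ 'n ^ 'n \<Rightarrow> real ^ 'n \<Rightarrow> real" where
  "gauss A v = exp (- inv_form A v / 2) / gauss_mass A"

lemma nn_integral_exp_norm_square:
  assumes c: "0 < c"
  shows "(\<integral>\<^sup>+v. ennreal (exp (- (norm (v::'a::euclidean_space))\<^sup>2 / (2 * c))) \<partial>lborel)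
     = ennreal ((2 * pi * c) powr (real DIM('a) / 2))"
proof -
  have 1: "(\<integral>\<^sup>+x. ennreal (exp (- x\<^sup>2 / (2 * c))) \<partial>lborel) = ennreal (sqrt (2 * pi * c))"
  proof -
    have "exp (- x\<^sup>2 / (2 * c)) = sqrt (2 * pi * c) * normal_density 0 (sqrt c) x" for x
      using c by (simp add: normal_density_def)
    then have "(\<integral>\<^sup>+x. ennreal (exp (- x\<^sup>2 / (2 * c))) \<partial>lborel)
      = (\<integral>\<^sup>+x. ennreal (sqrt (2 * pi * c)) * ennreal (normal_density 0 (sqrt c) x) \<partial>lborel)"
      using c by (simp add: ennreal_mult)
    also have "\<dots> = ennreal (sqrt (2 * pi * c)) * (\<integral>\<^sup>+x. ennreal (normal_density 0 (sqrt c) x) \<partial>lborel)"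
      by (rule nn_integral_cmult) simp
    also have "(\<integral>\<^sup>+x. ennreal (normal_density 0 (sqrt c) x) \<partial>lborel) = 1"
      using c prob_space.emeasure_space_1[OF prob_space_normal_density[of "sqrt c" 0]]
      by (simp add: emeasure_density)
    finally show ?thesis by simp
  qed
  have "exp (- (norm v)\<^sup>2 / (2 * c)) = (\<Prod>b\<in>Basis. exp (- (v \<bullet> b)\<^sup>2 / (2 * c)))" for v :: 'a
  proof -
    have "(norm v)\<^sup>2 = (\<Sum>b\<in>Basis. (v \<bullet> b)\<^sup>2)"
      by (metis (no_types, lifting) dot_square_norm euclidean_inner power2_eq_square sum.cong)
    then have "- (norm v)\<^sup>2 / (2 * c) = (\<Sum>b\<in>Basis. - (v \<bullet> b)\<^sup>2 / (2 * c))"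
      by (simp add: sum_negf sum_divide_distrib)
    then show ?thesis by (simp only: exp_sum[OF finite_Basis])
  qed
  then have "(\<integral>\<^sup>+v. ennreal (exp (- (norm (v::'a))\<^sup>2 / (2 * c))) \<partial>lborel)
    = (\<integral>\<^sup>+v. (\<Prod>b\<in>Basis. ennreal (exp (- (v \<bullet> b)\<^sup>2 / (2 * c)))) \<partial>(lborel::'a measure))"
    by (simp add: prod_ennreal)
  also have "\<dots> = (\<Prod>b\<in>(Basis::'a set). (\<integral>\<^sup>+x. ennreal (exp (- x\<^sup>2 / (2 * c))) \<partial>lborel))"
    by (rule nn_integral_lborel_prod) auto
  also have "\<dots> = ennreal (sqrt (2 * pi * c)) ^ DIM('a)" by (simp only: 1 prod_constant)
  also have "\<dots> = ennreal (sqrt (2 * pi * c) ^ DIM('a))" using c by (simp add: ennreal_power)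
  also have "sqrt (2 * pi * c) ^ DIM('a) = (2 * pi * c) powr (real DIM('a) / 2)"
    using c by (simp add: powr_half_sqrt[symmetric] powr_realpow[symmetric] powr_powr)
  finally show ?thesis .
qed

lemma symmetric_inner: "transpose A = A \<Longrightarrow> (x::real^'n) \<bullet> (A *v y) = (A *v x) \<bullet> y"
  by (metis dot_lmul_matrix vector_transpose_matrix)

lemma ellipticD:
  assumes "elliptic lo hi A"
  shows "0 < lo" "transpose A = A" "lo * (\<xi> \<bullet> \<xi>) \<le> \<xi> \<bullet> (A *v \<xi>)" "\<xi> \<bullet> (A *v \<xi>) \<le> hi * (\<xi> \<bullet> \<xi>)"
    "0 \<le> \<xi> \<bullet> (A *v \<xi>)"
  using assms by (auto simp: elliptic_def) (metis inner_ge_zero less_le_not_le mult_nonneg_nonneg order_trans linear)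

lemma elliptic_le:
  assumes "elliptic lo hi (A::real^'n^'n)" shows "lo \<le> hi"
proof -
  obtain i :: 'n where True by blast
  have "lo * (axis i 1 \<bullet> (axis i 1::real^'n)) \<le> hi * (axis i 1 \<bullet> (axis i 1::real^'n))"
    using ellipticD(3,4)[OF assms] by (meson order_trans)
  then show ?thesis by (simp add: inner_axis_axis)
qed

lemma elliptic_invertible:
  assumes "elliptic lo hi A" shows "invertible (A::real^'n^'n)"
proof -
  have "x = 0" if "A *v x = 0" for x
  proof -
    have "lo * (x \<bullet> x) \<le> 0" using ellipticD(3)[OF assms, of x] that by simp
    with ellipticD(1)[OF assms] show ?thesis
      by (metis inner_eq_zero_iff inner_ge_zero mult_pos_pos not_le order.not_eq_order_implies_strict)
  qed
  then show ?thesis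
    by (simp add: invertible_left_inverse matrix_left_invertible_ker)
qed

lemma elliptic_matrix_inv:
  assumes "elliptic lo hi A"
  shows "A *v (matrix_inv A *v v) = (v::real^'n)" "matrix_inv A *v (A *v v) = v"
proof -
  have "A ** matrix_inv A = mat 1 \<and> matrix_inv A ** A = mat 1"
    using elliptic_invertible[OF assms] unfolding invertible_def matrix_inv_def by (rule someI_ex)
  then show "A *v (matrix_inv A *v v) = v" "matrix_inv A *v (A *v v) = v"
    by (simp_all add: matrix_vector_mul_assoc)
qed

text \<open>Legendre duality: \<open>inv_form A v\<close> is the maximum of the left-hand side over \<open>\<xi>\<close>.\<close>

lemma inv_form_ge:
  assumes "elliptic lo hi A"
  shows "2 * (\<xi> \<bullet> v) - \<xi> \<bullet> (A *v \<xi>) \<le> inv_form A v"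
proof -
  define u where "u = matrix_inv A *v v"
  have v: "A *v u = v" using elliptic_matrix_inv(1)[OF assms] by (simp add: u_def)
  have "0 \<le> (\<xi> - u) \<bullet> (A *v (\<xi> - u))" by (rule ellipticD(5)[OF assms])
  also have "\<dots> = \<xi> \<bullet> (A *v \<xi>) - \<xi> \<bullet> v - u \<bullet> (A *v \<xi>) + u \<bullet> v"
    by (simp add: matrix_vector_mult_diff_distrib inner_diff v)
  also have "u \<bullet> (A *v \<xi>) = \<xi> \<bullet> v"
    using symmetric_inner[OF ellipticD(2)[OF assms], of u \<xi>] v by (simp add: inner_commute)
  finally show ?thesis by (simp add: inv_form_def u_def inner_commute)
qed

text \<open>Inversion reverses the order of positive definite forms: the dual maximum for
  \<open>A\<close> is tested at \<open>u / c\<close>, where \<open>u\<close> is the maximiser for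
  \<open>B\<close>.\<close>

lemma inv_form_antimono:
  assumes A: "elliptic lo hi A" and B: "elliptic lo' hi' B" and c: "0 < c"
    and le: "\<And>\<xi>. \<xi> \<bullet> (A *v \<xi>) \<le> c * (\<xi> \<bullet> (B *v \<xi>))"
  shows "inv_form B v \<le> c * inv_form A v"
proof -
  define u where "u = matrix_inv B *v v"
  have v: "B *v u = v" using elliptic_matrix_inv(1)[OF B] by (simp add: u_def)
  have "2 * ((u /\<^sub>R c) \<bullet> v) - (u /\<^sub>R c) \<bullet> (A *v (u /\<^sub>R c)) \<le> inv_form A v"
    by (rule inv_form_ge[OF A])
  moreover have "(u /\<^sub>R c) \<bullet> (A *v (u /\<^sub>R c)) \<le> (u \<bullet> v) / c"
  proof -
    have "u \<bullet> (A *v u) \<le> c * (u \<bullet> v)" using le[of u] by (simp add: v)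
    then show ?thesis using c by (simp add: matrix_vector_mult_scaleR field_simps)
  qed
  moreover have "2 * ((u /\<^sub>R c) \<bullet> v) = 2 * (u \<bullet> v) / c" by (simp add: divide_inverse)
  ultimately have "(u \<bullet> v) / c \<le> inv_form A v" by simp
  moreover have "inv_form B v = u \<bullet> v" by (simp add: inv_form_def u_def inner_commute)
  ultimately show ?thesis using c by (simp add: field_simps)
qed

lemma mat_mult_vec: "mat c *v v = c *\<^sub>R (v::real^'n)"
  by (simp add: vec_eq_iff matrix_vector_mult_def mat_def if_distrib[where f="\<lambda>x. x * _"] cong: if_cong)

lemma elliptic_scaled_id: "0 < c \<Longrightarrow> elliptic c c (mat c)"
  by (simp add: elliptic_def transpose_mat mat_mult_vec)

lemma inv_form_mat:
  assumes "0 < c" shows "inv_form (mat c) v = (norm (v::real^'n))\<^sup>2 / c"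
proof -
  have "c *\<^sub>R (matrix_inv (mat c) *v v) = v"
    using elliptic_matrix_inv(1)[OF elliptic_scaled_id[OF assms], of v] by (simp add: mat_mult_vec)
  then have "matrix_inv (mat c) *v v = (1 / c) *\<^sub>R v"
    using assms by (metis divide_self_if less_numeral_extra(3) scaleR_one scaleR_scaleR times_divide_eq_left mult_1)
  then show ?thesis by (simp add: inv_form_def power2_norm_eq_inner)
qed

lemma inv_form_bounds:
  assumes A: "elliptic lo hi (A::real^'n^'n)"
  shows "(norm v)\<^sup>2 / hi \<le> inv_form A v" "inv_form A v \<le> (norm v)\<^sup>2 / lo"
proof -
  have lo: "0 < lo" "0 < hi" using ellipticD(1)[OF A] elliptic_le[OF A] by auto
  have "inv_form (mat hi) v \<le> 1 * inv_form A v"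
    by (rule inv_form_antimono[OF A elliptic_scaled_id[OF lo(2)]])
       (use ellipticD(4)[OF A] in \<open>simp_all add: mat_mult_vec\<close>)
  then show "(norm v)\<^sup>2 / hi \<le> inv_form A v" using lo by (simp add: inv_form_mat)
  have "inv_form A v \<le> 1 * inv_form (mat lo) v"
    by (rule inv_form_antimono[OF elliptic_scaled_id[OF lo(1)] A])
       (use ellipticD(3)[OF A] in \<open>simp_all add: mat_mult_vec\<close>)
  then show "inv_form A v \<le> (norm v)\<^sup>2 / lo" using lo by (simp add: inv_form_mat)
qed

lemma continuous_inv_form [continuous_intros]: "continuous_on S (inv_form A)"
  unfolding inv_form_def by (intro continuous_intros matrix_vector_mult_linear_continuous_on)

lemma inv_form_measurable [measurable]: "inv_form A \<in> borel_measurable borel"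
  by (rule borel_measurable_continuous_onI[OF continuous_inv_form])

lemma gauss_measurable [measurable]: "gauss A \<in> borel_measurable borel"
  unfolding gauss_def by measurable

lemma gauss_mass_bounds:
  assumes A: "elliptic lo hi (A::real^'n^'n)"
  shows "(\<integral>\<^sup>+v. ennreal (exp (- inv_form A v / 2)) \<partial>lborel) = ennreal (gauss_mass A)"
    "(2 * pi * lo) powr (real CARD('n) / 2) \<le> gauss_mass A"
    "gauss_mass A \<le> (2 * pi * hi) powr (real CARD('n) / 2)"
    "0 < gauss_mass A"
proof -
  let ?I = "\<integral>\<^sup>+v. ennreal (exp (- inv_form A v / 2)) \<partial>lborel"
  have lo: "0 < lo" "0 < hi" using ellipticD(1)[OF A] elliptic_le[OF A] by auto
  have "?I \<le> (\<integral>\<^sup>+v. ennreal (exp (- (norm v)\<^sup>2 / (2 * hi))) \<partial>(lborel::(real^'n) measure))"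
    using inv_form_bounds(1)[OF A] by (intro nn_integral_mono ennreal_leI) (simp add: field_simps lo)
  also have "\<dots> = ennreal ((2 * pi * hi) powr (real CARD('n) / 2))"
    using nn_integral_exp_norm_square[OF lo(2), where 'a="real^'n"] by simp
  finally have up: "?I \<le> ennreal ((2 * pi * hi) powr (real CARD('n) / 2))" .
  \<comment> \<open>The upper bound \<open>up\<close> gives finiteness, which makes
    \<open>enn2real\<close> in the definition of the mass lossless.\<close>
  then show I: "?I = ennreal (gauss_mass A)"
    unfolding gauss_mass_def by (subst ennreal_enn2real) (auto simp: top.not_eq_extremum elim!: order.strict_trans1)
  show "gauss_mass A \<le> (2 * pi * hi) powr (real CARD('n) / 2)"
    using up unfolding I by (simp add: ennreal_le_iff)
  have "ennreal ((2 * pi * lo) powr (real CARD('n) / 2)) =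
      (\<integral>\<^sup>+v. ennreal (exp (- (norm v)\<^sup>2 / (2 * lo))) \<partial>(lborel::(real^'n) measure))"
    using nn_integral_exp_norm_square[OF lo(1), where 'a="real^'n"] by simp
  also have "\<dots> \<le> ?I"
    using inv_form_bounds(2)[OF A] by (intro nn_integral_mono ennreal_leI) (simp add: field_simps lo)
  finally show *: "(2 * pi * lo) powr (real CARD('n) / 2) \<le> gauss_mass A"
    unfolding I by (simp add: ennreal_le_iff gauss_mass_def)
  show "0 < gauss_mass A"
    by (rule less_le_trans[OF _ *]) (use lo in simp)
qed

lemma gauss_pos: "elliptic lo hi A \<Longrightarrow> 0 < gauss A v"
  by (simp add: gauss_def gauss_mass_bounds(4))

lemma nn_integral_gauss:
  assumes "elliptic lo hi A" shows "(\<integral>\<^sup>+v. ennreal (gauss A v) \<partial>lborel) = 1"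
proof -
  have "(\<integral>\<^sup>+v. ennreal (gauss A v) \<partial>lborel)
    = (\<integral>\<^sup>+v. ennreal (exp (- inv_form A v / 2)) / ennreal (gauss_mass A) \<partial>lborel)"
    using gauss_mass_bounds(4)[OF assms] by (simp add: gauss_def divide_ennreal)
  also have "\<dots> = ennreal (gauss_mass A) / ennreal (gauss_mass A)"
    by (subst nn_integral_divide) (simp, simp only: gauss_mass_bounds(1)[OF assms])
  finally show ?thesis using gauss_mass_bounds(4)[OF assms] by (simp add: ennreal_divide_self)
qed

lemma gauss_le:
  assumes A: "elliptic lo hi (A::real^'n^'n)"
  shows "gauss A v \<le> exp (- (norm v)\<^sup>2 / (2 * hi)) / (2 * pi * lo) powr (real CARD('n) / 2)"
proof -
  have lo: "0 < lo" "0 < hi" using ellipticD(1)[OF A] elliptic_le[OF A] by auto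
  show ?thesis unfolding gauss_def
    using inv_form_bounds(1)[OF A, of v] lo gauss_mass_bounds(2)[OF A]
    by (intro frac_le) (auto simp: field_simps)
qed

text \<open>The dilation by \<open>sqrt c\<close> turns \<open>inv_form A\<close> into
  \<open>c * inv_form A\<close>, which dominates \<open>inv_form B\<close>, and its Jacobian is the
  power of \<open>c\<close>. This takes the place of monotonicity of the determinant.\<close>

lemma gauss_mass_mono:
  assumes A: "elliptic lo hi A" and B: "elliptic lo' hi' B" and c: "0 < c"
    and le: "\<And>\<xi>. \<xi> \<bullet> (A *v \<xi>) \<le> c * (\<xi> \<bullet> (B *v \<xi>))"
  shows "gauss_mass A \<le> c powr (real CARD('n) / 2) * gauss_mass (B::real^'n^'n)"
proof -
  let ?s = "sqrt c"
  have "ennreal (gauss_mass A) = (\<integral>\<^sup>+v. ennreal (exp (- inv_form A v / 2)) \<partial>lborel)"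
    by (simp only: gauss_mass_bounds(1)[OF A])
  also have "\<dots> = (\<integral>\<^sup>+v. ennreal (exp (- inv_form A v / 2))
      \<partial>(density (distr lborel borel (\<lambda>x. 0 + ?s *\<^sub>R x)) (\<lambda>_. \<bar>?s\<bar> ^ DIM(real^'n))))"
    using lborel_affine[of ?s "0::real^'n"] c by simp
  also have "\<dots> = (\<integral>\<^sup>+v. ennreal (?s ^ CARD('n)) * ennreal (exp (- inv_form A (?s *\<^sub>R v) / 2)) \<partial>lborel)"
    using c by (simp add: nn_integral_density nn_integral_distr)
  also have "\<dots> = ennreal (?s ^ CARD('n)) * (\<integral>\<^sup>+v. ennreal (exp (- inv_form A (?s *\<^sub>R v) / 2)) \<partial>lborel)"
    by (rule nn_integral_cmult) measurable
  also have "\<dots> \<le> ennreal (?s ^ CARD('n)) * (\<integral>\<^sup>+v. ennreal (exp (- inv_form B v / 2)) \<partial>lborel)"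
  proof (intro mult_left_mono nn_integral_mono ennreal_leI)
    fix v
    have "inv_form A (?s *\<^sub>R v) = c * inv_form A v"
      using c by (simp add: inv_form_def matrix_vector_mult_scaleR)
    then show "exp (- inv_form A (?s *\<^sub>R v) / 2) \<le> exp (- inv_form B v / 2)"
      using inv_form_antimono[OF A B c le, of v] by simp
  qed simp
  also have "\<dots> = ennreal (?s ^ CARD('n) * gauss_mass B)"
    using c gauss_mass_bounds(4)[OF B] by (simp only: gauss_mass_bounds(1)[OF B]) (simp add: ennreal_mult)
  also have "?s ^ CARD('n) = c powr (real CARD('n) / 2)"
    using c by (simp add: powr_half_sqrt[symmetric] powr_realpow[symmetric] powr_powr)
  finally show ?thesis using c gauss_mass_bounds(4)[OF B] by (simp add: ennreal_le_iff)
qed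

text \<open>By ellipticity an absolute perturbation \<open>\<theta>\<close> of the form is a
  relative one, by the factor \<open>c = 1 + \<theta> / lo\<close> in both directions. One direction
  controls the exponent and the other the mass; the logarithm keeps the two contributions
  additive.\<close>

lemma ln_gauss_diff_le:
  fixes v :: "real^'n"
  assumes A: "elliptic lo hi A" and B: "elliptic lo hi B"
    and \<theta>: "\<And>\<xi>. \<bar>\<xi> \<bullet> (A *v \<xi>) - \<xi> \<bullet> (B *v \<xi>)\<bar> \<le> \<theta> * (\<xi> \<bullet> \<xi>)" and \<theta>0: "0 \<le> \<theta>"
  shows "ln (gauss A v) - ln (gauss B v) \<le> \<theta> / (2 * lo) * ((norm v)\<^sup>2 / lo + real CARD('n))"
proof -
  have lo: "0 < lo" by (rule ellipticD(1)[OF A])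
  define c where "c = 1 + \<theta> / lo"
  have c: "1 \<le> c" using lo \<theta>0 by (simp add: c_def)
  have t: "\<theta> * (\<xi> \<bullet> \<xi>) \<le> \<theta> / lo * (\<xi> \<bullet> (A *v \<xi>))" "\<theta> * (\<xi> \<bullet> \<xi>) \<le> \<theta> / lo * (\<xi> \<bullet> (B *v \<xi>))" for \<xi>
    using mult_left_mono[OF ellipticD(3)[OF A, of \<xi>], of "\<theta> / lo"]
      mult_left_mono[OF ellipticD(3)[OF B, of \<xi>], of "\<theta> / lo"] lo \<theta>0 by auto
  have AB: "\<xi> \<bullet> (A *v \<xi>) \<le> c * (\<xi> \<bullet> (B *v \<xi>))" "\<xi> \<bullet> (B *v \<xi>) \<le> c * (\<xi> \<bullet> (A *v \<xi>))" for \<xi>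
    using t[of \<xi>] \<theta>[of \<xi>] by (auto simp: c_def algebra_simps)
  have "inv_form B v \<le> c * inv_form A v" by (rule inv_form_antimono[OF A B _ AB(1)]) (use c in auto)
  then have 1: "inv_form B v - inv_form A v \<le> \<theta> / lo * ((norm v)\<^sup>2 / lo)"
    using mult_left_mono[OF inv_form_bounds(2)[OF A, of v], of "\<theta> / lo"] lo \<theta>0
    by (simp add: c_def algebra_simps)
  have lnc: "real CARD('n) / 2 * ln c \<le> real CARD('n) / 2 * (\<theta> / lo)"
    using ln_le_minus_one[of c] c by (intro mult_left_mono) (simp_all add: c_def)
  have "ln (gauss_mass B) \<le> ln (c powr (real CARD('n) / 2) * gauss_mass A)"
    by (rule ln_mono[OF gauss_mass_mono[OF B A _ AB(2)]]) (use c gauss_mass_bounds(4)[OF B] in auto)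
  also have "\<dots> = real CARD('n) / 2 * ln c + ln (gauss_mass A)"
    using c gauss_mass_bounds(4)[OF A] by (simp add: ln_mult ln_powr)
  finally have "ln (gauss_mass B) - ln (gauss_mass A) \<le> real CARD('n) / 2 * (\<theta> / lo)"
    using lnc by linarith
  moreover have "ln (gauss A v) = - inv_form A v / 2 - ln (gauss_mass A)"
    "ln (gauss B v) = - inv_form B v / 2 - ln (gauss_mass B)"
    using gauss_mass_bounds(4)[OF A] gauss_mass_bounds(4)[OF B] by (simp_all add: gauss_def ln_div)
  moreover have "\<theta> / (2 * lo) * ((norm v)\<^sup>2 / lo + real CARD('n))
      = \<theta> / lo * ((norm v)\<^sup>2 / lo) / 2 + real CARD('n) / 2 * (\<theta> / lo)"
    using lo by (simp add: field_simps)
  moreover define a where "a = \<theta> / lo * ((norm v)\<^sup>2 / lo)"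
  moreover define b where "b = real CARD('n) / 2 * (\<theta> / lo)"
  ultimately show ?thesis using 1 unfolding a_def[symmetric] b_def[symmetric] by linarith
qed

section \<open>Density of a Brownian increment and its convolution with a Gaussian kernel\<close>

definition std_gauss_density :: "real \<Rightarrow> real ^ 'm \<Rightarrow> real" where
  "std_gauss_density h z = (\<Prod>i\<in>UNIV. normal_density 0 (sqrt h) (z $ i))"

lemma std_gauss_density_eq:
  assumes "0 < h"
  shows "std_gauss_density h (z::real^'m) = exp (- (norm z)\<^sup>2 / (2 * h)) / (2 * pi * h) powr (real CARD('m) / 2)"
proof -
  have "(norm z)\<^sup>2 = (\<Sum>i\<in>UNIV. (z $ i)\<^sup>2)"
    by (simp only: power2_norm_eq_inner inner_vec_def) (simp add: power2_eq_square)
  then have "- (norm z)\<^sup>2 / (2 * h) = (\<Sum>i\<in>UNIV. - (z $ i)\<^sup>2 / (2 * h))"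
    by (simp add: sum_negf sum_divide_distrib)
  then have "exp (- (norm z)\<^sup>2 / (2 * h)) = (\<Prod>i\<in>UNIV. exp (- (z $ i)\<^sup>2 / (2 * h)))"
    by (simp only: exp_sum[OF finite])
  moreover have "(2 * pi * h) powr (real CARD('m) / 2) = (\<Prod>i\<in>(UNIV::'m set). sqrt (2 * pi * h))"
    using assms by (simp add: powr_half_sqrt[symmetric] powr_realpow[symmetric] powr_powr)
  ultimately show ?thesis
    using assms by (simp add: std_gauss_density_def normal_density_def prod_dividef)
qed

lemma std_gauss_density_measurable [measurable]: "std_gauss_density h \<in> borel_measurable borel"
  unfolding std_gauss_density_def by measurable

lemma nn_integral_std_gauss_density:
  assumes "0 < h" shows "(\<integral>\<^sup>+z. ennreal (std_gauss_density h (z::real^'m)) \<partial>lborel) = 1"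
proof -
  have "ennreal (std_gauss_density h z) = ennreal (exp (- (norm z)\<^sup>2 / (2 * h))) / ennreal ((2 * pi * h) powr (real CARD('m) / 2))"
    for z :: "real^'m"
    using assms by (simp add: std_gauss_density_eq divide_ennreal)
  then have "(\<integral>\<^sup>+z. ennreal (std_gauss_density h (z::real^'m)) \<partial>lborel)
     = (\<integral>\<^sup>+z. ennreal (exp (- (norm (z::real^'m))\<^sup>2 / (2 * h))) \<partial>lborel) / ennreal ((2 * pi * h) powr (real CARD('m) / 2))"
    by (simp add: nn_integral_divide)
  then show ?thesis
    using assms nn_integral_exp_norm_square[OF assms, where 'a="real^'m"] by (simp add: ennreal_divide_self)
qed

lemma transpose_mult_inner: "(v::real^'n) \<bullet> (S *v z) = (transpose S *v v) \<bullet> z"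
  by (metis dot_lmul_matrix vector_transpose_matrix transpose_transpose)

text \<open>Completing the square shows that the integral is a constant multiple of the right-hand side;
  integrating over \<open>v\<close> identifies the constant, so no determinant is needed.\<close>

lemma gauss_convolution:
  fixes S :: "real ^ 'm ^ 'n"
  assumes A: "elliptic lo hi A" and h: "0 < h"
    and B: "elliptic lo' hi' (A + h *\<^sub>R (S ** transpose S))"
  shows "(\<integral>\<^sup>+z. ennreal (gauss A (v - S *v z) * std_gauss_density h z) \<partial>lborel)
    = ennreal (gauss (A + h *\<^sub>R (S ** transpose S)) v)"
proof -
  define C where "C = A + h *\<^sub>R (S ** transpose S)"
  note B' = B[folded C_def]
  define c where "c = (2 * pi * h) powr (real CARD('m) / 2)"
  have c: "0 < c" using h by (simp add: c_def)
  define k where "k y = exp (- (inv_form A (S *v y) + (norm y)\<^sup>2 / h) / 2) / (gauss_mass A * c)" for y :: "real^'m"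
  define K where "K = (\<integral>\<^sup>+y. ennreal (k y) \<partial>lborel)"
  have [measurable]: "(\<lambda>z. S *v z) \<in> borel_measurable borel"
    by (intro borel_measurable_continuous_onI matrix_vector_mult_linear_continuous_on)
  have k: "k \<in> borel_measurable borel" unfolding k_def by measurable
  \<comment> \<open>The shift \<open>h *\<^sub>R (transpose S *v (matrix_inv C *v v))\<close>
    minimises the joint exponent in \<open>z\<close> (it is the conditional mean of the increment
    given \<open>v\<close>), so the cross terms cancel and \<open>v\<close> separates from
    \<open>y\<close>.\<close>
  have square: "gauss A (v - S *v (h *\<^sub>R (transpose S *v (matrix_inv C *v v)) + y))
      * std_gauss_density h (h *\<^sub>R (transpose S *v (matrix_inv C *v v)) + y)
      = exp (- inv_form C v / 2) * k y" for v y
  proof -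
    define u where "u = matrix_inv C *v v"
    have v: "v = C *v u" using elliptic_matrix_inv(1)[OF B', of v] by (simp add: u_def)
    have 1: "v - S *v (h *\<^sub>R (transpose S *v u) + y) = A *v u - S *v y"
      by (simp add: v C_def matrix_vector_right_distrib matrix_vector_mult_add_rdistrib
          matrix_vector_mult_scaleR scaleR_matrix_vector_assoc[symmetric] matrix_vector_mul_assoc
          del: transpose_matrix_vector)
    have inv_u: "matrix_inv A *v (A *v u - S *v y) = u - matrix_inv A *v (S *v y)"
      by (simp add: matrix_vector_mult_diff_distrib elliptic_matrix_inv(2)[OF A])
    have sym: "(A *v u) \<bullet> (matrix_inv A *v (S *v y)) = u \<bullet> (S *v y)"
      using symmetric_inner[OF ellipticD(2)[OF A], of u "matrix_inv A *v (S *v y)"]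
      by (simp add: elliptic_matrix_inv(1)[OF A])
    have 2: "inv_form A (A *v u - S *v y) = u \<bullet> (A *v u) - 2 * (u \<bullet> (S *v y)) + inv_form A (S *v y)"
      unfolding inv_form_def inv_u by (simp add: inner_diff sym inner_commute)
    define t where "t = transpose S *v u"
    have t: "u \<bullet> (S *v y) = t \<bullet> y" "u \<bullet> (S *v t) = t \<bullet> t"
      unfolding t_def by (rule transpose_mult_inner)+
    have 3: "(norm (h *\<^sub>R (transpose S *v u) + y))\<^sup>2 / h
        = h * ((transpose S *v u) \<bullet> (transpose S *v u)) + 2 * (u \<bullet> (S *v y)) + (norm y)\<^sup>2 / h"
      unfolding t_def[symmetric] t using h
      by (simp add: power2_norm_eq_inner inner_add inner_commute[of y t] field_simps)
    have Cu: "C *v u = A *v u + h *\<^sub>R (S *v t)"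
      unfolding t_def by (simp add: C_def matrix_vector_mult_add_rdistrib
          scaleR_matrix_vector_assoc[symmetric] matrix_vector_mul_assoc del: transpose_matrix_vector)
    have "inv_form C v = u \<bullet> (C *v u)"
      unfolding inv_form_def u_def[symmetric] using v by (simp add: inner_commute)
    then have 4: "inv_form C v = u \<bullet> (A *v u) + h * ((transpose S *v u) \<bullet> (transpose S *v u))"
      unfolding t_def[symmetric] by (simp add: Cu inner_add_right t)
    have "inv_form A (A *v u - S *v y) + (norm (h *\<^sub>R (transpose S *v u) + y))\<^sup>2 / h
        = inv_form C v + (inv_form A (S *v y) + (norm y)\<^sup>2 / h)"
      unfolding 2 3 4 by simp
    then have e: "- inv_form A (A *v u - S *v y) / 2 + - (norm (h *\<^sub>R (transpose S *v u) + y))\<^sup>2 / (2 * h)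
        = - inv_form C v / 2 + - (inv_form A (S *v y) + (norm y)\<^sup>2 / h) / 2"
      using h by (simp add: field_simps)
    show ?thesis
      unfolding u_def[symmetric] 1 gauss_def std_gauss_density_eq[OF h] k_def c_def[symmetric]
      using arg_cong[OF e, of exp, unfolded exp_add] by (simp only: times_divide_times_eq times_divide_eq_right times_divide_eq_left divide_divide_eq_left)
  qed
  have conv: "(\<integral>\<^sup>+z. ennreal (gauss A (v - S *v z) * std_gauss_density h z) \<partial>lborel)
      = ennreal (exp (- inv_form C v / 2)) * K" for v
  proof -
    let ?z = "h *\<^sub>R (transpose S *v (matrix_inv C *v v))"
    have "(\<integral>\<^sup>+z. ennreal (gauss A (v - S *v z) * std_gauss_density h z) \<partial>lborel)
      = (\<integral>\<^sup>+z. ennreal (gauss A (v - S *v z) * std_gauss_density h z) \<partial>(distr lborel borel ((+) ?z)))"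
      by (simp add: lborel_distr_plus)
    also have "\<dots> = (\<integral>\<^sup>+y. ennreal (gauss A (v - S *v (?z + y)) * std_gauss_density h (?z + y)) \<partial>lborel)"
      by (rule nn_integral_distr) measurable
    also have "\<dots> = (\<integral>\<^sup>+y. ennreal (exp (- inv_form C v / 2)) * ennreal (k y) \<partial>lborel)"
      by (simp only: square) (simp add: ennreal_mult')
    also have "\<dots> = ennreal (exp (- inv_form C v / 2)) * K"
      unfolding K_def using k by (intro nn_integral_cmult) measurable
    finally show ?thesis .
  qed
  have [measurable]: "(\<lambda>(v, z). v - S *v z) \<in> borel_measurable (borel \<Otimes>\<^sub>M borel)"
    unfolding borel_prod split_beta
    by (intro borel_measurable_continuous_onI continuous_intros
        continuous_on_compose2[OF matrix_vector_mult_linear_continuous_on, of UNIV]) auto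
  have "(\<integral>\<^sup>+v. ennreal (exp (- inv_form C v / 2)) * K \<partial>lborel)
     = (\<integral>\<^sup>+v. (\<integral>\<^sup>+z. ennreal (gauss A (v - S *v z) * std_gauss_density h z) \<partial>lborel) \<partial>lborel)"
    by (simp only: conv)
  also have "\<dots> = (\<integral>\<^sup>+z. (\<integral>\<^sup>+v. ennreal (gauss A (v - S *v z) * std_gauss_density h z) \<partial>lborel) \<partial>lborel)"
    by (rule lborel_pair.Fubini') measurable
  also have "\<dots> = (\<integral>\<^sup>+z. ennreal (std_gauss_density h (z::real^'m)) \<partial>lborel)"
  proof (rule nn_integral_cong)
    fix z :: "real^'m"
    have "(\<integral>\<^sup>+v. ennreal (gauss A (v - S *v z) * std_gauss_density h z) \<partial>lborel)
       = (\<integral>\<^sup>+v. ennreal (gauss A (v - S *v z)) \<partial>lborel) * ennreal (std_gauss_density h z)"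
      using gauss_pos[OF A] by (simp add: ennreal_mult' less_imp_le nn_integral_multc)
    also have "(\<integral>\<^sup>+v. ennreal (gauss A (v - S *v z)) \<partial>lborel)
       = (\<integral>\<^sup>+v. ennreal (gauss A v) \<partial>(distr lborel borel ((+) (- (S *v z)))))"
      by (subst nn_integral_distr) (simp_all add: add.commute)
    also have "\<dots> = 1" by (simp add: lborel_distr_plus nn_integral_gauss[OF A])
    finally show "(\<integral>\<^sup>+v. ennreal (gauss A (v - S *v z) * std_gauss_density h z) \<partial>lborel)
      = ennreal (std_gauss_density h z)" by simp
  qed
  also have "\<dots> = 1" by (rule nn_integral_std_gauss_density[OF h])
  also have "(\<integral>\<^sup>+v. ennreal (exp (- inv_form C v / 2)) * K \<partial>lborel) = ennreal (gauss_mass C) * K"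
    by (subst nn_integral_multc) (simp, simp only: gauss_mass_bounds(1)[OF B'])
  finally have K: "ennreal (gauss_mass C) * K = 1" .
  have "K = 1 / ennreal (gauss_mass C)"
    using K gauss_mass_bounds(4)[OF B']
    by (metis ennreal_mult_divide_eq ennreal_neq_top ennreal_eq_0_iff mult.commute not_le)
  then show ?thesis
    unfolding conv C_def[symmetric] gauss_def[of C] using gauss_mass_bounds(4)[OF B']
    by (simp add: divide_ennreal[symmetric] ennreal_times_divide)
qed

section \<open>Bounds on a law from its mollifications\<close>

text \<open>For a scalar matrix the lower and the upper bound on the mass coincide, so the mass is
  known exactly.\<close>

lemma gauss_mat:
  assumes "0 < c"
  shows "gauss (mat c) (v::real^'n) = exp (- (norm v)\<^sup>2 / (2 * c)) / (2 * pi * c) powr (real CARD('n) / 2)"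
proof -
  have "gauss_mass (mat c :: real^'n^'n) = (2 * pi * c) powr (real CARD('n) / 2)"
    using gauss_mass_bounds(2,3)[OF elliptic_scaled_id[OF assms]] by (rule order.antisym[rotated])
  then show ?thesis using assms by (simp add: gauss_def inv_form_mat)
qed

lemma gauss_minus: "gauss A (- v) = gauss A (v::real^'n)"
proof -
  have "matrix_inv A *v (- v) = - (matrix_inv A *v v)"
    using matrix_vector_mult_diff_distrib[of "matrix_inv A" 0 v] by simp
  then show ?thesis by (simp add: gauss_def inv_form_def)
qed

text \<open>Rescaling by \<open>sqrt (r n)\<close> makes the kernel independent of \<open>n\<close>.
  For each fixed \<open>y\<close> the point \<open>x + sqrt (r n) *\<^sub>R y\<close> eventually
  lies in the open set \<open>U\<close>, so Fatou's lemma applies.\<close>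

lemma mollifier_liminf:
  assumes U: "open U" "x \<in> U" and r: "r \<longlonglongrightarrow> 0" "\<And>n. 0 < r n"
  shows "1 \<le> liminf (\<lambda>n. \<integral>\<^sup>+z. indicator U z * ennreal (gauss (mat (r n)) (x - z)) \<partial>(lborel::(real^'n) measure))"
proof -
  have [measurable]: "U \<in> sets borel" using U by simp
  have eq: "(\<integral>\<^sup>+z. indicator U z * ennreal (gauss (mat (r n)) (x - z)) \<partial>lborel)
     = (\<integral>\<^sup>+y. indicator U (x + sqrt (r n) *\<^sub>R y) * ennreal (gauss (mat 1) y) \<partial>lborel)" for n
  proof -
    let ?s = "sqrt (r n)"
    have s: "0 < ?s" using r by simp
    have "(\<integral>\<^sup>+z. indicator U z * ennreal (gauss (mat (r n)) (x - z)) \<partial>lborel)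
      = (\<integral>\<^sup>+z. indicator U z * ennreal (gauss (mat (r n)) (x - z))
          \<partial>(density (distr lborel borel (\<lambda>y. x + ?s *\<^sub>R y)) (\<lambda>_. \<bar>?s\<bar> ^ DIM(real^'n))))"
      using lborel_affine[of ?s x] s by simp
    also have "\<dots> = (\<integral>\<^sup>+y. ennreal (?s ^ CARD('n)) * (indicator U (x + ?s *\<^sub>R y)
          * ennreal (gauss (mat (r n)) (- (?s *\<^sub>R y)))) \<partial>lborel)"
      using s by (simp add: nn_integral_density nn_integral_distr)
    also have "\<dots> = (\<integral>\<^sup>+y. indicator U (x + ?s *\<^sub>R y) * ennreal (gauss (mat 1) y) \<partial>lborel)"
    proof (intro nn_integral_cong)
      fix y :: "real^'n"
      have p: "?s ^ CARD('n) = (r n) powr (real CARD('n) / 2)"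
        using r(2)[of n] by (simp add: powr_half_sqrt[symmetric] powr_realpow[symmetric] powr_powr)
      have "?s ^ CARD('n) * gauss (mat (r n)) (?s *\<^sub>R y) = gauss (mat 1) y"
        using r(2)[of n] by (simp add: p gauss_mat powr_mult power_mult_distrib)
      then show "ennreal (?s ^ CARD('n)) * (indicator U (x + ?s *\<^sub>R y) * ennreal (gauss (mat (r n)) (- (?s *\<^sub>R y))))
         = indicator U (x + ?s *\<^sub>R y) * ennreal (gauss (mat 1) y)"
        using s by (simp add: gauss_minus ennreal_mult'[symmetric] mult.left_commute indicator_def)
    qed
    finally show ?thesis .
  qed
  have "1 = (\<integral>\<^sup>+y. ennreal (gauss (mat 1) (y::real^'n)) \<partial>lborel)"
    using nn_integral_gauss[OF elliptic_scaled_id[of 1]] by simp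
  also have "\<dots> \<le> (\<integral>\<^sup>+y. liminf (\<lambda>n. indicator U (x + sqrt (r n) *\<^sub>R y) * ennreal (gauss (mat 1) y)) \<partial>lborel)"
  proof (intro nn_integral_mono)
    fix y :: "real^'n"
    have "(\<lambda>n. x + sqrt (r n) *\<^sub>R y) \<longlonglongrightarrow> x + sqrt 0 *\<^sub>R y" by (intro tendsto_intros r)
    then have "(\<lambda>n. x + sqrt (r n) *\<^sub>R y) \<longlonglongrightarrow> x" by simp
    then have "eventually (\<lambda>n. x + sqrt (r n) *\<^sub>R y \<in> U) sequentially"
      using U topological_tendstoD by blast
    then show "ennreal (gauss (mat 1) y) \<le> liminf (\<lambda>n. indicator U (x + sqrt (r n) *\<^sub>R y) * ennreal (gauss (mat 1) y))"
      by (intro Liminf_bounded) (auto elim!: eventually_mono)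
  qed
  also have "\<dots> \<le> liminf (\<lambda>n. \<integral>\<^sup>+y. indicator U (x + sqrt (r n) *\<^sub>R y) * ennreal (gauss (mat 1) y) \<partial>lborel)"
    by (rule nn_integral_liminf) measurable
  finally show ?thesis by (simp only: eq)
qed

text \<open>This yields absolute continuity and the density bound at once, as an inequality between
  measures. Fatou's lemma and the previous estimate bound the measure of open sets, and outer
  regularity of Lebesgue measure passes to Borel sets.\<close>

lemma nn_integral_le_of_mollified:
  fixes \<mu> :: "(real^'n) measure" and D :: real
  assumes fin: "finite_measure \<mu>" and sets [measurable_cong]: "sets \<mu> = sets borel"
    and e0: "0 < \<epsilon>0" and D: "0 \<le> D"
    and bound: "\<And>\<epsilon> z. 0 < \<epsilon> \<Longrightarrow> \<epsilon> \<le> \<epsilon>0 \<Longrightarrow> (\<integral>\<^sup>+x. ennreal (gauss (mat \<epsilon>) (x - z)) \<partial>\<mu>) \<le> ennreal D"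
    and g: "g \<in> borel_measurable borel"
  shows "(\<integral>\<^sup>+x. g x \<partial>\<mu>) \<le> ennreal D * integral\<^sup>N lborel g"
proof -
  interpret \<mu>: finite_measure \<mu> by fact
  interpret pair: pair_sigma_finite \<mu> "lborel :: (real^'n) measure" by unfold_locales
  define r where "r n = \<epsilon>0 / real (Suc n)" for n
  have r: "r \<longlonglongrightarrow> 0" "0 < r n" "r n \<le> \<epsilon>0" for n
    using e0 LIMSEQ_Suc[OF lim_const_over_n[of \<epsilon>0]] by (auto simp: r_def[abs_def] field_simps)
  have op: "emeasure \<mu> U \<le> ennreal D * emeasure lborel U" if U: "open U" for U
  proof -
    have [measurable]: "U \<in> sets borel" using U by simp
    have "emeasure \<mu> U = (\<integral>\<^sup>+x. indicator U x \<partial>\<mu>)" by simp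
    also have "\<dots> \<le> (\<integral>\<^sup>+x. liminf (\<lambda>n. \<integral>\<^sup>+z. indicator U z * ennreal (gauss (mat (r n)) (x - z)) \<partial>lborel) \<partial>\<mu>)"
      by (intro nn_integral_mono) (use mollifier_liminf[OF U _ r(1,2)] in \<open>auto simp: indicator_def\<close>)
    also have "\<dots> \<le> liminf (\<lambda>n. \<integral>\<^sup>+x. (\<integral>\<^sup>+z. indicator U z * ennreal (gauss (mat (r n)) (x - z)) \<partial>lborel) \<partial>\<mu>)"
      by (rule nn_integral_liminf) measurable
    also have "\<dots> \<le> liminf (\<lambda>n. ennreal D * emeasure lborel U)"
    proof (intro Liminf_mono always_eventually allI)
      fix n
      have "(\<integral>\<^sup>+x. (\<integral>\<^sup>+z. indicator U z * ennreal (gauss (mat (r n)) (x - z)) \<partial>lborel) \<partial>\<mu>)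
         = (\<integral>\<^sup>+z. (\<integral>\<^sup>+x. indicator U z * ennreal (gauss (mat (r n)) (x - z)) \<partial>\<mu>) \<partial>lborel)"
        by (rule pair.Fubini'[symmetric]) measurable
      also have "\<dots> = (\<integral>\<^sup>+z. indicator U z * (\<integral>\<^sup>+x. ennreal (gauss (mat (r n)) (x - z)) \<partial>\<mu>) \<partial>lborel)"
        by (intro nn_integral_cong nn_integral_cmult) measurable
      also have "\<dots> \<le> (\<integral>\<^sup>+z. indicator U z * ennreal D \<partial>lborel)"
        by (intro nn_integral_mono mult_left_mono bound r) simp
      also have "\<dots> = ennreal D * emeasure lborel U" by (subst nn_integral_multc) (simp_all add: mult.commute)
      finally show "(\<integral>\<^sup>+x. (\<integral>\<^sup>+z. indicator U z * ennreal (gauss (mat (r n)) (x - z)) \<partial>lborel) \<partial>\<mu>)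
         \<le> ennreal D * emeasure lborel U" .
    qed
    also have "\<dots> = ennreal D * emeasure lborel U" by (simp add: Liminf_const)
    finally show ?thesis .
  qed
  have le: "emeasure \<mu> B \<le> ennreal D * emeasure lborel B" if B: "B \<in> sets borel" for B
  proof (rule ennreal_le_epsilon)
    fix e :: real assume e: "0 < e"
    \<comment> \<open>Dividing by \<open>D + 1\<close> instead of \<open>D\<close> covers
      \<open>D = 0\<close>.\<close>
    then have "0 < e / (D + 1)" using D by simp
    have split: "ennreal D * ennreal (e / (D + 1)) = ennreal (D * (e / (D + 1)))"
      using D e by (intro ennreal_mult[symmetric]) auto
    from outer_regular_lborel[OF B \<open>0 < e / (D + 1)\<close>] obtain U
      where U: "open U" "B \<subseteq> U" "emeasure lborel (U - B) < ennreal (e / (D + 1))" by auto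
    have "emeasure \<mu> B \<le> emeasure \<mu> U" using U B by (intro emeasure_mono) (auto simp: sets)
    also have "\<dots> \<le> ennreal D * emeasure lborel U" by (rule op) fact
    also have "emeasure lborel U \<le> emeasure lborel B + emeasure lborel (U - B)"
      using U B by (subst plus_emeasure) (auto simp: Un_absorb1)
    also have "\<dots> \<le> emeasure lborel B + ennreal (e / (D + 1))"
      using U by (intro add_left_mono) simp
    also have "ennreal D * (emeasure lborel B + ennreal (e / (D + 1)))
        = ennreal D * emeasure lborel B + ennreal (D * (e / (D + 1)))"
      by (simp only: distrib_left split)
    also have "D * (e / (D + 1)) \<le> e" using D e by (simp add: field_simps)
    finally show "emeasure \<mu> B \<le> ennreal D * emeasure lborel B + ennreal e"
      by (simp add: add_left_mono ennreal_leI mult_left_mono)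
  qed
  have "\<mu> \<le> scale_measure (ennreal D) lborel"
    by (subst le_measure) (auto simp: sets le_fun_def emeasure_notin_sets intro!: le)
  then have "(\<integral>\<^sup>+x. g x \<partial>\<mu>) \<le> (\<integral>\<^sup>+x. g x \<partial>(scale_measure (ennreal D) lborel))"
    by (intro nn_integral_mono_measure) (simp_all add: sets)
  also have "\<dots> = ennreal D * integral\<^sup>N lborel g"
    using g by (intro nn_integral_scale_measure) simp
  finally show ?thesis .
qed

section \<open>Integrating out a Brownian increment independent of the past\<close>

lemma matrix_vector_mult_continuous:
  "continuous_on UNIV (\<lambda>(S :: real^'m^'n, z). S *v z)"
  unfolding matrix_vector_mult_def split_beta by (intro continuous_intros)

lemma matrix_vector_mult_measurable [measurable (raw)]:
  assumes "S \<in> borel_measurable M" "Z \<in> borel_measurable M"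
  shows "(\<lambda>\<omega>. (S \<omega> :: real^'m^'n) *v Z \<omega>) \<in> borel_measurable M"
  using borel_measurable_continuous_Pair[OF assms matrix_vector_mult_continuous[unfolded split_beta]]
  by (simp add: split_beta)

text \<open>Freezing lemma: by independence the joint law of the past and the increment is a product
  measure, so the increment is integrated out by Fubini with the past held fixed.\<close>

lemma nn_integral_indep_increment:
  fixes W :: "real \<Rightarrow> 'w \<Rightarrow> real ^ 'm"
  assumes filt: "filtered_prob_space M F" and bm: "brownian_motion M F W"
    and s: "0 \<le> s" "s < t"
    and \<Phi>: "\<Phi> \<in> borel_measurable (F s \<Otimes>\<^sub>M borel)"
  shows "(\<integral>\<^sup>+\<omega>. \<Phi> (\<omega>, W t \<omega> - W s \<omega>) \<partial>M)
    = (\<integral>\<^sup>+\<omega>. (\<integral>\<^sup>+z. \<Phi> (\<omega>, z) * ennreal (std_gauss_density (t - s) z) \<partial>lborel) \<partial>M)"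
proof -
  interpret prob_space M using filt by (simp add: filtered_prob_space_def)
  have sub: "subalgebra M (F s)" using filt s by (simp add: filtered_prob_space_def)
  let ?Z = "\<lambda>\<omega>. W t \<omega> - W s \<omega>"
  let ?N = "density lborel (\<lambda>z :: real^'m. ennreal (std_gauss_density (t - s) z))"
  have ind: "indep_set (sets (F s)) (sets (vimage_algebra (space M) ?Z borel))"
    and dist: "distributed M lborel ?Z (\<lambda>z. ennreal (std_gauss_density (t - s) z))"
    using bm s by (auto simp: brownian_motion_def std_gauss_density_def)
  have Z: "?Z \<in> borel_measurable M" using distributed_measurable[OF dist] by simp
  \<comment> \<open>The identity into the smaller sigma-algebra \<open>F s\<close> serves as the
    random variable that carries the whole past.\<close>
  have idm: "(\<lambda>\<omega>. \<omega>) \<in> measurable M (F s)" by (rule measurable_from_subalg[OF sub]) simp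
  have spF: "space (F s) = space M" using sub by (simp add: subalgebra_def)
  interpret P: prob_space "distr M (F s) (\<lambda>\<omega>. \<omega>)" by (rule prob_space_distr[OF idm])
  interpret Q: prob_space "distr M borel ?Z" by (rule prob_space_distr[OF Z])
  have eq: "distr M (F s) (\<lambda>\<omega>. \<omega>) \<Otimes>\<^sub>M distr M borel ?Z = distr M (F s \<Otimes>\<^sub>M borel) (\<lambda>\<omega>. (\<omega>, ?Z \<omega>))"
  proof (rule pair_measure_eqI)
    fix A and B :: "(real^'m) set"
    assume "A \<in> sets (distr M (F s) (\<lambda>\<omega>. \<omega>))" "B \<in> sets (distr M borel ?Z)"
    then have A: "A \<in> sets (F s)" and B: "B \<in> sets borel" by auto
    have AM: "A \<subseteq> space M" "A \<in> sets M" using A sets.sets_into_space[OF A] spF sub by (auto simp: subalgebra_def)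
    have "?Z -` B \<inter> space M \<in> sets (vimage_algebra (space M) ?Z borel)"
      using B by (auto simp: sets_vimage_algebra2 intro!: in_vimage_algebra)
    then have "prob (A \<inter> (?Z -` B \<inter> space M)) = prob A * prob (?Z -` B \<inter> space M)"
      by (rule indep_setD[OF ind A])
    moreover have "(\<lambda>\<omega>. (\<omega>, ?Z \<omega>)) -` (A \<times> B) \<inter> space M = A \<inter> (?Z -` B \<inter> space M)" using AM by auto
    moreover have "(\<lambda>\<omega>. \<omega>) -` A \<inter> space M = A" using AM by auto
    ultimately show "emeasure (distr M (F s) (\<lambda>\<omega>. \<omega>)) A * emeasure (distr M borel ?Z) B
       = emeasure (distr M (F s \<Otimes>\<^sub>M borel) (\<lambda>\<omega>. (\<omega>, ?Z \<omega>))) (A \<times> B)"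
      using A B idm Z
      by (subst (1 2 3) emeasure_distr) (auto simp: emeasure_eq_measure ennreal_mult'[symmetric])
  qed (unfold_locales, simp cong: sets_pair_measure_cong)
  have dZ: "distr M borel ?Z = ?N"
    using distributed_distr_eq_density[OF dist] by (metis distr_cong sets_lborel)
  interpret N: prob_space ?N using Q.prob_space_axioms unfolding dZ .
  have [measurable]: "\<Phi> \<in> borel_measurable (F s \<Otimes>\<^sub>M borel)" by fact
  have "(\<integral>\<^sup>+\<omega>. \<Phi> (\<omega>, ?Z \<omega>) \<partial>M) = (\<integral>\<^sup>+p. \<Phi> p \<partial>(distr M (F s \<Otimes>\<^sub>M borel) (\<lambda>\<omega>. (\<omega>, ?Z \<omega>))))"
    by (rule nn_integral_distr[symmetric]) (use idm Z in measurable)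
  also have "\<dots> = (\<integral>\<^sup>+p. \<Phi> p \<partial>(distr M (F s) (\<lambda>\<omega>. \<omega>) \<Otimes>\<^sub>M ?N))" by (simp only: eq[symmetric] dZ)
  also have "\<dots> = (\<integral>\<^sup>+\<omega>. (\<integral>\<^sup>+z. \<Phi> (\<omega>, z) \<partial>?N) \<partial>(distr M (F s) (\<lambda>\<omega>. \<omega>)))"
    by (rule N.nn_integral_fst[symmetric]) (simp cong: measurable_cong_sets)
  also have "\<dots> = (\<integral>\<^sup>+\<omega>. (\<integral>\<^sup>+z. \<Phi> (\<omega>, z) \<partial>?N) \<partial>M)"
    by (rule nn_integral_distr[OF idm]) measurable
  also have "\<dots> = (\<integral>\<^sup>+\<omega>. (\<integral>\<^sup>+z. \<Phi> (\<omega>, z) * ennreal (std_gauss_density (t - s) z) \<partial>lborel) \<partial>M)"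
  proof (rule nn_integral_cong)
    fix \<omega> assume "\<omega> \<in> space M"
    then have [measurable]: "(\<lambda>z. \<Phi> (\<omega>, z)) \<in> borel_measurable borel"
      by (intro measurable_compose[OF measurable_Pair1' \<Phi>]) (simp add: spF)
    show "(\<integral>\<^sup>+z. \<Phi> (\<omega>, z) \<partial>?N) = (\<integral>\<^sup>+z. \<Phi> (\<omega>, z) * ennreal (std_gauss_density (t - s) z) \<partial>lborel)"
      by (subst nn_integral_density) (simp_all add: mult.commute)
  qed
  finally show ?thesis .
qed

section \<open>Comparison of Gaussian kernels\<close>

lemma gauss_translate_le:
  assumes A: "elliptic lo hi A"
  shows "ln (gauss A (v + y)) - ln (gauss A v) \<le> norm v * norm y / lo"
proof -
  have lo: "0 < lo" by (rule ellipticD(1)[OF A])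
  define u where "u = matrix_inv A *v y"
  have y: "A *v u = y" using elliptic_matrix_inv(1)[OF A] by (simp add: u_def)
  have v: "A *v (matrix_inv A *v v) = v" by (rule elliptic_matrix_inv(1)[OF A])
  have "lo * (norm u * norm u) \<le> norm u * norm y"
    using ellipticD(3)[OF A, of u] norm_cauchy_schwarz[of u y]
    by (simp add: y power2_norm_eq_inner[symmetric] power2_eq_square)
  then have u: "norm u \<le> norm y / lo" using lo by (cases "u = 0") (simp_all add: field_simps)
  have "y \<bullet> (matrix_inv A *v v) = u \<bullet> v"
    using symmetric_inner[OF ellipticD(2)[OF A], of u "matrix_inv A *v v"] by (simp add: y v)
  then have "inv_form A (v + y) = inv_form A v + 2 * (v \<bullet> u) + y \<bullet> u"
    by (simp add: inv_form_def matrix_vector_right_distrib inner_add u_def[symmetric] inner_commute)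
  moreover have "y \<bullet> u \<ge> 0" using ellipticD(5)[OF A, of u] by (simp add: y inner_commute)
  moreover have "- (v \<bullet> u) \<le> norm v * norm u" using norm_cauchy_schwarz[of "- v" u] by simp
  moreover have "ln (gauss A (v + y)) - ln (gauss A v) = (inv_form A v - inv_form A (v + y)) / 2"
    using gauss_mass_bounds(4)[OF A] by (simp add: gauss_def ln_div)
  ultimately have "ln (gauss A (v + y)) - ln (gauss A v) \<le> norm v * norm u" by (simp add: field_simps)
  also have "\<dots> \<le> norm v * norm y / lo" using mult_left_mono[OF u, of "norm v"] by simp
  finally show ?thesis .
qed

text \<open>Half of a Gaussian decay absorbs the polynomial factors of the one-step error. The
  constants are rational upper bounds for the maxima, obtained from
  \<open>1 + x \<le> exp x\<close>; for the cube this is applied to \<open>u\<^sup>2 / 24\<close>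
  and then cubed.\<close>

lemma mult_exp_neg_square_le:
  assumes "0 \<le> (u::real)"
  shows "u * exp (- u\<^sup>2 / 8) \<le> 3 / 2" "u ^ 3 * exp (- u\<^sup>2 / 8) \<le> 125 / 8"
proof -
  have *: "x * exp (- u\<^sup>2 / 8) \<le> c" if "x \<le> c * exp (u\<^sup>2 / 8)" for x c
    using mult_right_mono[OF that, of "exp (- u\<^sup>2 / 8)"] by (simp add: mult_exp_exp mult.assoc)
  have "2 / 3 * u \<le> 1 + u\<^sup>2 / 8"
    using zero_le_power2[of "u - 8 / 3"] by (simp add: power2_eq_square algebra_simps)
  also have "\<dots> \<le> exp (u\<^sup>2 / 8)" by (rule exp_ge_add_one_self)
  finally show "u * exp (- u\<^sup>2 / 8) \<le> 3 / 2" using *[of u "3 / 2"] by simp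
  have "u * (2 / 5) \<le> 1 + u\<^sup>2 / 24" using zero_le_power2[of "u - 24/5"]
    by (simp add: power2_eq_square algebra_simps)
  also have "\<dots> \<le> exp (u\<^sup>2 / 24)" by (rule exp_ge_add_one_self)
  finally have "(u * (2 / 5)) ^ 3 \<le> exp (u\<^sup>2 / 24) ^ 3" using assms by (intro power_mono) auto
  also have "\<dots> = exp (u\<^sup>2 / 8)" by (simp add: exp_of_nat_mult[symmetric])
  finally have "u ^ 3 \<le> 125 / 8 * exp (u\<^sup>2 / 8)" by (simp add: power_mult_distrib power3_eq_cube)
  then show "u ^ 3 * exp (- u\<^sup>2 / 8) \<le> 125 / 8" by (rule *)
qed

text \<open>A factor \<open>exp u\<close> on the right would be useless, because the
  \<open>u\<close> that occurs is unbounded in space. Here \<open>u\<close> enters linearly and is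
  multiplied by the Gaussian \<open>x\<close>, whose decay can absorb it.\<close>

lemma diff_le_ln_diff_mult:
  assumes "0 < x" "0 < (y::real)" "ln x - ln y \<le> u" shows "x \<le> y + u * x"
proof -
  have "x * (1 - u) \<le> x * (1 + (ln y - ln x))" using assms by (intro mult_left_mono) auto
  also have "\<dots> \<le> x * exp (ln y - ln x)" using assms by (intro mult_left_mono exp_ge_add_one_self) auto
  also have "\<dots> = y" using assms by (simp add: exp_diff)
  finally show ?thesis by (simp add: algebra_simps)
qed

text \<open>Doubling the variance in the exponent pays for the shift, by
  \<open>norm v ^ 2 \<le> 2 * norm (v + y) ^ 2 + 2 * norm y ^ 2\<close>. What is left is
  \<open>exp (1 / 16)\<close>, at most \<open>16 / 15\<close>.\<close>

lemma gauss_shift_le: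
  fixes A :: "real^'n^'n"
  assumes A: "elliptic lo hi A" and y: "(norm y)\<^sup>2 \<le> hi / 8"
  shows "gauss A (v + y) \<le> 16 / 15 * exp (- (norm v)\<^sup>2 / (4 * hi)) / (2 * pi * lo) powr (real CARD('n) / 2)"
proof -
  have lo: "0 < lo" "0 < hi" using ellipticD(1)[OF A] elliptic_le[OF A] by auto
  have "(norm v)\<^sup>2 \<le> 2 * (norm (v + y))\<^sup>2 + 2 * (norm y)\<^sup>2"
  proof -
    have "(norm (v + y + (- y)))\<^sup>2 \<le> (norm (v + y) + norm (- y))\<^sup>2"
      by (intro power_mono norm_triangle_ineq) auto
    also have "\<dots> \<le> 2 * (norm (v + y))\<^sup>2 + 2 * (norm y)\<^sup>2"
      using zero_le_power2[of "norm (v + y) - norm y"] by (simp add: power2_eq_square algebra_simps)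
    finally show ?thesis by simp
  qed
  then have "- (norm (v + y))\<^sup>2 / (2 * hi) \<le> - (norm v)\<^sup>2 / (4 * hi) + 1 / 16"
    using lo y by (simp add: field_simps)
  then have "exp (- (norm (v + y))\<^sup>2 / (2 * hi)) \<le> exp (1 / 16) * exp (- (norm v)\<^sup>2 / (4 * hi))"
    by (simp add: mult_exp_exp add.commute)
  also have "exp (1 / 16 :: real) \<le> 16 / 15"
    using exp_ge_add_one_self[of "- (1 / 16 :: real)"] by (simp add: exp_minus field_simps)
  finally have "exp (- (norm (v + y))\<^sup>2 / (2 * hi)) \<le> 16 / 15 * exp (- (norm v)\<^sup>2 / (4 * hi))" by simp
  then have "exp (- (norm (v + y))\<^sup>2 / (2 * hi)) / (2 * pi * lo) powr (real CARD('n) / 2)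
    \<le> 16 / 15 * exp (- (norm v)\<^sup>2 / (4 * hi)) / (2 * pi * lo) powr (real CARD('n) / 2)"
    by (rule divide_right_mono) simp
  then show ?thesis using gauss_le[OF A, of "v + y"] by simp
qed

text \<open>One step of the parametrix comparison: \<open>A\<close> is the covariance with the coefficients of the
  last step taken at \<open>w\<close>, \<open>B\<close> the one with all coefficients frozen at \<open>w - v\<close>.\<close>

lemma gauss_frozen_step_le:
  fixes A B :: "real^'n^'n"
  assumes lo: "0 < lmin" "lmin \<le> lmax" and t: "0 < \<delta>" "\<delta> \<le> t" and nb: "0 \<le> nb" "\<delta> * nb\<^sup>2 \<le> lmin / 8"
    and L0: "0 \<le> L0"
    and A: "elliptic (lmin * t) (lmax * t) A" and B: "elliptic (lmin * t) (lmax * t) B"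
    and AB: "\<And>\<xi>. \<bar>\<xi> \<bullet> (A *v \<xi>) - \<xi> \<bullet> (B *v \<xi>)\<bar> \<le> \<delta> * (2 * sqrt lmax * L0 * norm v) * (\<xi> \<bullet> \<xi>)"
    and y: "norm y \<le> \<delta> * nb"
  shows "gauss A (v + y) \<le> gauss B v
    + \<delta> / sqrt t * (19 * real CARD('n) * L0 * (lmax / lmin)\<^sup>2 + 2 * sqrt (lmax / lmin) * nb / sqrt lmin)
      * exp (- (norm v)\<^sup>2 / (8 * (lmax * t))) / (2 * pi * (lmin * t)) powr (real CARD('n) / 2)"
proof -
  define \<kappa> where "\<kappa> = lmax / lmin"
  define d where "d = real CARD('n)"
  define P where "P = (2 * pi * (lmin * t)) powr (real CARD('n) / 2)"
  have lmax: "0 < lmax" and t0: "0 < t" and \<kappa>: "1 \<le> \<kappa>" using lo t by (auto simp: \<kappa>_def)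
  have d: "1 \<le> d" by (simp add: d_def Suc_leI)
  have P: "0 < P" using lo t0 by (simp add: P_def)
  \<comment> \<open>Length in units of the width of the kernel at time \<open>t\<close>.\<close>
  define u where "u = norm v / sqrt (lmax * t)"
  have u0: "0 \<le> u" by (simp add: u_def lmax t0 less_imp_le)
  have v: "norm v = u * sqrt lmax * sqrt t" using lmax t0 by (simp add: u_def real_sqrt_mult)
  have u2: "u\<^sup>2 = (norm v)\<^sup>2 / (lmax * t)" using lmax t0 by (simp add: u_def power_divide)
  \<comment> \<open>The first summand is the cost of the drift shift \<open>y\<close>, the second
    the cost of replacing covariance \<open>A\<close> by \<open>B\<close>.\<close>
  define U where "U = norm v * norm y / (lmin * t)
     + \<delta> * (2 * sqrt lmax * L0 * norm v) / (2 * (lmin * t)) * ((norm v)\<^sup>2 / (lmin * t) + d)"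
  have "ln (gauss A (v + y)) - ln (gauss B v) \<le> U"
    using gauss_translate_le[OF A, of v y] ln_gauss_diff_le[OF A B AB, of v] t L0 lmax
    by (simp add: U_def d_def)
  then have 1: "gauss A (v + y) \<le> gauss B v + U * gauss A (v + y)"
    by (rule diff_le_ln_diff_mult[OF gauss_pos[OF A] gauss_pos[OF B]])
  have U0: "0 \<le> U" using lmax lo t0 t L0 d by (simp add: U_def)
  have "\<delta> * nb \<ge> 0" using t nb by simp
  then have "(norm y)\<^sup>2 \<le> (\<delta> * nb)\<^sup>2" using y by (intro power_mono) auto
  also have "\<dots> = \<delta> * (\<delta> * nb\<^sup>2)" by (simp add: power2_eq_square)
  also have "\<dots> \<le> t * (lmax / 8)" using nb lo t by (intro mult_mono) auto
  finally have y2: "(norm y)\<^sup>2 \<le> lmax * t / 8" by (simp add: mult.commute)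
  have 2: "U * gauss A (v + y) \<le> U * (16 / 15 * exp (- u\<^sup>2 / 4) / P)"
    using gauss_shift_le[OF A y2, of v] U0 unfolding u2 P_def
    by (intro mult_left_mono) (auto simp: mult_ac)
  \<comment> \<open>Both summands of \<open>U\<close> contain one unsquared factor
    \<open>norm v = u * sqrt lmax * sqrt t\<close> against \<open>t\<close> in the denominator,
    which leaves \<open>\<delta> / sqrt t\<close> times a polynomial in \<open>u\<close>.\<close>
  have Ule: "U \<le> \<delta> / sqrt t * (sqrt \<kappa> * nb / sqrt lmin * u + L0 * \<kappa> * (\<kappa> * u ^ 3 + d * u))"
  proof -
    have st: "t = sqrt t * sqrt t" "lmin = sqrt lmin * sqrt lmin" "lmax = sqrt lmax * sqrt lmax"
      using t0 lo lmax by auto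
    have "norm v * norm y / (lmin * t) \<le> norm v * (\<delta> * nb) / (lmin * t)"
      using y lo t0 by (intro divide_right_mono mult_left_mono) auto
    also have "\<dots> = \<delta> / sqrt t * (sqrt \<kappa> * nb / sqrt lmin * u)"
      unfolding v \<kappa>_def real_sqrt_divide by (subst (2) st(1), subst (1) st(2)) (use t0 lo in \<open>simp add: field_simps\<close>)
    finally have a: "norm v * norm y / (lmin * t) \<le> \<delta> / sqrt t * (sqrt \<kappa> * nb / sqrt lmin * u)" .
    have b: "(norm v)\<^sup>2 / (lmin * t) = \<kappa> * u\<^sup>2" using lmax t0 by (simp add: u2 \<kappa>_def)
    have c: "\<delta> * (2 * sqrt lmax * L0 * norm v) / (2 * (lmin * t)) = \<delta> / sqrt t * (L0 * \<kappa> * u)"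
    proof -
      have "\<delta> * (2 * sqrt lmax * L0 * norm v) / (2 * (lmin * t))
        = \<delta> * L0 * u * (sqrt lmax * sqrt lmax) / lmin * (sqrt t / t)"
        unfolding v by simp
      also have "sqrt t / t = 1 / sqrt t" using t0 by (simp add: real_div_sqrt field_simps)
      finally show ?thesis using lmax by (simp add: \<kappa>_def mult_ac)
    qed
    show ?thesis unfolding U_def b c using a
      by (simp add: distrib_left power3_eq_cube power2_eq_square mult_ac add_divide_distrib)
  qed
  have "U * (16 / 15 * exp (- u\<^sup>2 / 4) / P)
     \<le> \<delta> / sqrt t * (sqrt \<kappa> * nb / sqrt lmin * u + L0 * \<kappa> * (\<kappa> * u ^ 3 + d * u)) * (16 / 15 * exp (- u\<^sup>2 / 4) / P)"
    using Ule P by (intro mult_right_mono) auto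
  \<comment> \<open>The decay \<open>exp (- u\<^sup>2 / 4)\<close> is split in two equal halves: one
    absorbs the powers of \<open>u\<close>, the other remains as decay of the error kernel.\<close>
  also have "\<dots> = \<delta> / sqrt t * (16 / 15 * (sqrt \<kappa> * nb / sqrt lmin * (u * exp (- u\<^sup>2 / 8))
       + L0 * \<kappa> * (\<kappa> * (u ^ 3 * exp (- u\<^sup>2 / 8)) + d * (u * exp (- u\<^sup>2 / 8))))) * exp (- u\<^sup>2 / 8) / P"
  proof -
    have "exp (- u\<^sup>2 / 4) = exp (- u\<^sup>2 / 8) * exp (- u\<^sup>2 / 8)" by (simp add: mult_exp_exp)
    then show ?thesis by (simp add: algebra_simps add_divide_distrib)
  qed
  also have "\<dots> \<le> \<delta> / sqrt t * (19 * d * L0 * \<kappa>\<^sup>2 + 2 * sqrt \<kappa> * nb / sqrt lmin) * exp (- u\<^sup>2 / 8) / P"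
  proof -
    \<comment> \<open>The numbers 2 and 19 are \<open>16 / 15 * (3 / 2)\<close> and
      \<open>16 / 15 * (137 / 8)\<close> rounded up, with
      \<open>137 / 8 = 125 / 8 + 3 / 2\<close>.\<close>
    have comb: "16 / 15 * (p + q) \<le> 19 * x + 2 * r"
      if "p \<le> r * (3 / 2)" "q \<le> q'" "q' \<le> q''" "q'' = 137 / 8 * x" "0 \<le> x" "0 \<le> r" for p q q' q'' r x :: real
      using that by simp
    have "sqrt \<kappa> * nb / sqrt lmin * (u * exp (- u\<^sup>2 / 8)) \<le> sqrt \<kappa> * nb / sqrt lmin * (3 / 2)"
      using mult_exp_neg_square_le[OF u0] \<kappa> nb lo by (intro mult_left_mono) auto
    moreover have "L0 * \<kappa> * (\<kappa> * (u ^ 3 * exp (- u\<^sup>2 / 8)) + d * (u * exp (- u\<^sup>2 / 8))) \<le> L0 * \<kappa> * (\<kappa> * (125 / 8) + d * (3 / 2))"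
      using mult_exp_neg_square_le[OF u0] \<kappa> d L0 by (intro mult_left_mono add_mono) auto
    moreover have "L0 * \<kappa> * (\<kappa> * (125 / 8) + d * (3 / 2)) \<le> L0 * \<kappa> * (d * \<kappa> * (125 / 8 + 3 / 2))"
    proof (intro mult_left_mono)
      have "\<kappa> \<le> d * \<kappa>" "d \<le> d * \<kappa>" using d \<kappa> by auto
      then show "\<kappa> * (125 / 8) + d * (3 / 2) \<le> d * \<kappa> * (125 / 8 + 3 / 2)" unfolding distrib_left by linarith
    qed (use L0 \<kappa> in auto)
    moreover have "L0 * \<kappa> * (d * \<kappa> * (125 / 8 + 3 / 2)) = 137 / 8 * (d * L0 * \<kappa>\<^sup>2)"
      by (simp add: power2_eq_square)
    moreover have "0 \<le> d * L0 * \<kappa>\<^sup>2" "0 \<le> sqrt \<kappa> * nb / sqrt lmin" using d L0 nb \<kappa> lo by auto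
    ultimately have "16 / 15 * (sqrt \<kappa> * nb / sqrt lmin * (u * exp (- u\<^sup>2 / 8))
       + L0 * \<kappa> * (\<kappa> * (u ^ 3 * exp (- u\<^sup>2 / 8)) + d * (u * exp (- u\<^sup>2 / 8))))
      \<le> 19 * (d * L0 * \<kappa>\<^sup>2) + 2 * (sqrt \<kappa> * nb / sqrt lmin)" by (rule comb)
    also have "\<dots> = 19 * d * L0 * \<kappa>\<^sup>2 + 2 * sqrt \<kappa> * nb / sqrt lmin" by simp
    finally show ?thesis using P t t0 by (intro divide_right_mono mult_right_mono mult_left_mono) auto
  qed
  finally have 3: "U * (16 / 15 * exp (- u\<^sup>2 / 4) / P)
    \<le> \<delta> / sqrt t * (19 * d * L0 * \<kappa>\<^sup>2 + 2 * sqrt \<kappa> * nb / sqrt lmin) * exp (- u\<^sup>2 / 8) / P" .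
  have "- u\<^sup>2 / 8 = - (norm v)\<^sup>2 / (8 * (lmax * t))" by (simp add: u2)
  from order_trans[OF 1 add_left_mono[OF order_trans[OF 2 3]], unfolded this]
  show ?thesis unfolding P_def d_def \<kappa>_def .
qed

section \<open>One step of the scheme\<close>

lemma elliptic_add:
  assumes "elliptic lo hi A" "elliptic lo' hi' B" "0 \<le> h"
  shows "elliptic (lo + h * lo') (hi + h * hi') (A + h *\<^sub>R B)"
proof -
  have t: "transpose (A + h *\<^sub>R B) = A + h *\<^sub>R B"
    using ellipticD(2)[OF assms(1)] ellipticD(2)[OF assms(2)]
    by (simp add: transpose_def vec_eq_iff)
  have e: "\<xi> \<bullet> ((A + h *\<^sub>R B) *v \<xi>) = \<xi> \<bullet> (A *v \<xi>) + h * (\<xi> \<bullet> (B *v \<xi>))" for \<xi>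
    by (simp add: matrix_vector_mult_add_rdistrib inner_add_right scaleR_matrix_vector_assoc[symmetric])
  have "0 < lo + h * lo'" using ellipticD(1)[OF assms(1)] ellipticD(1)[OF assms(2)] assms(3)
    by (simp add: add_pos_nonneg)
  moreover have "(lo + h * lo') * (\<xi> \<bullet> \<xi>) \<le> \<xi> \<bullet> ((A + h *\<^sub>R B) *v \<xi>)
      \<and> \<xi> \<bullet> ((A + h *\<^sub>R B) *v \<xi>) \<le> (hi + h * hi') * (\<xi> \<bullet> \<xi>)" for \<xi>
    unfolding e distrib_right mult.assoc
    by (intro conjI add_mono mult_left_mono ellipticD(3,4)[OF assms(1)] ellipticD(3,4)[OF assms(2)] assms(3))
  ultimately show ?thesis using t by (simp add: elliptic_def)
qed

lemma norm_matrix_vector_le: "norm (S *v z) \<le> norm (S :: real^'m^'n) * norm z"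
proof -
  have "norm (S *v z) \<le> norm (\<chi> i. norm (S $ i) * norm z)"
  proof (rule norm_le_componentwise_cart)
    fix i
    have "(S *v z) $ i = S $ i \<bullet> z" by (simp add: matrix_vector_mul_component)
    then show "norm ((S *v z) $ i) \<le> norm ((\<chi> i. norm (S $ i) * norm z) $ i)"
      using Cauchy_Schwarz_ineq2[of "S $ i" z] by simp
  qed
  also have "(\<chi> i. norm (S $ i) * norm z) = norm z *\<^sub>R (\<chi> i. norm (S $ i))"
    by (simp add: vec_eq_iff mult.commute)
  also have "norm \<dots> = norm S * norm z"
    by (simp add: norm_vec_def[of S] norm_vec_def[of "\<chi> i. norm (S $ i)"] mult.commute)
  finally show ?thesis .
qed

lemma norm_transpose: "norm (transpose (S :: real^'m^'n)) = norm S"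
proof -
  have "norm S = sqrt (\<Sum>i\<in>UNIV. \<Sum>j\<in>UNIV. (S $ i $ j)\<^sup>2)" for S :: "real^'b^'a"
    by (simp add: norm_vec_def L2_set_def sum_nonneg)
  from this[of S] this[of "transpose S"] show ?thesis
    by (simp add: transpose_def) (rule sum.swap)
qed

text \<open>The scheme enters through its increments inside one grid cell. They hold almost surely
  for each fixed \<open>k\<close>, \<open>s\<close>, \<open>r\<close>, which is enough for
  expectations at fixed times. Here \<open>nb\<close> is any bound on the drift; the supremum norm
  is inserted at the end.\<close>

locale euler_scheme =
  fixes M :: "'w measure" and F :: "real \<Rightarrow> 'w measure"
    and W :: "real \<Rightarrow> 'w \<Rightarrow> real ^ 'm"
    and b :: "real ^ 'd \<Rightarrow> real ^ 'd" and \<sigma> :: "real ^ 'd \<Rightarrow> real ^ 'm ^ 'd"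
    and lmin lmax L0 nb \<delta> :: real and X :: "real \<Rightarrow> 'w \<Rightarrow> real ^ 'd"
  assumes filtered: "filtered_prob_space M F" and brownian: "brownian_motion M F W"
    and b_measurable [measurable]: "b \<in> borel_measurable borel" and b_bound: "norm (b x) \<le> nb"
    and A3: "assumption_A3 \<sigma> lmin lmax L0"
    and \<delta>: "0 < \<delta>" "\<delta> < 1" and X_adapted: "adapted_to F X"
    and increment: "real k * \<delta> \<le> s \<Longrightarrow> s \<le> r \<Longrightarrow> r \<le> real (k + 1) * \<delta> \<Longrightarrow>
      AE \<omega> in M. X r \<omega> = X s \<omega> + (r - s) *\<^sub>R b (X (real k * \<delta>) \<omega>)
        + \<sigma> (X (real k * \<delta>) \<omega>) *v (W r \<omega> - W s \<omega>)"
begin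

sublocale prob_space M using filtered by (simp add: filtered_prob_space_def)

definition cov :: "real ^ 'd \<Rightarrow> real ^ 'd ^ 'd" where "cov x = \<sigma> x ** transpose (\<sigma> x)"

lemma constants_pos: "0 < lmin" "0 < lmax" "0 < L0" using A3 by (auto simp: assumption_A3_def)

lemma nb_nonneg: "0 \<le> nb" using b_bound[of undefined] norm_ge_zero order_trans by blast

lemma cov_elliptic: "elliptic lmin lmax (cov x)"
proof -
  have "transpose (cov x) = cov x" by (simp add: cov_def matrix_transpose_mul)
  then show ?thesis
    using A3 unfolding elliptic_def assumption_A3_def cov_def
    by (auto simp: power2_norm_eq_inner inner_commute)
qed

lemma lmin_le_lmax: "lmin \<le> lmax" using elliptic_le[OF cov_elliptic] .

lemma sigma_Lipschitz: "norm (\<sigma> x - \<sigma> y) \<le> L0 * norm (x - y)"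
  using A3 by (auto simp: assumption_A3_def)

lemma sigma_measurable [measurable]: "\<sigma> \<in> borel_measurable borel"
proof -
  have "L0-lipschitz_on UNIV \<sigma>"
    using sigma_Lipschitz constants_pos by (intro lipschitz_onI) (auto simp: dist_norm)
  then show ?thesis
    by (intro borel_measurable_continuous_onI lipschitz_on_continuous_on)
qed

lemma cov_form: "\<xi> \<bullet> (cov x *v \<xi>) = (norm (transpose (\<sigma> x) *v \<xi>))\<^sup>2"
  by (simp add: cov_def matrix_vector_mul_assoc[symmetric] transpose_mult_inner power2_norm_eq_inner
      del: transpose_matrix_vector)

text \<open>The form is the square of \<open>norm (transpose (\<sigma> x) *v \<xi>)\<close>, so the
  difference factors as \<open>(p - p') * (p + p')\<close>: the first factor inherits the Lipschitz
  bound of \<open>\<sigma>\<close>, the second is at most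
  \<open>2 * sqrt lmax * norm \<xi>\<close>.\<close>

lemma cov_diff: "\<bar>\<xi> \<bullet> (cov x *v \<xi>) - \<xi> \<bullet> (cov y *v \<xi>)\<bar> \<le> 2 * sqrt lmax * L0 * norm (x - y) * (\<xi> \<bullet> \<xi>)"
proof -
  let ?p = "\<lambda>x. norm (transpose (\<sigma> x) *v \<xi>)"
  have p: "?p x \<le> sqrt lmax * norm \<xi>" for x
  proof -
    have "(?p x)\<^sup>2 \<le> lmax * (\<xi> \<bullet> \<xi>)"
      using ellipticD(4)[OF cov_elliptic, of \<xi> x] by (simp only: cov_form)
    also have "\<dots> = (sqrt lmax * norm \<xi>)\<^sup>2"
      using constants_pos by (simp add: power_mult_distrib power2_norm_eq_inner)
    finally show ?thesis by (rule power2_le_imp_le) (use constants_pos in simp)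
  qed
  have "\<bar>?p x - ?p y\<bar> \<le> norm (transpose (\<sigma> x) *v \<xi> - transpose (\<sigma> y) *v \<xi>)"
    by (rule norm_triangle_ineq3)
  also have "transpose (\<sigma> x) *v \<xi> - transpose (\<sigma> y) *v \<xi> = transpose (\<sigma> x - \<sigma> y) *v \<xi>"
    by (simp add: vec_eq_iff transpose_def matrix_vector_mult_def left_diff_distrib sum_subtractf del: transpose_matrix_vector)
  also have "norm \<dots> \<le> norm (\<sigma> x - \<sigma> y) * norm \<xi>"
    using norm_matrix_vector_le[of "transpose (\<sigma> x - \<sigma> y)" \<xi>] by (simp only: norm_transpose)
  also have "\<dots> \<le> L0 * norm (x - y) * norm \<xi>" by (intro mult_right_mono sigma_Lipschitz) simp
  finally have d: "\<bar>?p x - ?p y\<bar> \<le> L0 * norm (x - y) * norm \<xi>" .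
  have "\<bar>(?p x)\<^sup>2 - (?p y)\<^sup>2\<bar> = \<bar>?p x - ?p y\<bar> * (?p x + ?p y)"
    by (simp add: power2_eq_square square_diff_square_factored abs_mult del: transpose_matrix_vector)
  also have "\<dots> \<le> (L0 * norm (x - y) * norm \<xi>) * (sqrt lmax * norm \<xi> + sqrt lmax * norm \<xi>)"
    by (intro mult_mono d add_mono p) (use constants_pos in auto)
  also have "\<dots> = 2 * sqrt lmax * L0 * norm (x - y) * (\<xi> \<bullet> \<xi>)"
    by (simp add: power2_norm_eq_inner[symmetric] power2_eq_square)
  finally show ?thesis by (simp only: cov_form)
qed

lemma subalg: "0 \<le> s \<Longrightarrow> s \<le> t \<Longrightarrow> subalgebra (F t) (F s)" "0 \<le> s \<Longrightarrow> subalgebra M (F s)"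
  using filtered by (auto simp: filtered_prob_space_def)

lemma F_mono: "Y \<in> borel_measurable (F s) \<Longrightarrow> 0 \<le> s \<Longrightarrow> s \<le> t \<Longrightarrow> Y \<in> borel_measurable (F t)"
  by (rule measurable_from_subalg[OF subalg(1)])

lemma F_M: "Y \<in> borel_measurable (F s) \<Longrightarrow> 0 \<le> s \<Longrightarrow> Y \<in> borel_measurable M"
  by (rule measurable_from_subalg[OF subalg(2)])

lemma X_F: "0 \<le> s \<Longrightarrow> s \<le> t \<Longrightarrow> X s \<in> borel_measurable (F t)"
  using X_adapted F_mono by (auto simp: adapted_to_def)

lemma X_M [measurable]: "0 \<le> s \<Longrightarrow> X s \<in> borel_measurable M"
  using X_F[of s s] F_M by auto

text \<open>Conditioning on \<open>F s\<close> is expressed by an arbitrary \<open>F s\<close>-measurable weight \<open>Y\<close>.\<close>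

lemma nn_integral_step:
  fixes g :: "real ^ 'd \<Rightarrow> ennreal"
  assumes s: "real k * \<delta> \<le> s" "s < r" "r \<le> real (k + 1) * \<delta>"
    and Y: "Y \<in> borel_measurable (F s)" and g [measurable]: "g \<in> borel_measurable borel"
  shows "(\<integral>\<^sup>+\<omega>. Y \<omega> * g (X r \<omega>) \<partial>M)
    = (\<integral>\<^sup>+\<omega>. Y \<omega> * (\<integral>\<^sup>+z. g (X s \<omega> + (r - s) *\<^sub>R b (X (real k * \<delta>) \<omega>) + \<sigma> (X (real k * \<delta>) \<omega>) *v z)
        * ennreal (std_gauss_density (r - s) z) \<partial>lborel) \<partial>M)"
proof -
  have k0: "0 \<le> real k * \<delta>" using \<delta> by simp
  then have s0: "0 \<le> s" using s by linarith
  note [measurable] = Y X_F[OF k0 s(1)] X_F[OF s0 order.refl]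
  let ?\<Phi> = "\<lambda>(\<omega>, z). Y \<omega> * g (X s \<omega> + (r - s) *\<^sub>R b (X (real k * \<delta>) \<omega>) + \<sigma> (X (real k * \<delta>) \<omega>) *v z)"
  have "(\<integral>\<^sup>+\<omega>. Y \<omega> * g (X r \<omega>) \<partial>M) = (\<integral>\<^sup>+\<omega>. ?\<Phi> (\<omega>, W r \<omega> - W s \<omega>) \<partial>M)"
    by (rule nn_integral_cong_AE)
       (use increment[OF s(1) less_imp_le[OF s(2)] s(3)] in \<open>auto elim!: eventually_mono\<close>)
  also have "\<dots> = (\<integral>\<^sup>+\<omega>. (\<integral>\<^sup>+z. ?\<Phi> (\<omega>, z) * ennreal (std_gauss_density (r - s) z) \<partial>lborel) \<partial>M)"
    by (rule nn_integral_indep_increment[OF filtered brownian s0 s(2)]) measurable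
  also have "\<dots> = (\<integral>\<^sup>+\<omega>. Y \<omega> * (\<integral>\<^sup>+z. g (X s \<omega> + (r - s) *\<^sub>R b (X (real k * \<delta>) \<omega>) + \<sigma> (X (real k * \<delta>) \<omega>) *v z)
        * ennreal (std_gauss_density (r - s) z) \<partial>lborel) \<partial>M)"
  proof (rule nn_integral_cong)
    fix \<omega>
    show "(\<integral>\<^sup>+z. ?\<Phi> (\<omega>, z) * ennreal (std_gauss_density (r - s) z) \<partial>lborel)
      = Y \<omega> * (\<integral>\<^sup>+z. g (X s \<omega> + (r - s) *\<^sub>R b (X (real k * \<delta>) \<omega>) + \<sigma> (X (real k * \<delta>) \<omega>) *v z)
        * ennreal (std_gauss_density (r - s) z) \<partial>lborel)"
      by (subst nn_integral_cmult[symmetric]) (simp_all add: mult.assoc)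
  qed
  finally show ?thesis .
qed

text \<open>Backward step of the parametrix: the kernel, read at the later time, becomes a kernel at
  the earlier time whose covariance has grown by that of the increment, evaluated at the random
  state at the last grid point.\<close>

lemma nn_integral_step_gauss:
  assumes s: "real k * \<delta> \<le> s" "s < r" "r \<le> real (k + 1) * \<delta>"
    and Y: "Y \<in> borel_measurable (F s)" and A: "elliptic lo hi A"
  shows "(\<integral>\<^sup>+\<omega>. Y \<omega> * ennreal (gauss A (X r \<omega> - z0)) \<partial>M)
    = (\<integral>\<^sup>+\<omega>. Y \<omega> * ennreal (gauss (A + (r - s) *\<^sub>R cov (X (real k * \<delta>) \<omega>))
        (X s \<omega> - z0 + (r - s) *\<^sub>R b (X (real k * \<delta>) \<omega>))) \<partial>M)"
proof -
  have "(\<integral>\<^sup>+z. ennreal (gauss A (x + y + S *v z - z0)) * ennreal (std_gauss_density (r - s) z) \<partial>lborel)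
     = ennreal (gauss (A + (r - s) *\<^sub>R cov w) (x - z0 + y))" if S: "S = \<sigma> w" for x y w S
  proof -
    \<comment> \<open>The convolution formula is stated for \<open>v - S *v z\<close>; it is applied
      to \<open>- S\<close>, which has the same covariance.\<close>
    have m: "(- S) *v z = - (S *v z)" for z
      using matrix_vector_mult_diff_rdistrib[of 0 S z] by simp
    have "(- S) ** transpose (- S) = cov w"
      by (simp add: S cov_def transpose_def matrix_matrix_mult_def)
    moreover have "elliptic (lo + (r - s) * lmin) (hi + (r - s) * lmax) (A + (r - s) *\<^sub>R cov w)"
      by (rule elliptic_add[OF A cov_elliptic]) (use s in simp)
    ultimately have "(\<integral>\<^sup>+z. ennreal (gauss A (x - z0 + y - (- S) *v z) * std_gauss_density (r - s) z) \<partial>lborel)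
      = ennreal (gauss (A + (r - s) *\<^sub>R cov w) (x - z0 + y))"
      using gauss_convolution[OF A, of "r - s" _ _ "- S" "x - z0 + y"] s by simp
    moreover have "x - z0 + y - (- S) *v z = x + y + S *v z - z0" for z by (simp add: m)
    ultimately show ?thesis using gauss_pos[OF A] by (simp add: ennreal_mult' less_imp_le)
  qed
  then show ?thesis
    using nn_integral_step[OF s Y, of "\<lambda>x. ennreal (gauss A (x - z0))"] by simp
qed

end

section \<open>Parametrix estimate on the time grid\<close>

lemma elliptic_weaken:
  assumes "elliptic lo hi A" "hi \<le> hi'" shows "elliptic lo hi' A"
proof -
  have "\<xi> \<bullet> (A *v \<xi>) \<le> hi' * (\<xi> \<bullet> \<xi>)" for \<xi>
    using ellipticD(4)[OF assms(1), of \<xi>] mult_right_mono[OF assms(2), of "\<xi> \<bullet> \<xi>"] by simp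
  then show ?thesis using assms(1) by (simp add: elliptic_def)
qed

text \<open>Riemann sum at right endpoints for the decreasing function \<open>1 / sqrt\<close>: each
  term is at most the increment of the antiderivative \<open>2 * sqrt\<close>, by the inequality of
  arithmetic and geometric means.\<close>

lemma sum_step_over_sqrt_le:
  assumes "0 < \<epsilon>" "0 < (\<delta>::real)"
  shows "(\<Sum>j=1..n. \<delta> / sqrt (\<epsilon> + real j * \<delta>)) \<le> 2 * sqrt (\<epsilon> + real n * \<delta>)"
proof (induction n)
  case 0 then show ?case using assms by simp
next
  case (Suc n)
  define x where "x = \<epsilon> + real n * \<delta>"
  have x: "0 < x" using assms by (simp add: x_def add_pos_nonneg)
  have "2 * sqrt x * sqrt (x + \<delta>) \<le> x + (x + \<delta>)"
    using sum_squares_bound[of "sqrt x" "sqrt (x + \<delta>)"] x assms by simp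
  then have "\<delta> / sqrt (x + \<delta>) \<le> 2 * sqrt (x + \<delta>) - 2 * sqrt x"
    using x assms by (simp add: field_simps)
  moreover have "\<epsilon> + real (Suc n) * \<delta> = x + \<delta>" by (simp add: x_def algebra_simps)
  moreover have "(\<Sum>j=1..Suc n. \<delta> / sqrt (\<epsilon> + real j * \<delta>))
      = (\<Sum>j=1..n. \<delta> / sqrt (\<epsilon> + real j * \<delta>)) + \<delta> / sqrt (\<epsilon> + real (Suc n) * \<delta>)" by simp
  ultimately show ?case using Suc unfolding x_def[symmetric] by simp
qed

context euler_scheme
begin

text \<open>The weight becomes a change of measure: the mollification criterion is applied to the
  law of \<open>X t\<close> under the finite measure \<open>density M Y\<close>.\<close>

lemma nn_integral_X_le_of_mollified:
  assumes Y: "Y \<in> borel_measurable M" "integral\<^sup>N M Y < \<infinity>" and t: "0 \<le> t"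
    and \<epsilon>0: "0 < \<epsilon>0" and D: "0 \<le> D"
    and bound: "\<And>\<epsilon> z. 0 < \<epsilon> \<Longrightarrow> \<epsilon> \<le> \<epsilon>0 \<Longrightarrow>
      (\<integral>\<^sup>+\<omega>. Y \<omega> * ennreal (gauss (mat \<epsilon>) (X t \<omega> - z)) \<partial>M) \<le> ennreal D * integral\<^sup>N M Y"
    and g [measurable]: "g \<in> borel_measurable borel"
  shows "(\<integral>\<^sup>+\<omega>. Y \<omega> * g (X t \<omega>) \<partial>M) \<le> ennreal D * integral\<^sup>N lborel g * integral\<^sup>N M Y"
proof -
  note [measurable] = Y(1) X_M[OF t]
  let ?\<mu> = "distr (density M Y) borel (X t)"
  obtain e where e: "0 \<le> e" "integral\<^sup>N M Y = ennreal e"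
    using Y(2) by (cases "integral\<^sup>N M Y" rule: ennreal_cases) auto
  have eq: "(\<integral>\<^sup>+x. h x \<partial>?\<mu>) = (\<integral>\<^sup>+\<omega>. Y \<omega> * h (X t \<omega>) \<partial>M)" if [measurable]: "h \<in> borel_measurable borel" for h
    by (simp add: nn_integral_distr nn_integral_density)
  have "finite_measure ?\<mu>"
  proof
    have "emeasure ?\<mu> (space ?\<mu>) = (\<integral>\<^sup>+x. 1 \<partial>?\<mu>)" by simp
    also have "\<dots> = ennreal e" by (simp only: eq borel_measurable_const mult_1_right e)
    finally show "emeasure ?\<mu> (space ?\<mu>) \<noteq> \<infinity>" by simp
  qed
  then have "(\<integral>\<^sup>+x. g x \<partial>?\<mu>) \<le> ennreal (D * e) * integral\<^sup>N lborel g"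
    using bound D e by (intro nn_integral_le_of_mollified[OF _ _ \<epsilon>0]) (auto simp: eq ennreal_mult)
  then show ?thesis using D e by (simp add: eq ennreal_mult mult_ac)
qed

definition parametrix_const :: real where
  "parametrix_const = 19 * real CARD('d) * L0 * (lmax / lmin)\<^sup>2 + 2 * sqrt (lmax / lmin) * nb / sqrt lmin"

text \<open>The summand \<open>mat (lmin * \<epsilon>)\<close> is the mollifier. Its scaling makes
  the total elliptic with bounds proportional to \<open>\<epsilon> + real j * \<delta>\<close>, as
  if the kernel had evolved for a further time \<open>\<epsilon>\<close>.\<close>

definition frozen_cov :: "real \<Rightarrow> real ^ 'd \<Rightarrow> nat \<Rightarrow> real ^ 'd ^ 'd" where
  "frozen_cov \<epsilon> z j = mat (lmin * \<epsilon>) + (real j * \<delta>) *\<^sub>R cov z"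

definition error_kernel :: "real ^ 'd \<Rightarrow> real \<Rightarrow> real ^ 'd \<Rightarrow> real" where
  "error_kernel z t w = \<delta> / sqrt t * parametrix_const
      * exp (- (norm (w - z))\<^sup>2 / (8 * (lmax * t))) / (2 * pi * (lmin * t)) powr (real CARD('d) / 2)"

lemma error_kernel_measurable [measurable]: "error_kernel z t \<in> borel_measurable borel"
  unfolding error_kernel_def by measurable

lemma parametrix_const_nonneg: "0 \<le> parametrix_const"
  using constants_pos nb_nonneg by (simp add: parametrix_const_def)

lemma frozen_cov_elliptic:
  assumes "0 < \<epsilon>"
  shows "elliptic (lmin * (\<epsilon> + real j * \<delta>)) (lmax * (\<epsilon> + real j * \<delta>)) (frozen_cov \<epsilon> z j)"
proof -
  have "elliptic (lmin * \<epsilon> + (real j * \<delta>) * lmin) (lmin * \<epsilon> + (real j * \<delta>) * lmax) (frozen_cov \<epsilon> z j)"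
    unfolding frozen_cov_def
    by (rule elliptic_add[OF elliptic_scaled_id cov_elliptic]) (use assms constants_pos \<delta> in auto)
  moreover have "lmin * \<epsilon> + (real j * \<delta>) * lmax \<le> lmax * (\<epsilon> + real j * \<delta>)"
    using assms lmin_le_lmax by (simp add: algebra_simps)
  moreover have "lmin * (\<epsilon> + real j * \<delta>) = lmin * \<epsilon> + (real j * \<delta>) * lmin" by (simp add: algebra_simps)
  ultimately show ?thesis using elliptic_weaken by simp
qed

lemma frozen_step:
  assumes nb: "\<delta> * nb\<^sup>2 \<le> lmin / 8" and \<epsilon>: "0 < \<epsilon>"
  shows "gauss (frozen_cov \<epsilon> z j + \<delta> *\<^sub>R cov w) (w - z + \<delta> *\<^sub>R b w)
    \<le> gauss (frozen_cov \<epsilon> z (Suc j)) (w - z) + error_kernel z (\<epsilon> + real (Suc j) * \<delta>) w"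
proof -
  let ?t = "\<epsilon> + real (Suc j) * \<delta>"
  have A: "elliptic (lmin * ?t) (lmax * ?t) (frozen_cov \<epsilon> z j + \<delta> *\<^sub>R cov w)"
    using elliptic_add[OF frozen_cov_elliptic[OF \<epsilon>, of j z] cov_elliptic, of \<delta> w] \<delta>
    by (simp add: algebra_simps)
  have B: "elliptic (lmin * ?t) (lmax * ?t) (frozen_cov \<epsilon> z (Suc j))" by (rule frozen_cov_elliptic[OF \<epsilon>])
  have AB: "\<bar>\<xi> \<bullet> ((frozen_cov \<epsilon> z j + \<delta> *\<^sub>R cov w) *v \<xi>) - \<xi> \<bullet> (frozen_cov \<epsilon> z (Suc j) *v \<xi>)\<bar>
      \<le> \<delta> * (2 * sqrt lmax * L0 * norm (w - z)) * (\<xi> \<bullet> \<xi>)" for \<xi>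
  proof -
    have "\<xi> \<bullet> ((frozen_cov \<epsilon> z j + \<delta> *\<^sub>R cov w) *v \<xi>) - \<xi> \<bullet> (frozen_cov \<epsilon> z (Suc j) *v \<xi>)
       = \<delta> * (\<xi> \<bullet> (cov w *v \<xi>) - \<xi> \<bullet> (cov z *v \<xi>))"
      by (simp add: frozen_cov_def matrix_vector_mult_add_rdistrib inner_add_right
          scaleR_matrix_vector_assoc[symmetric] algebra_simps)
    then have "\<bar>\<xi> \<bullet> ((frozen_cov \<epsilon> z j + \<delta> *\<^sub>R cov w) *v \<xi>) - \<xi> \<bullet> (frozen_cov \<epsilon> z (Suc j) *v \<xi>)\<bar>
       = \<delta> * \<bar>\<xi> \<bullet> (cov w *v \<xi>) - \<xi> \<bullet> (cov z *v \<xi>)\<bar>" using \<delta> by (simp add: abs_mult)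
    also have "\<dots> \<le> \<delta> * (2 * sqrt lmax * L0 * norm (w - z) * (\<xi> \<bullet> \<xi>))"
      by (rule mult_left_mono[OF cov_diff]) (use \<delta> in simp)
    finally show ?thesis by (simp add: mult.assoc)
  qed
  have y: "norm (\<delta> *\<^sub>R b w) \<le> \<delta> * nb" using \<delta> b_bound[of w] by simp
  have t: "\<delta> \<le> ?t" using \<delta> \<epsilon> by (simp add: algebra_simps)
  show ?thesis
    using gauss_frozen_step_le[OF constants_pos(1) lmin_le_lmax \<delta>(1) t nb_nonneg nb less_imp_le[OF constants_pos(3)] A B AB y]
    by (simp add: error_kernel_def parametrix_const_def)
qed

text \<open>Each backward step adds the true covariance at the current state and the drift to the
  kernel; replacing this by one more frozen step costs one error kernel, evaluated at the state of
  the chain reached so far. After \<open>i\<close> steps kernel and chain have exchanged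
  \<open>i\<close> units of time.\<close>

lemma parametrix_telescope:
  assumes nb: "\<delta> * nb\<^sup>2 \<le> lmin / 8" and \<epsilon>: "0 < \<epsilon>" and Y: "Y \<in> borel_measurable (F (real k * \<delta>))"
    and i: "i \<le> n"
  shows "(\<integral>\<^sup>+\<omega>. Y \<omega> * ennreal (gauss (frozen_cov \<epsilon> z 0) (X (real (k + n) * \<delta>) \<omega> - z)) \<partial>M)
    \<le> (\<integral>\<^sup>+\<omega>. Y \<omega> * ennreal (gauss (frozen_cov \<epsilon> z i) (X (real (k + n - i) * \<delta>) \<omega> - z)) \<partial>M)
      + (\<Sum>j=1..i. \<integral>\<^sup>+\<omega>. Y \<omega> * ennreal (error_kernel z (\<epsilon> + real j * \<delta>) (X (real (k + n - j) * \<delta>) \<omega>)) \<partial>M)"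
  using i
proof (induction i)
  case 0 then show ?case by simp
next
  case (Suc i)
  define l where "l = k + n - Suc i"
  have l: "k + n - i = Suc l" "k \<le> l" using Suc.prems by (auto simp: l_def)
  have kl: "0 \<le> real k * \<delta>" "real k * \<delta> \<le> real l * \<delta>" "0 \<le> real l * \<delta>" using l \<delta> by auto
  have [measurable]: "Y \<in> borel_measurable M" by (rule F_M[OF Y kl(1)])
  note [measurable] = X_M[OF kl(3)]
  have st: "real l * \<delta> \<le> real l * \<delta>" "real l * \<delta> < real (Suc l) * \<delta>" "real (Suc l) * \<delta> \<le> real (l + 1) * \<delta>"
    and dl: "real (Suc l) * \<delta> - real l * \<delta> = \<delta>" using \<delta> by (auto simp: algebra_simps)
  let ?E = "\<lambda>\<omega>. error_kernel z (\<epsilon> + real (Suc i) * \<delta>) (X (real l * \<delta>) \<omega>)"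
  let ?G = "\<lambda>\<omega>. gauss (frozen_cov \<epsilon> z (Suc i)) (X (real l * \<delta>) \<omega> - z)"
  have "(\<integral>\<^sup>+\<omega>. Y \<omega> * ennreal (gauss (frozen_cov \<epsilon> z i) (X (real (Suc l) * \<delta>) \<omega> - z)) \<partial>M)
    = (\<integral>\<^sup>+\<omega>. Y \<omega> * ennreal (gauss (frozen_cov \<epsilon> z i + \<delta> *\<^sub>R cov (X (real l * \<delta>) \<omega>))
        (X (real l * \<delta>) \<omega> - z + \<delta> *\<^sub>R b (X (real l * \<delta>) \<omega>))) \<partial>M)"
    using nn_integral_step_gauss[OF st F_mono[OF Y kl(1,2)] frozen_cov_elliptic[OF \<epsilon>], of z i z]
    by (simp only: dl)
  also have "\<dots> \<le> (\<integral>\<^sup>+\<omega>. Y \<omega> * (ennreal (?G \<omega>) + ennreal (?E \<omega>)) \<partial>M)"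
  proof (intro nn_integral_mono mult_left_mono)
    fix \<omega>
    have "0 \<le> ?E \<omega>" using parametrix_const_nonneg \<delta> \<epsilon> by (simp add: error_kernel_def)
    then show "ennreal (gauss (frozen_cov \<epsilon> z i + \<delta> *\<^sub>R cov (X (real l * \<delta>) \<omega>))
        (X (real l * \<delta>) \<omega> - z + \<delta> *\<^sub>R b (X (real l * \<delta>) \<omega>))) \<le> ennreal (?G \<omega>) + ennreal (?E \<omega>)"
      using frozen_step[OF nb \<epsilon>, of z i "X (real l * \<delta>) \<omega>"] gauss_pos[OF frozen_cov_elliptic[OF \<epsilon>], of z "Suc i"]
      by (subst ennreal_plus[symmetric]) (auto intro: less_imp_le ennreal_leI)
  qed simp
  also have "\<dots> = (\<integral>\<^sup>+\<omega>. Y \<omega> * ennreal (?G \<omega>) \<partial>M) + (\<integral>\<^sup>+\<omega>. Y \<omega> * ennreal (?E \<omega>) \<partial>M)"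
    by (simp add: distrib_left nn_integral_add)
  finally have "(\<integral>\<^sup>+\<omega>. Y \<omega> * ennreal (gauss (frozen_cov \<epsilon> z i) (X (real (k + n - i) * \<delta>) \<omega> - z)) \<partial>M)
    \<le> (\<integral>\<^sup>+\<omega>. Y \<omega> * ennreal (?G \<omega>) \<partial>M) + (\<integral>\<^sup>+\<omega>. Y \<omega> * ennreal (?E \<omega>) \<partial>M)" unfolding l .
  note step = this
  let ?S = "\<Sum>j=1..i. \<integral>\<^sup>+\<omega>. Y \<omega> * ennreal (error_kernel z (\<epsilon> + real j * \<delta>) (X (real (k + n - j) * \<delta>) \<omega>)) \<partial>M"
  have "(\<integral>\<^sup>+\<omega>. Y \<omega> * ennreal (gauss (frozen_cov \<epsilon> z 0) (X (real (k + n) * \<delta>) \<omega> - z)) \<partial>M)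
    \<le> (\<integral>\<^sup>+\<omega>. Y \<omega> * ennreal (gauss (frozen_cov \<epsilon> z i) (X (real (k + n - i) * \<delta>) \<omega> - z)) \<partial>M) + ?S"
    using Suc by simp
  also have "\<dots> \<le> ((\<integral>\<^sup>+\<omega>. Y \<omega> * ennreal (?G \<omega>) \<partial>M) + (\<integral>\<^sup>+\<omega>. Y \<omega> * ennreal (?E \<omega>) \<partial>M)) + ?S"
    by (rule add_right_mono[OF step])
  also have "\<dots> = (\<integral>\<^sup>+\<omega>. Y \<omega> * ennreal (?G \<omega>) \<partial>M) + (?S + (\<integral>\<^sup>+\<omega>. Y \<omega> * ennreal (?E \<omega>) \<partial>M))"
    by (simp only: add_ac)
  also have "?S + (\<integral>\<^sup>+\<omega>. Y \<omega> * ennreal (?E \<omega>) \<partial>M)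
    = (\<Sum>j=1..Suc i. \<integral>\<^sup>+\<omega>. Y \<omega> * ennreal (error_kernel z (\<epsilon> + real j * \<delta>) (X (real (k + n - j) * \<delta>) \<omega>)) \<partial>M)"
    by (simp add: l_def)
  finally show ?case unfolding l_def .
qed

lemma nn_integral_error_kernel:
  assumes t: "0 < t"
  shows "(\<integral>\<^sup>+w. ennreal (error_kernel z t w) \<partial>lborel)
    = ennreal (\<delta> / sqrt t * parametrix_const * (4 * (lmax / lmin)) powr (real CARD('d) / 2))"
proof -
  let ?P = "(2 * pi * (lmin * t)) powr (real CARD('d) / 2)"
  let ?c = "\<delta> / sqrt t * parametrix_const / ?P"
  have c: "0 \<le> ?c" using \<delta> t parametrix_const_nonneg by simp
  have "(\<integral>\<^sup>+w. ennreal (error_kernel z t w) \<partial>lborel)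
    = (\<integral>\<^sup>+w. ennreal (error_kernel z t w) \<partial>(distr lborel borel ((+) z)))" by (simp add: lborel_distr_plus)
  also have "\<dots> = (\<integral>\<^sup>+w. ennreal (error_kernel z t (z + w)) \<partial>lborel)" by (rule nn_integral_distr) measurable
  also have "\<dots> = (\<integral>\<^sup>+w. ennreal ?c * ennreal (exp (- (norm w)\<^sup>2 / (2 * (4 * lmax * t)))) \<partial>(lborel :: (real^'d) measure))"
    using c by (intro nn_integral_cong) (simp add: error_kernel_def ennreal_mult[symmetric])
  also have "\<dots> = ennreal ?c * (\<integral>\<^sup>+w. ennreal (exp (- (norm w)\<^sup>2 / (2 * (4 * lmax * t)))) \<partial>(lborel :: (real^'d) measure))"
    by (rule nn_integral_cmult) measurable
  also have "\<dots> = ennreal ?c * ennreal ((2 * pi * (4 * lmax * t)) powr (real CARD('d) / 2))"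
    using nn_integral_exp_norm_square[of "4 * lmax * t", where 'a="real^'d"] constants_pos t by simp
  also have "\<dots> = ennreal (?c * (2 * pi * (4 * lmax * t)) powr (real CARD('d) / 2))"
    using c by (intro ennreal_mult[symmetric]) auto
  also have "?c * (2 * pi * (4 * lmax * t)) powr (real CARD('d) / 2)
     = \<delta> / sqrt t * parametrix_const * ((2 * pi * (4 * lmax * t)) / (2 * pi * (lmin * t))) powr (real CARD('d) / 2)"
    using constants_pos t by (subst powr_divide) auto
  also have "(2 * pi * (4 * lmax * t)) / (2 * pi * (lmin * t)) = 4 * (lmax / lmin)"
    using constants_pos t by simp
  finally show ?thesis .
qed

text \<open>The factor 2 is the constant of the induction hypothesis,
  \<open>4 * (lmax / lmin)\<close> comes from the mass of the error kernel, and the further 2 in the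
  base turns half of the total time back into the total time.\<close>

definition growth_const :: real where
  "growth_const = 2 * parametrix_const * (8 * (lmax / lmin)) powr (real CARD('d) / 2)"

text \<open>Through the second bound the short-time condition of the density estimate also forces
  \<open>\<delta> * nb\<^sup>2 \<le> lmin / 8\<close>, the smallness of the drift that one
  comparison step requires.\<close>

lemma growth_const_bounds: "0 \<le> growth_const" "8 * nb / sqrt lmin \<le> growth_const"
proof -
  have \<kappa>: "1 \<le> lmax / lmin" using lmin_le_lmax constants_pos by simp
  show "0 \<le> growth_const" using parametrix_const_nonneg by (simp add: growth_const_def)
  have d: "1 / 2 \<le> real CARD('d) / 2" using zero_less_card_finite[where 'a='d] by simp
  have "2 \<le> 8 powr (1 / 2 :: real)" by (simp add: powr_half_sqrt real_le_rsqrt)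
  also have "\<dots> \<le> 8 powr (real CARD('d) / 2)" by (rule powr_mono[OF d]) simp
  also have "\<dots> \<le> (8 * (lmax / lmin)) powr (real CARD('d) / 2)" using \<kappa> by (intro powr_mono2) auto
  finally have 1: "2 \<le> (8 * (lmax / lmin)) powr (real CARD('d) / 2)" .
  have "2 * nb / sqrt lmin = 2 * 1 * nb / sqrt lmin" by simp
  also have "\<dots> \<le> 2 * sqrt (lmax / lmin) * nb / sqrt lmin"
    using \<kappa> nb_nonneg constants_pos by (intro divide_right_mono mult_right_mono mult_left_mono) auto
  also have "\<dots> \<le> parametrix_const" using constants_pos by (simp add: parametrix_const_def)
  finally have "4 * nb / sqrt lmin \<le> 2 * parametrix_const" by simp
  then have "4 * nb / sqrt lmin * 2 \<le> growth_const" unfolding growth_const_def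
    using 1 nb_nonneg constants_pos parametrix_const_nonneg by (intro mult_mono) auto
  then show "8 * nb / sqrt lmin \<le> growth_const" by simp
qed

text \<open>In each error term either the kernel or, by induction, the law of the chain at the earlier
  time has lived for at least half of the total time.\<close>

lemma grid_density_short_time:
  assumes n: "1 \<le> n" and short: "growth_const * sqrt (2 * (real n * \<delta>)) \<le> 1 / 2"
    and Y: "Y \<in> borel_measurable (F (real k * \<delta>))" "integral\<^sup>N M Y < \<infinity>"
    and g: "g \<in> borel_measurable borel"
  shows "(\<integral>\<^sup>+\<omega>. Y \<omega> * g (X (real (k + n) * \<delta>) \<omega>) \<partial>M)
    \<le> ennreal (2 / (2 * pi * (lmin * (real n * \<delta>))) powr (real CARD('d) / 2)) * integral\<^sup>N lborel g * integral\<^sup>N M Y"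
  using n short g
proof (induction n arbitrary: g rule: less_induct)
  case (less n)
  define d where "d = real CARD('d) / 2"
  have d0: "0 \<le> d" by (simp add: d_def)
  define P where "P t = (2 * pi * (lmin * t)) powr d" for t
  have P_pos: "0 < P t" if "0 < t" for t using that constants_pos by (simp add: P_def)
  have P_mono: "P s \<le> P t" if "0 < s" "s \<le> t" for s t
    using that constants_pos d0 by (auto simp: P_def intro!: powr_mono2)
  have half: "1 / P t \<le> 2 powr d / P \<tau>" if "\<tau> \<le> 2 * t" "0 < \<tau>" for t \<tau>
  proof -
    have le: "P \<tau> \<le> P (2 * t)" by (rule P_mono) (use that in auto)
    have "2 * pi * (lmin * (2 * t)) = 2 * (2 * pi * (lmin * t))" by simp
    then have "P (2 * t) = 2 powr d * P t" using that constants_pos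
      unfolding P_def by (simp only: powr_mult)
    with le show ?thesis using P_pos[of \<tau>] P_pos[of t] that by (simp add: field_simps)
  qed
  define \<kappa> where "\<kappa> = lmax / lmin"
  have \<kappa>: "1 \<le> \<kappa>" using lmin_le_lmax constants_pos by (simp add: \<kappa>_def)
  have n0: "0 < real n * \<delta>" using less.prems \<delta> by simp
  have small: "\<delta> * nb\<^sup>2 \<le> lmin / 8"
  proof -
    have "8 * nb / sqrt lmin * sqrt (2 * \<delta>) \<le> growth_const * sqrt (2 * (real n * \<delta>))"
      using growth_const_bounds nb_nonneg constants_pos \<delta> less.prems by (intro mult_mono) auto
    also have "\<dots> \<le> 1 / 2" by fact
    finally have "nb * sqrt \<delta> * sqrt 2 * 16 \<le> sqrt lmin" using constants_pos
      by (simp add: real_sqrt_mult field_simps)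
    moreover have "nb * sqrt \<delta> * 16 \<le> nb * sqrt \<delta> * sqrt 2 * 16"
      using mult_left_mono[of 1 "sqrt 2" "nb * sqrt \<delta>"] nb_nonneg \<delta> by simp
    ultimately have "nb * sqrt \<delta> * 16 \<le> sqrt lmin" by linarith
    then have "(nb * sqrt \<delta> * 16)\<^sup>2 \<le> (sqrt lmin)\<^sup>2" using nb_nonneg \<delta> by (intro power_mono) auto
    then show ?thesis using constants_pos \<delta> by (simp add: power_mult_distrib mult.commute)
  qed
  have kd: "0 \<le> real k * \<delta>" "0 \<le> real i * \<delta>" for i using \<delta> by auto
  have Ym [measurable]: "Y \<in> borel_measurable M" by (rule F_M[OF Y(1) kd(1)])
  obtain e where e: "0 \<le> e" "integral\<^sup>N M Y = ennreal e"
    using Y(2) by (cases "integral\<^sup>N M Y" rule: ennreal_cases) auto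
  \<comment> \<open>A mollifier of at most this size adds at most one step to the lifetime of the
    kernel, so that the total time \<open>\<tau>\<close> lies between
    \<open>real n * \<delta>\<close> and twice that value.\<close>
  have main: "(\<integral>\<^sup>+\<omega>. Y \<omega> * ennreal (gauss (mat \<epsilon>') (X (real (k + n) * \<delta>) \<omega> - z)) \<partial>M)
     \<le> ennreal (2 / P (real n * \<delta>)) * integral\<^sup>N M Y" if \<epsilon>': "0 < \<epsilon>'" "\<epsilon>' \<le> lmin * \<delta>" for \<epsilon>' z
  proof -
    define \<epsilon> where "\<epsilon> = \<epsilon>' / lmin"
    have \<epsilon>: "0 < \<epsilon>" "\<epsilon> \<le> \<delta>" "mat \<epsilon>' = frozen_cov \<epsilon> z 0"
      using \<epsilon>' constants_pos by (auto simp: \<epsilon>_def frozen_cov_def field_simps)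
    define \<tau> where "\<tau> = \<epsilon> + real n * \<delta>"
    have \<tau>: "0 < \<tau>" "real n * \<delta> \<le> \<tau>" using \<epsilon> n0 by (auto simp: \<tau>_def)
    have "\<delta> \<le> real n * \<delta>" using less.prems \<delta> by simp
    then have \<tau>2: "\<tau> \<le> 2 * (real n * \<delta>)" using \<epsilon>(2) unfolding \<tau>_def by linarith
    have first: "(\<integral>\<^sup>+\<omega>. Y \<omega> * ennreal (gauss (frozen_cov \<epsilon> z n) (X (real (k + n - n) * \<delta>) \<omega> - z)) \<partial>M)
      \<le> ennreal (1 / P \<tau> * e)"
    proof -
      have "gauss (frozen_cov \<epsilon> z n) v \<le> 1 / P \<tau>" for v
      proof -
        have "gauss (frozen_cov \<epsilon> z n) v \<le> exp (- (norm v)\<^sup>2 / (2 * (lmax * \<tau>))) / P \<tau>"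
          using gauss_le[OF frozen_cov_elliptic[OF \<epsilon>(1)], of z n v] by (simp add: P_def d_def \<tau>_def)
        also have "\<dots> \<le> 1 / P \<tau>" using constants_pos \<tau> P_pos[OF \<tau>(1)] by (intro divide_right_mono) auto
        finally show ?thesis .
      qed
      then have "(\<integral>\<^sup>+\<omega>. Y \<omega> * ennreal (gauss (frozen_cov \<epsilon> z n) (X (real (k + n - n) * \<delta>) \<omega> - z)) \<partial>M)
        \<le> (\<integral>\<^sup>+\<omega>. Y \<omega> * ennreal (1 / P \<tau>) \<partial>M)"
        by (intro nn_integral_mono mult_left_mono ennreal_leI) auto
      also have "\<dots> = ennreal (1 / P \<tau> * e)"
        using P_pos[OF \<tau>(1)] e by (simp add: nn_integral_multc mult.commute ennreal_mult[symmetric])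
      finally show ?thesis .
    qed
    have err: "(\<integral>\<^sup>+\<omega>. Y \<omega> * ennreal (error_kernel z (\<epsilon> + real j * \<delta>) (X (real (k + n - j) * \<delta>) \<omega>)) \<partial>M)
      \<le> ennreal (\<delta> / sqrt (\<epsilon> + real j * \<delta>) * (growth_const / P \<tau> * e))" if j: "1 \<le> j" "j \<le> n" for j
    proof -
      define t where "t = \<epsilon> + real j * \<delta>"
      have t: "0 < t" using \<epsilon> \<delta> by (simp add: t_def add_pos_nonneg)
      have c0: "0 \<le> \<delta> / sqrt t * parametrix_const" using \<delta> t parametrix_const_nonneg by simp
      have gc: "growth_const = 2 * parametrix_const * ((4 * \<kappa>) powr d * 2 powr d)"
        using \<kappa> by (simp add: growth_const_def d_def \<kappa>_def[symmetric] powr_mult[symmetric])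
      show ?thesis unfolding t_def[symmetric]
      proof (cases "\<tau> \<le> 2 * t")
        case True
        have ge1: "1 \<le> (4 * \<kappa>) powr d" using \<kappa> d0 by (intro ge_one_powr_ge_zero) auto
        have "error_kernel z t w \<le> \<delta> / sqrt t * (growth_const / P \<tau>)" for w
        proof -
          have "error_kernel z t w = \<delta> / sqrt t * parametrix_const * exp (- (norm (w - z))\<^sup>2 / (8 * (lmax * t))) / P t"
            by (simp add: error_kernel_def P_def d_def)
          also have "\<dots> \<le> \<delta> / sqrt t * parametrix_const * (1 / P t)"
            unfolding times_divide_eq_right[symmetric] mult.assoc
            using c0 constants_pos t P_pos[OF t] \<delta> parametrix_const_nonneg
            by (intro mult_left_mono divide_right_mono) auto
          also have "\<dots> \<le> \<delta> / sqrt t * parametrix_const * (2 powr d / P \<tau>)"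
            using half[OF True \<tau>(1)] c0 by (rule mult_left_mono)
          also have "\<dots> \<le> \<delta> / sqrt t * parametrix_const * (2 * (4 * \<kappa>) powr d * 2 powr d / P \<tau>)"
            using c0 P_pos[OF \<tau>(1)] ge1 by (intro mult_left_mono divide_right_mono) auto
          finally show ?thesis by (simp add: gc mult_ac)
        qed
        then have "(\<integral>\<^sup>+\<omega>. Y \<omega> * ennreal (error_kernel z t (X (real (k + n - j) * \<delta>) \<omega>)) \<partial>M)
          \<le> (\<integral>\<^sup>+\<omega>. Y \<omega> * ennreal (\<delta> / sqrt t * (growth_const / P \<tau>)) \<partial>M)"
          by (intro nn_integral_mono mult_left_mono ennreal_leI) auto
        also have "\<dots> = ennreal (\<delta> / sqrt t * (growth_const / P \<tau>)) * ennreal e"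
          using e by (simp add: nn_integral_multc mult.commute)
        also have "\<dots> = ennreal (\<delta> / sqrt t * (growth_const / P \<tau> * e))"
          using P_pos[OF \<tau>(1)] e \<delta> t growth_const_bounds(1) by (simp add: ennreal_mult[symmetric] mult_ac)
        finally show "(\<integral>\<^sup>+\<omega>. Y \<omega> * ennreal (error_kernel z t (X (real (k + n - j) * \<delta>) \<omega>)) \<partial>M)
          \<le> ennreal (\<delta> / sqrt t * (growth_const / P \<tau> * e))" .
      next
        case False
        \<comment> \<open>Strong induction applies to \<open>i\<close>:
          \<open>real i * \<delta> = \<tau> - t\<close> is positive because
          \<open>2 * t < \<tau>\<close>, and \<open>i < n\<close> because \<open>j\<close> starts at
          1.\<close>
        define i where "i = n - j"
        have i: "real i * \<delta> = \<tau> - t" using j by (simp add: i_def \<tau>_def t_def of_nat_diff algebra_simps)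
        have "0 < real i * \<delta>" using False \<tau> by (simp add: i)
        then have "i \<noteq> 0" by (intro notI) simp
        then have i1: "1 \<le> i" "i < n" using j by (auto simp: i_def)
        have sh: "growth_const * sqrt (2 * (real i * \<delta>)) \<le> 1 / 2"
        proof (rule order_trans[OF _ less.prems(2)])
          show "growth_const * sqrt (2 * (real i * \<delta>)) \<le> growth_const * sqrt (2 * (real n * \<delta>))"
            using growth_const_bounds(1) \<delta> i1 by (intro mult_left_mono) auto
        qed
        have "(\<integral>\<^sup>+\<omega>. Y \<omega> * ennreal (error_kernel z t (X (real (k + i) * \<delta>) \<omega>)) \<partial>M)
          \<le> ennreal (2 / P (real i * \<delta>)) * ennreal (\<delta> / sqrt t * parametrix_const * (4 * \<kappa>) powr d) * ennreal e"
          using less.IH[OF i1(2,1) sh, of "\<lambda>w. ennreal (error_kernel z t w)"] t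
          by (simp add: nn_integral_error_kernel e \<kappa>_def P_def d_def)
        also have "\<dots> = ennreal (1 / P (real i * \<delta>) * (\<delta> / sqrt t * (2 * parametrix_const * (4 * \<kappa>) powr d) * e))"
          using P_pos[OF \<open>0 < real i * \<delta>\<close>] e c0 \<kappa> \<delta> t parametrix_const_nonneg
          by (simp add: ennreal_mult[symmetric] mult_ac)
        also have "\<dots> \<le> ennreal (2 powr d / P \<tau> * (\<delta> / sqrt t * (2 * parametrix_const * (4 * \<kappa>) powr d) * e))"
          using half[of \<tau> "real i * \<delta>"] False \<tau> i e t \<delta> parametrix_const_nonneg
          by (intro ennreal_leI mult_right_mono) auto
        also have "2 powr d / P \<tau> * (\<delta> / sqrt t * (2 * parametrix_const * (4 * \<kappa>) powr d) * e)
          = \<delta> / sqrt t * (growth_const / P \<tau> * e)" by (simp add: gc mult_ac)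
        finally show "(\<integral>\<^sup>+\<omega>. Y \<omega> * ennreal (error_kernel z t (X (real (k + n - j) * \<delta>) \<omega>)) \<partial>M)
          \<le> ennreal (\<delta> / sqrt t * (growth_const / P \<tau> * e))"
          using j by (simp add: i_def add.commute)
      qed
    qed
    have "(\<integral>\<^sup>+\<omega>. Y \<omega> * ennreal (gauss (mat \<epsilon>') (X (real (k + n) * \<delta>) \<omega> - z)) \<partial>M)
      \<le> ennreal (1 / P \<tau> * e) + (\<Sum>j=1..n. ennreal (\<delta> / sqrt (\<epsilon> + real j * \<delta>) * (growth_const / P \<tau> * e)))"
      unfolding \<epsilon>(3)
      by (rule order_trans[OF parametrix_telescope[OF small \<epsilon>(1) Y(1) order.refl]])
         (intro add_mono sum_mono first err, auto)
    also have "(\<Sum>j=1..n. ennreal (\<delta> / sqrt (\<epsilon> + real j * \<delta>) * (growth_const / P \<tau> * e)))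
      = ennreal ((\<Sum>j=1..n. \<delta> / sqrt (\<epsilon> + real j * \<delta>)) * (growth_const / P \<tau> * e))"
      unfolding sum_distrib_right
      using P_pos[OF \<tau>(1)] e \<delta> \<epsilon> growth_const_bounds(1) by (intro sum_ennreal) simp
    also have "ennreal (1 / P \<tau> * e) + \<dots> = ennreal (1 / P \<tau> * e + (\<Sum>j=1..n. \<delta> / sqrt (\<epsilon> + real j * \<delta>)) * (growth_const / P \<tau> * e))"
      using P_pos[OF \<tau>(1)] e \<delta> \<epsilon> growth_const_bounds(1)
      by (intro ennreal_plus[symmetric] mult_nonneg_nonneg sum_nonneg) auto
    \<comment> \<open>The error terms add up to at most
      \<open>2 * sqrt \<tau> * growth_const \<le> 1\<close> times \<open>1 / P \<tau>\<close>, as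
      much as the main term. This reproduces the constant 2 and closes the induction.\<close>
    also have "\<dots> \<le> ennreal (2 / P (real n * \<delta>) * e)"
    proof (rule ennreal_leI)
      have "(\<Sum>j=1..n. \<delta> / sqrt (\<epsilon> + real j * \<delta>)) * growth_const \<le> 2 * sqrt \<tau> * growth_const"
        unfolding \<tau>_def by (rule mult_right_mono[OF sum_step_over_sqrt_le]) (use \<epsilon> \<delta> growth_const_bounds in auto)
      also have "\<dots> \<le> 2 * (growth_const * sqrt (2 * (real n * \<delta>)))"
        using mult_left_mono[OF real_sqrt_le_mono[OF \<tau>2] growth_const_bounds(1)] by (simp add: mult.commute[of growth_const])
      also have "\<dots> \<le> 1" using less.prems(2) by simp
      finally have "(\<Sum>j=1..n. \<delta> / sqrt (\<epsilon> + real j * \<delta>)) * growth_const * (1 / P \<tau> * e) \<le> 1 * (1 / P \<tau> * e)"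
        using P_pos[OF \<tau>(1)] e by (intro mult_right_mono) auto
      then have "1 / P \<tau> * e + (\<Sum>j=1..n. \<delta> / sqrt (\<epsilon> + real j * \<delta>)) * (growth_const / P \<tau> * e) \<le> 2 / P \<tau> * e"
        by simp
      also have "\<dots> \<le> 2 / P (real n * \<delta>) * e"
        using P_mono[OF n0 \<tau>(2)] P_pos[OF n0] e by (intro mult_right_mono divide_left_mono) auto
      finally show "1 / P \<tau> * e + (\<Sum>j=1..n. \<delta> / sqrt (\<epsilon> + real j * \<delta>)) * (growth_const / P \<tau> * e) \<le> 2 / P (real n * \<delta>) * e" .
    qed
    also have "\<dots> = ennreal (2 / P (real n * \<delta>)) * integral\<^sup>N M Y"
      using e P_pos[OF n0] by (simp add: ennreal_mult[symmetric])
    finally show ?thesis .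
  qed
  show ?case
    using nn_integral_X_le_of_mollified[OF Ym Y(2) kd(2), of "lmin * \<delta>", OF _ _ main less.prems(3)]
      constants_pos \<delta> P_pos[OF n0]
    by (simp add: P_def d_def)
qed

end

section \<open>Density bound at all times\<close>

context euler_scheme
begin

text \<open>Despite the name, the reciprocal of the maximum of the centred Gaussian density with
  covariance \<open>lmin * t\<close> times the identity; density bounds take the form
  \<open>C / peak t\<close>.\<close>

definition peak :: "real \<Rightarrow> real" where
  "peak t = (2 * pi * (lmin * t)) powr (real CARD('d) / 2)"

lemma peak_pos: "0 < t \<Longrightarrow> 0 < peak t"
  using constants_pos by (simp add: peak_def)

lemma peak_mono: "0 \<le> s \<Longrightarrow> s \<le> t \<Longrightarrow> peak s \<le> peak t"
  using constants_pos unfolding peak_def by (intro powr_mono2 mult_left_mono) auto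

lemma peak_mult: "0 \<le> c \<Longrightarrow> 0 \<le> t \<Longrightarrow> peak (c * t) = c powr (real CARD('d) / 2) * peak t"
proof -
  assume "0 \<le> c" "0 \<le> t"
  moreover have "2 * pi * (lmin * (c * t)) = c * (2 * pi * (lmin * t))" by simp
  ultimately show ?thesis using constants_pos unfolding peak_def by (simp only: powr_mult)
qed

text \<open>Inside one cell the law given the past up to \<open>s\<close> is Gaussian with
  covariance at least \<open>(r - s) * lmin\<close>, whatever the drift. The starting time need not
  lie on the grid.\<close>

lemma single_step_density:
  assumes s: "real k * \<delta> \<le> s" "s < r" "r \<le> real (k + 1) * \<delta>"
    and Y: "Y \<in> borel_measurable (F s)" "integral\<^sup>N M Y < \<infinity>" and g: "g \<in> borel_measurable borel"
  shows "(\<integral>\<^sup>+\<omega>. Y \<omega> * g (X r \<omega>) \<partial>M)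
    \<le> ennreal (1 / peak (r - s)) * integral\<^sup>N lborel g * integral\<^sup>N M Y"
proof -
  have "0 \<le> real k * \<delta>" using \<delta> by simp
  then have s0: "0 \<le> s" "0 \<le> r" using s by linarith+
  have Ym [measurable]: "Y \<in> borel_measurable M" by (rule F_M[OF Y(1) s0(1)])
  have "(\<integral>\<^sup>+\<omega>. Y \<omega> * ennreal (gauss (mat \<epsilon>) (X r \<omega> - z)) \<partial>M) \<le> ennreal (1 / peak (r - s)) * integral\<^sup>N M Y"
    if \<epsilon>: "0 < \<epsilon>" "\<epsilon> \<le> 1" for \<epsilon> z
  proof -
    have "gauss (mat \<epsilon> + (r - s) *\<^sub>R cov w) v \<le> 1 / peak (r - s)" for w v
    proof -
      have "elliptic (\<epsilon> + (r - s) * lmin) (\<epsilon> + (r - s) * lmax) (mat \<epsilon> + (r - s) *\<^sub>R cov w)"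
        using \<epsilon> s by (intro elliptic_add elliptic_scaled_id cov_elliptic) auto
      from gauss_le[OF this, of v]
      have "gauss (mat \<epsilon> + (r - s) *\<^sub>R cov w) v
        \<le> exp (- (norm v)\<^sup>2 / (2 * (\<epsilon> + (r - s) * lmax))) / (2 * pi * (\<epsilon> + (r - s) * lmin)) powr (real CARD('d) / 2)" .
      also have "\<dots> \<le> 1 / peak (r - s)"
      proof (rule frac_le)
        show "exp (- (norm v)\<^sup>2 / (2 * (\<epsilon> + (r - s) * lmax))) \<le> 1"
          using \<epsilon> s constants_pos by simp
        show "peak (r - s) \<le> (2 * pi * (\<epsilon> + (r - s) * lmin)) powr (real CARD('d) / 2)"
          unfolding peak_def using \<epsilon> s constants_pos by (intro powr_mono2) auto
      qed (use s peak_pos in auto)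
      finally show ?thesis .
    qed
    then have "(\<integral>\<^sup>+\<omega>. Y \<omega> * ennreal (gauss (mat \<epsilon>) (X r \<omega> - z)) \<partial>M) \<le> (\<integral>\<^sup>+\<omega>. Y \<omega> * ennreal (1 / peak (r - s)) \<partial>M)"
      unfolding nn_integral_step_gauss[OF s Y(1) elliptic_scaled_id[OF \<epsilon>(1)]]
      by (intro nn_integral_mono mult_left_mono ennreal_leI) auto
    then show ?thesis by (simp add: nn_integral_multc mult.commute)
  qed
  then show ?thesis
    using nn_integral_X_le_of_mollified[OF Ym Y(2) s0(2) zero_less_one _ _ g] peak_pos[of "r - s"] s by simp
qed

text \<open>Loss in a step from a grid point: the variance is doubled to absorb the drift shift, the
  normalisation compares \<open>lmax\<close> with \<open>lmin\<close>, and the exponential is what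
  remains of the drift.\<close>

definition spread_const :: real where
  "spread_const = (2 * (lmax / lmin)) powr (real CARD('d) / 2) * exp (nb\<^sup>2 / (2 * lmax))"

lemma spread_const_ge_1: "1 \<le> spread_const"
proof -
  have "1 \<le> (2 * (lmax / lmin)) powr (real CARD('d) / 2)"
    using lmin_le_lmax constants_pos by (intro ge_one_powr_ge_zero) (auto simp: field_simps)
  moreover have "1 \<le> exp (nb\<^sup>2 / (2 * lmax))" using constants_pos by simp
  ultimately show ?thesis using mult_mono[of 1 "(2 * (lmax / lmin)) powr (real CARD('d) / 2)" 1 "exp (nb\<^sup>2 / (2 * lmax))"]
    by (simp add: spread_const_def)
qed

lemma nn_integral_exp_shifted:
  assumes c: "0 < c"
  shows "(\<integral>\<^sup>+w. ennreal (exp (- (norm (w - (z::'a::euclidean_space)))\<^sup>2 / (2 * c))) \<partial>lborel)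
    = ennreal ((2 * pi * c) powr (real DIM('a) / 2))"
proof -
  have "(\<integral>\<^sup>+w. ennreal (exp (- (norm (w - z))\<^sup>2 / (2 * c))) \<partial>lborel)
    = (\<integral>\<^sup>+w. ennreal (exp (- (norm (w - z))\<^sup>2 / (2 * c))) \<partial>(distr lborel borel ((+) z)))"
    by (simp only: lborel_distr_plus)
  also have "\<dots> = (\<integral>\<^sup>+w. ennreal (exp (- (norm w)\<^sup>2 / (2 * c))) \<partial>(lborel :: 'a measure))"
    by (subst nn_integral_distr) simp_all
  finally show ?thesis using nn_integral_exp_norm_square[OF c, where 'a='a] by simp
qed

text \<open>The one-step bound blows up as \<open>r\<close> approaches the grid point. Here a
  density bound already present at the grid point is carried along with a loss independent of the
  length of the step: the transition kernel, integrated over its starting point, stays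
  bounded.\<close>

lemma density_after_partial_step:
  assumes r: "real k * \<delta> < r" "r \<le> real (k + 1) * \<delta>"
    and Y: "Y \<in> borel_measurable (F (real k * \<delta>))" "integral\<^sup>N M Y < \<infinity>"
    and D: "0 \<le> D" and dens: "\<And>h. h \<in> borel_measurable borel \<Longrightarrow>
      (\<integral>\<^sup>+\<omega>. Y \<omega> * h (X (real k * \<delta>) \<omega>) \<partial>M) \<le> ennreal D * (\<integral>\<^sup>+x. h x \<partial>lborel) * integral\<^sup>N M Y"
    and g: "g \<in> borel_measurable borel"
  shows "(\<integral>\<^sup>+\<omega>. Y \<omega> * g (X r \<omega>) \<partial>M)
    \<le> ennreal (D * spread_const) * integral\<^sup>N lborel g * integral\<^sup>N M Y"
proof -
  have k0: "0 \<le> real k * \<delta>" using \<delta> by simp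
  then have r0: "0 \<le> r" using r by linarith
  have Ym [measurable]: "Y \<in> borel_measurable M" by (rule F_M[OF Y(1) k0])
  define u where "u = r - real k * \<delta>"
  have u: "0 < u" "u \<le> 1" using r \<delta> by (auto simp: u_def algebra_simps)
  define d where "d = real CARD('d) / 2"
  have d0: "0 \<le> d" by (simp add: d_def)
  have "(\<integral>\<^sup>+\<omega>. Y \<omega> * ennreal (gauss (mat \<epsilon>) (X r \<omega> - z)) \<partial>M) \<le> ennreal (D * spread_const) * integral\<^sup>N M Y"
    if \<epsilon>: "0 < \<epsilon>" "\<epsilon> \<le> 1" for \<epsilon> z
  proof -
    define lo where "lo = \<epsilon> + u * lmin"
    define hi where "hi = \<epsilon> + u * lmax"
    have lohi: "0 < lo" "lo \<le> hi" "0 < hi" "u * lmax \<le> hi"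
      using \<epsilon> u constants_pos lmin_le_lmax by (auto simp: lo_def hi_def add_pos_pos)
    define c where "c = exp (nb\<^sup>2 / (2 * lmax)) / (2 * pi * lo) powr d"
    have c: "0 \<le> c" by (simp add: c_def)
    have ptw: "gauss (mat \<epsilon> + u *\<^sub>R cov w) (w - z + u *\<^sub>R b w) \<le> c * exp (- (norm (w - z))\<^sup>2 / (2 * (2 * hi)))" for w
    proof -
      have el: "elliptic lo hi (mat \<epsilon> + u *\<^sub>R cov w)" unfolding lo_def hi_def
        using \<epsilon> u by (intro elliptic_add elliptic_scaled_id cov_elliptic) auto
      let ?v = "w - z + u *\<^sub>R b w"
      have "(norm (w - z))\<^sup>2 \<le> 2 * (norm ?v)\<^sup>2 + 2 * (u * nb)\<^sup>2"
      proof -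
        have "norm (w - z) \<le> norm ?v + norm (u *\<^sub>R b w)"
          using norm_triangle_ineq4[of ?v "u *\<^sub>R b w"] by simp
        also have "norm (u *\<^sub>R b w) \<le> u * nb" using u b_bound[of w] by simp
        finally have "(norm (w - z))\<^sup>2 \<le> (norm ?v + u * nb)\<^sup>2" by (intro power_mono) auto
        also have "\<dots> \<le> 2 * (norm ?v)\<^sup>2 + 2 * (u * nb)\<^sup>2"
          using zero_le_power2[of "norm ?v - u * nb"] by (simp add: power2_eq_square algebra_simps)
        finally show ?thesis .
      qed
      then have "- (norm ?v)\<^sup>2 / (2 * hi) \<le> - (norm (w - z))\<^sup>2 / (2 * (2 * hi)) + (u * nb)\<^sup>2 / (2 * hi)"
        using lohi by (simp add: field_simps)
      \<comment> \<open>This uses \<open>u \<le> 1\<close>, which holds because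
        \<open>\<delta> < 1\<close>.\<close>
      also have "(u * nb)\<^sup>2 / (2 * hi) \<le> nb\<^sup>2 / (2 * lmax)"
      proof -
        have "u\<^sup>2 * lmax \<le> u * lmax" using u constants_pos by (simp add: power2_eq_square mult_left_le)
        then have "u\<^sup>2 * lmax \<le> hi" using lohi by linarith
        then have "u\<^sup>2 * lmax * nb\<^sup>2 \<le> hi * nb\<^sup>2" by (rule mult_right_mono) simp
        then show ?thesis using lohi constants_pos by (simp add: power_mult_distrib field_simps)
      qed
      finally have "exp (- (norm ?v)\<^sup>2 / (2 * hi)) \<le> exp (nb\<^sup>2 / (2 * lmax)) * exp (- (norm (w - z))\<^sup>2 / (2 * (2 * hi)))"
        by (simp add: mult_exp_exp add.commute)
      then have "exp (- (norm ?v)\<^sup>2 / (2 * hi)) / (2 * pi * lo) powr d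
        \<le> exp (nb\<^sup>2 / (2 * lmax)) * exp (- (norm (w - z))\<^sup>2 / (2 * (2 * hi))) / (2 * pi * lo) powr d"
        by (rule divide_right_mono) simp
      then show ?thesis using gauss_le[OF el, of ?v] by (simp add: c_def d_def)
    qed
    have "(\<integral>\<^sup>+\<omega>. Y \<omega> * ennreal (gauss (mat \<epsilon>) (X r \<omega> - z)) \<partial>M)
      = (\<integral>\<^sup>+\<omega>. Y \<omega> * ennreal (gauss (mat \<epsilon> + u *\<^sub>R cov (X (real k * \<delta>) \<omega>))
          (X (real k * \<delta>) \<omega> - z + u *\<^sub>R b (X (real k * \<delta>) \<omega>))) \<partial>M)"
      unfolding u_def by (rule nn_integral_step_gauss[OF order.refl r Y(1) elliptic_scaled_id[OF \<epsilon>(1)]])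
    also have "\<dots> \<le> (\<integral>\<^sup>+\<omega>. Y \<omega> * ennreal (c * exp (- (norm (X (real k * \<delta>) \<omega> - z))\<^sup>2 / (2 * (2 * hi)))) \<partial>M)"
      by (intro nn_integral_mono mult_left_mono ennreal_leI ptw) simp
    also have "\<dots> \<le> ennreal D * (\<integral>\<^sup>+w. ennreal (c * exp (- (norm (w - z))\<^sup>2 / (2 * (2 * hi)))) \<partial>lborel) * integral\<^sup>N M Y"
      by (rule dens) measurable
    also have "(\<integral>\<^sup>+w. ennreal (c * exp (- (norm (w - z))\<^sup>2 / (2 * (2 * hi)))) \<partial>lborel)
      = (\<integral>\<^sup>+w. ennreal c * ennreal (exp (- (norm (w - z))\<^sup>2 / (2 * (2 * hi)))) \<partial>lborel)"
      using c by (simp add: ennreal_mult)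
    also have "\<dots> = ennreal c * (\<integral>\<^sup>+w. ennreal (exp (- (norm (w - z))\<^sup>2 / (2 * (2 * hi)))) \<partial>lborel)"
      by (rule nn_integral_cmult) measurable
    also have "\<dots> = ennreal c * ennreal ((2 * pi * (2 * hi)) powr d)"
      using nn_integral_exp_shifted[of "2 * hi" z] lohi by (simp add: d_def)
    also have "\<dots> = ennreal (c * (2 * pi * (2 * hi)) powr d)"
      using c by (intro ennreal_mult[symmetric]) auto
    also have "\<dots> \<le> ennreal spread_const"
    proof (rule ennreal_leI)
      have "c * (2 * pi * (2 * hi)) powr d = exp (nb\<^sup>2 / (2 * lmax)) * ((2 * pi * (2 * hi)) / (2 * pi * lo)) powr d"
        using lohi unfolding c_def by (subst powr_divide) auto
      also have "(2 * pi * (2 * hi)) / (2 * pi * lo) = 2 * (hi / lo)" using lohi by simp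
      \<comment> \<open>Adding the same \<open>\<epsilon>\<close> to both ellipticity bounds can
        only lower their ratio.\<close>
      also have "(2 * (hi / lo)) powr d \<le> (2 * (lmax / lmin)) powr d"
      proof (intro powr_mono2 mult_left_mono)
        have "\<epsilon> * lmin \<le> \<epsilon> * lmax" using \<epsilon> lmin_le_lmax by simp
        then have "hi * lmin \<le> lmax * lo" by (simp add: hi_def lo_def algebra_simps)
        then show "hi / lo \<le> lmax / lmin" using lohi constants_pos by (simp add: field_simps)
      qed (use d0 lohi in auto)
      finally show "c * (2 * pi * (2 * hi)) powr d \<le> spread_const"
        by (simp add: spread_const_def d_def mult.commute)
    qed
    finally have "(\<integral>\<^sup>+\<omega>. Y \<omega> * ennreal (gauss (mat \<epsilon>) (X r \<omega> - z)) \<partial>M)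
      \<le> ennreal D * ennreal spread_const * integral\<^sup>N M Y"
      by (simp add: mult_left_mono mult_right_mono)
    then show ?thesis using D spread_const_ge_1 by (simp add: ennreal_mult)
  qed
  then show ?thesis
    using nn_integral_X_le_of_mollified[OF Ym Y(2) r0 zero_less_one _ _ g] D spread_const_ge_1 by simp
qed

text \<open>The 2 is the short-time constant; the maximum bounds the ratio of all steps to the last
  steps that the short-time estimate can handle.\<close>

definition chain_const :: "real \<Rightarrow> real" where
  "chain_const T = 2 * max 1 (16 * growth_const\<^sup>2 * T) powr (real CARD('d) / 2)"

lemma chain_const_ge_2: "2 \<le> chain_const T"
proof -
  have "1 \<le> max 1 (16 * growth_const\<^sup>2 * T) powr (real CARD('d) / 2)" by (intro ge_one_powr_ge_zero) auto
  then show ?thesis by (simp add: chain_const_def)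
qed

text \<open>By the Markov property only the last \<open>l\<close> steps matter; \<open>l\<close> is taken as large as
  the short-time estimate permits.\<close>

lemma grid_density:
  assumes n: "1 \<le> n" and T: "real n * \<delta> \<le> T"
    and Y: "Y \<in> borel_measurable (F (real k * \<delta>))" "integral\<^sup>N M Y < \<infinity>"
    and g: "g \<in> borel_measurable borel"
  shows "(\<integral>\<^sup>+\<omega>. Y \<omega> * g (X (real (k + n) * \<delta>) \<omega>) \<partial>M)
    \<le> ennreal (chain_const T / peak (real n * \<delta>)) * integral\<^sup>N lborel g * integral\<^sup>N M Y"
proof -
  define G where "G = growth_const"
  have G0: "0 \<le> G" using growth_const_bounds(1) by (simp add: G_def)
  have n0: "0 < real n * \<delta>" using n \<delta> by simp
  have T0: "0 \<le> T" using n0 T by simp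
  have kd: "0 \<le> real k * \<delta>" using \<delta> by simp
  have "\<exists>l. 1 \<le> l \<and> l \<le> n \<and> real n \<le> max 1 (16 * G\<^sup>2 * T) * real l \<and> (l = 1 \<or> G * sqrt (2 * (real l * \<delta>)) \<le> 1 / 2)"
  proof (cases "G * sqrt (2 * (real n * \<delta>)) \<le> 1 / 2")
    case True
    have "1 * real n \<le> max 1 (16 * G\<^sup>2 * T) * real n" by (intro mult_right_mono) auto
    with True n show ?thesis by (intro exI[of _ n]) auto
  next
    case False
    then have Gpos: "0 < G" using G0 by (cases "G = 0") auto
    \<comment> \<open>The exact threshold, in numbers of steps, of the short-time condition. Any
      \<open>y\<close> with \<open>x \<le> 2 * y\<close> is long enough for the required ratio,
      which is why 8 here becomes 16 in \<open>chain_const\<close>.\<close>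
    define x where "x = 1 / (8 * G\<^sup>2 * \<delta>)"
    have x: "0 < x" using Gpos \<delta> by (simp add: x_def)
    have short: "G * sqrt (2 * (y * \<delta>)) \<le> 1 / 2 \<longleftrightarrow> y \<le> x" if "0 \<le> y" for y
    proof -
      have "G * sqrt (2 * (y * \<delta>)) \<le> 1 / 2 \<longleftrightarrow> (G * sqrt (2 * (y * \<delta>)))\<^sup>2 \<le> (1 / 2)\<^sup>2"
        using G0 that \<delta> by (intro power_mono_iff[symmetric]) auto
      also have "\<dots> \<longleftrightarrow> y \<le> x" using that \<delta> Gpos by (simp add: power_mult_distrib x_def power2_eq_square field_simps)
      finally show ?thesis .
    qed
    have nx: "x < real n" using False short[of "real n"] by simp
    have bound: "real n \<le> max 1 (16 * G\<^sup>2 * T) * y" if y: "x \<le> 2 * y" for y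
    proof -
      have y0: "0 < y" using y x by simp
      have "real n = 16 * G\<^sup>2 * (real n * \<delta>) * (x / 2)" using Gpos \<delta> by (simp add: x_def)
      also have "\<dots> \<le> 16 * G\<^sup>2 * T * y"
        using y x T T0 \<delta> by (intro mult_mono mult_left_mono) auto
      also have "\<dots> \<le> max 1 (16 * G\<^sup>2 * T) * y" using y0 by (intro mult_right_mono) auto
      finally show ?thesis .
    qed
    show ?thesis
    proof (cases "1 \<le> x")
      case True
      \<comment> \<open>For \<open>x \<ge> 1\<close> rounding down loses less than a factor 2. If
        \<open>x < 1\<close>, even one step violates the short-time condition, and
        \<open>l = 1\<close> is left to the one-step bound.\<close>
      define l where "l = nat \<lfloor>x\<rfloor>"
      have l1: "real l \<le> x" "x < real l + 1" using True unfolding l_def by linarith+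
      then have "1 \<le> l" using True by (cases l) auto
      with l1 have l: "real l \<le> x" "x \<le> 2 * real l" "1 \<le> l" by linarith+
      have "l \<le> n" using l nx by linarith
      with l bound[of "real l"] short[of "real l"] show ?thesis by (intro exI[of _ l]) auto
    next
      case False
      with bound[of 1] n show ?thesis by (intro exI[of _ 1]) auto
    qed
  qed
  then obtain l where l: "1 \<le> l" "l \<le> n" "real n \<le> max 1 (16 * G\<^sup>2 * T) * real l"
    and cases: "l = 1 \<or> G * sqrt (2 * (real l * \<delta>)) \<le> 1 / 2" by blast
  define j where "j = k + n - l"
  have j: "j + l = k + n" "k \<le> j" using l by (auto simp: j_def)
  have jd: "real k * \<delta> \<le> real j * \<delta>" using j \<delta> by simp
  have l0: "0 < real l * \<delta>" using l \<delta> by simp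
  have "(\<integral>\<^sup>+\<omega>. Y \<omega> * g (X (real (j + l) * \<delta>) \<omega>) \<partial>M)
    \<le> ennreal (2 / peak (real l * \<delta>)) * integral\<^sup>N lborel g * integral\<^sup>N M Y"
  proof (cases "l = 1")
    case True
    have "(\<integral>\<^sup>+\<omega>. Y \<omega> * g (X (real (j + 1) * \<delta>) \<omega>) \<partial>M)
      \<le> ennreal (1 / peak (real (j + 1) * \<delta> - real j * \<delta>)) * integral\<^sup>N lborel g * integral\<^sup>N M Y"
      by (rule single_step_density[OF order.refl _ order.refl F_mono[OF Y(1) kd jd] Y(2) g]) (use \<delta> in auto)
    also have "real (j + 1) * \<delta> - real j * \<delta> = real l * \<delta>" using True by (simp add: algebra_simps)
    also have "ennreal (1 / peak (real l * \<delta>)) * integral\<^sup>N lborel g * integral\<^sup>N M Y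
      \<le> ennreal (2 / peak (real l * \<delta>)) * integral\<^sup>N lborel g * integral\<^sup>N M Y"
      using peak_pos[OF l0] by (intro mult_right_mono ennreal_leI divide_right_mono) auto
    finally show ?thesis using True by simp
  next
    case False
    with cases show ?thesis
      using grid_density_short_time[OF l(1) _ F_mono[OF Y(1) kd jd] Y(2) g] by (simp add: peak_def G_def)
  qed
  also have "\<dots> \<le> ennreal (chain_const T / peak (real n * \<delta>)) * integral\<^sup>N lborel g * integral\<^sup>N M Y"
  proof (intro mult_right_mono ennreal_leI)
    have "real n * \<delta> \<le> max 1 (16 * G\<^sup>2 * T) * (real l * \<delta>)"
      using mult_right_mono[OF l(3), of \<delta>] \<delta> by (simp add: mult.assoc)
    then have "peak (real n * \<delta>) \<le> peak (max 1 (16 * G\<^sup>2 * T) * (real l * \<delta>))" using n0 by (intro peak_mono) auto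
    also have "\<dots> = max 1 (16 * G\<^sup>2 * T) powr (real CARD('d) / 2) * peak (real l * \<delta>)"
      by (rule peak_mult) (use l0 in auto)
    finally have "2 * peak (real n * \<delta>) \<le> chain_const T * peak (real l * \<delta>)" by (simp add: chain_const_def G_def)
    then show "2 / peak (real l * \<delta>) \<le> chain_const T / peak (real n * \<delta>)"
      using peak_pos[OF l0] peak_pos[OF n0] by (simp add: field_simps)
  qed auto
  finally show ?thesis by (simp only: j)
qed

definition density_const :: "real \<Rightarrow> real" where
  "density_const T = chain_const T * spread_const * 3 powr (real CARD('d) / 2)"

text \<open>If \<open>[s, r]\<close> contains at least one full grid step, the full steps make up at least a
  third of it; otherwise one of its at most two partial steps makes up at least half.\<close>

theorem density_bound:
  assumes s: "0 \<le> s" "s < r" "r \<le> T"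
    and Y: "Y \<in> borel_measurable (F s)" "integral\<^sup>N M Y < \<infinity>" and g: "g \<in> borel_measurable borel"
  shows "(\<integral>\<^sup>+\<omega>. Y \<omega> * g (X r \<omega>) \<partial>M)
    \<le> ennreal (density_const T / peak (r - s)) * integral\<^sup>N lborel g * integral\<^sup>N M Y"
proof -
  \<comment> \<open>Every case ends in a bound \<open>C / peak t\<close> for some \<open>t\<close>
    that covers at least a third of the interval; the third becomes the power of 3 in
    \<open>density_const\<close>.\<close>
  have concl: ?thesis if D: "0 \<le> C" "C \<le> chain_const T * spread_const" and t: "0 < t" "r - s \<le> 3 * t"
    and le: "(\<integral>\<^sup>+\<omega>. Y \<omega> * g (X r \<omega>) \<partial>M) \<le> ennreal (C / peak t) * integral\<^sup>N lborel g * integral\<^sup>N M Y" for C t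
  proof (rule order_trans[OF le], intro mult_right_mono ennreal_leI)
    have "peak (r - s) \<le> peak (3 * t)" using s t by (intro peak_mono) auto
    also have "\<dots> = 3 powr (real CARD('d) / 2) * peak t" by (rule peak_mult) (use t in auto)
    finally have "C * peak (r - s) \<le> chain_const T * spread_const * (3 powr (real CARD('d) / 2) * peak t)"
      using D by (intro mult_mono) (auto simp: peak_def)
    then show "C / peak t \<le> density_const T / peak (r - s)"
      using peak_pos[OF t(1)] peak_pos[of "r - s"] s by (simp add: density_const_def field_simps)
  qed auto
  have cc: "1 \<le> spread_const" "1 \<le> chain_const T" using spread_const_ge_1 chain_const_ge_2[of T] by auto
  have one: "1 \<le> chain_const T * spread_const" "spread_const \<le> chain_const T * spread_const"
    using mult_mono[of 1 "chain_const T" 1 spread_const] mult_right_mono[of 1 "chain_const T" spread_const] cc by auto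
  define k where "k = nat \<lfloor>s / \<delta>\<rfloor>"
  \<comment> \<open>The ceiling minus one puts \<open>r\<close> into
    \<open>real l * \<delta> < r \<le> real (l + 1) * \<delta>\<close>: a grid time belongs to the
    step that it ends, so the last partial step has positive length.\<close>
  define l where "l = nat (\<lceil>r / \<delta>\<rceil> - 1)"
  have "real k \<le> s / \<delta>" "s / \<delta> < real k + 1" using s \<delta> by (auto simp: k_def)
  then have k: "real k * \<delta> \<le> s" "s < real (k + 1) * \<delta>" using \<delta> by (auto simp: field_simps)
  have "0 < r / \<delta>" using s \<delta> by simp
  then have "real l < r / \<delta>" "r / \<delta> \<le> real l + 1" unfolding l_def by linarith+
  then have l: "real l * \<delta> < r" "r \<le> real (l + 1) * \<delta>" using \<delta> by (auto simp: field_simps)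
  have "real k * \<delta> < real (l + 1) * \<delta>" using k l s by linarith
  then have kl: "k \<le> l" using \<delta> by simp
  show ?thesis
  proof (cases "k = l")
    case True
    show ?thesis
      by (rule concl[OF _ one(1) _ _ single_step_density[OF k(1) s(2) _ Y g]]) (use s l True in auto)
  next
    case False
    define n where "n = l - (k + 1)"
    have ln: "l = k + 1 + n" using False kl by (simp add: n_def)
    have l0: "0 \<le> real l * \<delta>" "real (k + 1) * \<delta> \<le> real l * \<delta>" "0 \<le> real (k + 1) * \<delta>" using \<delta> ln by auto
    have sk: "s \<le> real (k + 1) * \<delta>" "s \<le> real l * \<delta>" using k l0 by linarith+
    note Yl = F_mono[OF Y(1) s(1) sk(2)] note Yk = F_mono[OF Y(1) s(1) sk(1)]
    have width: "r - s \<le> (real n + 2) * \<delta>" using k l ln by (simp add: algebra_simps)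
    show ?thesis
    proof (cases "n = 0")
      case True
      show ?thesis
      proof (cases "real l * \<delta> - s \<le> r - real l * \<delta>")
        case True
        define y where "y = real l * \<delta>"
        have "r - s \<le> 3 * (r - real l * \<delta>)" using True l(1) unfolding y_def[symmetric] by argo
        then show ?thesis
          by (intro concl[OF _ one(1) _ _ single_step_density[OF order.refl l Yl Y(2) g]]) (use l in auto)
      next
        \<comment> \<open>The first partial step is the longer one: it supplies the density at the
          grid point, and the second only spreads it.\<close>
        case False
        have lk: "real l * \<delta> = real (k + 1) * \<delta>" using ln True by simp
        have sl: "s < real l * \<delta>" unfolding lk by (rule k(2))
        have "(\<integral>\<^sup>+\<omega>. Y \<omega> * g (X r \<omega>) \<partial>M)
          \<le> ennreal (1 / peak (real l * \<delta> - s) * spread_const) * integral\<^sup>N lborel g * integral\<^sup>N M Y"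
          by (rule density_after_partial_step[OF l Yl Y(2) _ _ g])
             (use peak_pos[of "real l * \<delta> - s"] sl single_step_density[OF k(1) sl _ Y] lk in auto)
        moreover define y where "y = real l * \<delta>"
        then have "r - s \<le> 3 * (real l * \<delta> - s)" using False sl unfolding y_def[symmetric] by argo
        ultimately show ?thesis
          by (intro concl[OF _ one(2), of "real l * \<delta> - s"]) (use sl cc in auto)
      qed
    next
      case False
      then have n1: "1 \<le> n" by simp
      then have n0: "0 < real n * \<delta>" using \<delta> by simp
      have nT: "real n * \<delta> \<le> T"
      proof -
        have "real n * \<delta> \<le> real l * \<delta>" using ln \<delta> by simp
        then show ?thesis using l s by linarith
      qed
      have "(\<integral>\<^sup>+\<omega>. Y \<omega> * g (X r \<omega>) \<partial>M)
        \<le> ennreal (chain_const T / peak (real n * \<delta>) * spread_const) * integral\<^sup>N lborel g * integral\<^sup>N M Y"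
        by (rule density_after_partial_step[OF l Yl Y(2) _ _ g])
           (use peak_pos[OF n0] cc grid_density[OF n1 nT Yk Y(2)] ln in auto)
      moreover have "r - s \<le> 3 * (real n * \<delta>)"
      proof -
        have "2 * \<delta> \<le> 2 * (real n * \<delta>)" using n1 \<delta> by simp
        then show ?thesis using width by (simp add: algebra_simps)
      qed
      ultimately show ?thesis
        by (intro concl[OF _ order.refl n0]) (use cc in auto)
    qed
  qed
qed

end

section \<open>Krylov estimate\<close>

text \<open>Stated with upper bounds \<open>I\<close>, \<open>J\<close> in place of norms, so that
  vanishing integrals need no separate treatment. Young's inequality requires positive normalisers;
  zero is reached by letting \<open>1 / n\<close> tend to 0.\<close>

lemma nn_integral_Hoelder:
  fixes f g :: "'a \<Rightarrow> real"
  assumes pq: "1 < p" "1 < q" "1 / p + 1 / q = 1"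
    and [measurable]: "f \<in> borel_measurable M" "g \<in> borel_measurable M"
    and nonneg: "\<And>x. 0 \<le> f x" "\<And>x. 0 \<le> g x"
    and IJ: "0 \<le> I" "0 \<le> J"
    and f: "(\<integral>\<^sup>+x. ennreal (f x powr p) \<partial>M) \<le> ennreal I"
    and g: "(\<integral>\<^sup>+x. ennreal (g x powr q) \<partial>M) \<le> ennreal J"
  shows "(\<integral>\<^sup>+x. ennreal (f x * g x) \<partial>M) \<le> ennreal (I powr (1 / p) * J powr (1 / q))"
proof -
  have pos: "(\<integral>\<^sup>+x. ennreal (f x * g x) \<partial>M) \<le> ennreal (I' powr (1 / p) * J' powr (1 / q))"
    if I': "0 < I'" "I \<le> I'" and J': "0 < J'" "J \<le> J'" for I' J'
  proof -
    define a where "a = I' powr (1 / p)"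
    define c where "c = J' powr (1 / q)"
    have ac: "0 < a" "0 < c" "a powr p = I'" "c powr q = J'"
      using I' J' pq by (auto simp: a_def c_def powr_powr)
    have "f x * g x \<le> (a * c / (p * I')) * f x powr p + (a * c / (q * J')) * g x powr q" for x
    proof -
      have "(f x / a) * (g x / c) \<le> (f x / a) powr p / p + (g x / c) powr q / q"
        by (rule Youngs_inequality[OF pq]) (use nonneg ac in auto)
      also have "\<dots> = f x powr p / (p * I') + g x powr q / (q * J')"
        using ac nonneg by (simp add: powr_divide mult.commute)
      finally have "(a * c) * ((f x / a) * (g x / c)) \<le> (a * c) * (f x powr p / (p * I') + g x powr q / (q * J'))"
        using ac by (intro mult_left_mono) auto
      then show ?thesis using ac by (simp add: distrib_left)
    qed
    then have "(\<integral>\<^sup>+x. ennreal (f x * g x) \<partial>M)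
      \<le> (\<integral>\<^sup>+x. ennreal ((a * c / (p * I')) * f x powr p + (a * c / (q * J')) * g x powr q) \<partial>M)"
      by (intro nn_integral_mono ennreal_leI)
    also have "\<dots> = (\<integral>\<^sup>+x. ennreal (a * c / (p * I')) * ennreal (f x powr p) + ennreal (a * c / (q * J')) * ennreal (g x powr q) \<partial>M)"
      using ac pq I' J' by (intro nn_integral_cong) (simp add: ennreal_mult[symmetric])
    also have "\<dots> = ennreal (a * c / (p * I')) * (\<integral>\<^sup>+x. ennreal (f x powr p) \<partial>M)
      + ennreal (a * c / (q * J')) * (\<integral>\<^sup>+x. ennreal (g x powr q) \<partial>M)"
      by (subst nn_integral_add) (auto simp: nn_integral_cmult)
    also have "\<dots> \<le> ennreal (a * c / (p * I')) * ennreal I' + ennreal (a * c / (q * J')) * ennreal J'"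
      using order_trans[OF f ennreal_leI[OF I'(2)]] order_trans[OF g ennreal_leI[OF J'(2)]]
      by (intro add_mono mult_left_mono) auto
    also have "\<dots> = ennreal (a * c / p + a * c / q)"
      using ac pq I' J' by (simp add: ennreal_mult[symmetric])
    also have "a * c / p + a * c / q = a * c * (1 / p + 1 / q)" by (simp add: distrib_left)
    finally show ?thesis by (simp add: pq a_def c_def)
  qed
  have "(\<lambda>n. (I + 1 / real (Suc n)) powr (1 / p) * (J + 1 / real (Suc n)) powr (1 / q))
    \<longlonglongrightarrow> (I + 0) powr (1 / p) * (J + 0) powr (1 / q)"
    using pq IJ by (intro tendsto_intros tendsto_powr' LIMSEQ_Suc[OF lim_1_over_n]) (auto intro!: always_eventually)
  then have lim: "(\<lambda>n. ennreal ((I + 1 / real (Suc n)) powr (1 / p) * (J + 1 / real (Suc n)) powr (1 / q)))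
    \<longlonglongrightarrow> ennreal (I powr (1 / p) * J powr (1 / q))" by (intro tendsto_ennrealI) simp
  have "(\<integral>\<^sup>+x. ennreal (f x * g x) \<partial>M)
     \<le> ennreal ((I + 1 / real (Suc n)) powr (1 / p) * (J + 1 / real (Suc n)) powr (1 / q))" for n
    by (rule pos) (use IJ in \<open>auto simp: add_nonneg_pos\<close>)
  then show ?thesis by (intro LIMSEQ_le_const[OF lim] exI allI impI)
qed

lemma nn_integral_powr_interval:
  assumes "a < 1" "s < (t::real)"
  shows "(\<integral>\<^sup>+r. ennreal (indicator {s<..t} r * (r - s) powr (- a)) \<partial>lborel) = ennreal ((t - s) powr (1 - a) / (1 - a))"
proof -
  have "(\<integral>\<^sup>+r. ennreal (indicator {s<..t} r * (r - s) powr (- a)) \<partial>lborel)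
    = (\<integral>\<^sup>+r. ennreal (indicator {s<..t} r * (r - s) powr (- a)) \<partial>(distr lborel borel ((+) s)))"
    by (simp add: lborel_distr_plus)
  also have "\<dots> = (\<integral>\<^sup>+r. ennreal (indicator {s<..t} (s + r) * r powr (- a)) \<partial>lborel)"
    by (subst nn_integral_distr) simp_all
  \<comment> \<open>The endpoint \<open>r = 0\<close> may be added because
    \<open>0 powr (- a) = 0\<close>.\<close>
  also have "\<dots> = (\<integral>\<^sup>+r. ennreal (indicator {0..t - s} r * r powr (- a)) \<partial>lborel)"
    by (intro nn_integral_cong) (auto simp: indicator_def)
  also have "\<dots> = ennreal ((t - s) powr (- a + 1) / (- a + 1))"
  proof (rule nn_integral_has_integral_lborel)
    show "((\<lambda>r. indicator {0..t - s} r * r powr (- a)) has_integral (t - s) powr (- a + 1) / (- a + 1)) UNIV"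
    proof -
      have "((\<lambda>r. r powr (- a)) has_integral (t - s) powr (- a + 1) / (- a + 1)) {0..t - s}"
        using assms by (intro has_integral_powr_from_0) auto
      then have "((\<lambda>r. if r \<in> {0..t - s} then r powr (- a) else 0) has_integral (t - s) powr (- a + 1) / (- a + 1)) UNIV"
        by (simp only: has_integral_restrict_UNIV)
      then show ?thesis by (rule has_integral_eq[rotated]) (simp add: indicator_def)
    qed
  qed auto
  finally show ?thesis by (simp add: add.commute)
qed

context euler_scheme
begin

lemma density_const_ge_1: "1 \<le> density_const T"
proof -
  have "1 * 1 \<le> chain_const T * spread_const"
    using chain_const_ge_2[of T] spread_const_ge_1 by (intro mult_mono) auto
  then have "1 * 1 \<le> chain_const T * spread_const * 3 powr (real CARD('d) / 2)"
    by (intro mult_mono) (auto intro: ge_one_powr_ge_zero)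
  then show ?thesis by (simp add: density_const_def)
qed

text \<open>Hoelder's inequality against the constant 1 under \<open>density M Y\<close>. Only the
  power \<open>1 / p\<close> of the density bound is paid, which tames the time singularity to
  \<open>(r - s) powr (- d / (2 * p))\<close> in dimension \<open>d\<close>.\<close>

lemma Lp_density_bound:
  fixes g :: "real ^ 'd \<Rightarrow> real"
  assumes s: "0 \<le> s" "s < r" "r \<le> T"
    and Y: "Y \<in> borel_measurable (F s)" "integral\<^sup>N M Y < \<infinity>"
    and g [measurable]: "g \<in> borel_measurable borel" and g0: "\<And>x. 0 \<le> g x"
    and p: "1 < p" and G: "0 \<le> G" "(\<integral>\<^sup>+x. ennreal (g x powr p) \<partial>lborel) \<le> ennreal G"
  shows "(\<integral>\<^sup>+\<omega>. Y \<omega> * ennreal (g (X r \<omega>)) \<partial>M)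
    \<le> ennreal ((density_const T / peak (r - s)) powr (1 / p) * G powr (1 / p)) * integral\<^sup>N M Y"
proof -
  have r0: "0 \<le> r" using s by simp
  have [measurable]: "Y \<in> borel_measurable M" by (rule F_M[OF Y(1) s(1)])
  note [measurable] = X_M[OF r0]
  define D where "D = density_const T / peak (r - s)"
  have D: "0 \<le> D" using peak_pos[of "r - s"] s density_const_ge_1[of T] by (simp add: D_def)
  obtain e where e: "0 \<le> e" "integral\<^sup>N M Y = ennreal e"
    using Y(2) by (cases "integral\<^sup>N M Y" rule: ennreal_cases) auto
  let ?Q = "density M Y"
  define q where "q = p / (p - 1)"
  have pq: "1 < p" "1 < q" "1 / p + 1 / q = 1" using p by (auto simp: q_def field_simps)
  have I: "(\<integral>\<^sup>+\<omega>. ennreal (g (X r \<omega>) powr p) \<partial>?Q) \<le> ennreal (D * G * e)"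
  proof -
    have "(\<integral>\<^sup>+\<omega>. ennreal (g (X r \<omega>) powr p) \<partial>?Q) = (\<integral>\<^sup>+\<omega>. Y \<omega> * ennreal (g (X r \<omega>) powr p) \<partial>M)"
      by (simp add: nn_integral_density)
    also have "\<dots> \<le> ennreal D * (\<integral>\<^sup>+x. ennreal (g x powr p) \<partial>lborel) * ennreal e"
      unfolding D_def e(2)[symmetric] by (rule density_bound[OF s Y]) measurable
    also have "\<dots> \<le> ennreal D * ennreal G * ennreal e"
      by (intro mult_right_mono mult_left_mono G(2)) auto
    also have "\<dots> = ennreal (D * G * e)" using D G e by (simp add: ennreal_mult)
    finally show ?thesis .
  qed
  have "(\<integral>\<^sup>+\<omega>. Y \<omega> * ennreal (g (X r \<omega>)) \<partial>M) = (\<integral>\<^sup>+\<omega>. ennreal (g (X r \<omega>) * 1) \<partial>?Q)"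
    by (simp add: nn_integral_density)
  also have "\<dots> \<le> ennreal ((D * G * e) powr (1 / p) * e powr (1 / q))"
  proof (rule nn_integral_Hoelder[OF pq _ _ _ _ _ _ I])
    show "(\<integral>\<^sup>+\<omega>. ennreal (1 powr q) \<partial>?Q) \<le> ennreal e"
      using e by (simp add: emeasure_density cong: nn_integral_cong_simp)
  qed (use D G e g0 in auto)
  also have "(D * G * e) powr (1 / p) * e powr (1 / q) = D powr (1 / p) * G powr (1 / p) * e"
  proof (cases "e = 0")
    case False
    then have "e powr (1 / p) * e powr (1 / q) = e" using e by (simp add: powr_add[symmetric] pq)
    then show ?thesis using D G e by (simp add: powr_mult)
  qed simp
  finally show ?thesis using D G e by (simp add: D_def ennreal_mult)
qed

text \<open>The last factor comes from the norm of the time singularity on \<open>[s, t]\<close> in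
  the exponent conjugate to \<open>q\<close>, whose remaining part is
  \<open>(t - s) powr (1 / gamma0)\<close>.\<close>

definition krylov_const :: "real \<Rightarrow> real \<Rightarrow> real \<Rightarrow> real" where
  "krylov_const T p q = density_const T powr (1 / p) / (2 * pi * lmin) powr (real CARD('d) / (2 * p))
     * (gamma0 CARD('d) p q * (1 - 1 / q)) powr ((q - 1) / q)"

theorem krylov_estimate:
  fixes h :: "real \<Rightarrow> real ^ 'd \<Rightarrow> real"
  assumes h [measurable]: "(\<lambda>(t, x). h t x) \<in> borel_measurable (borel \<Otimes>\<^sub>M borel)" and h0: "\<And>t x. 0 \<le> h t x"
    and pq: "1 < p" "1 < q" "real CARD('d) / p + 2 / q < 2"
    and J: "0 \<le> J" "(\<integral>\<^sup>+t\<in>{0..T}. ennpowr (\<integral>\<^sup>+x. ennreal (h t x powr p) \<partial>lborel) (q / p) \<partial>lborel) \<le> ennreal J"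
    and s: "0 \<le> s" "s < t" "t \<le> T"
    and Y: "Y \<in> borel_measurable (F s)" "integral\<^sup>N M Y < \<infinity>"
  shows "(\<integral>\<^sup>+r\<in>{s..t}. (\<integral>\<^sup>+\<omega>. Y \<omega> * ennreal (h r (X r \<omega>)) \<partial>M) \<partial>lborel)
    \<le> ennreal (krylov_const T p q * J powr (1 / q) * (t - s) powr (1 / gamma0 CARD('d) p q)) * integral\<^sup>N M Y"
proof -
  define d where "d = real CARD('d) / (2 * p)"
  define q' where "q' = q / (q - 1)"
  define \<gamma> where "\<gamma> = gamma0 CARD('d) p q"
  have qq: "1 < q'" "1 < q" "1 / q' + 1 / q = 1" using pq by (auto simp: q'_def field_simps)
  have q'inv: "1 / q' = 1 - 1 / q" "1 / q' = (q - 1) / q" using pq by (auto simp: q'_def field_simps)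
  have d0: "0 \<le> d" using pq by (simp add: d_def)
  have "1 - 1 / q - d > 0" using pq(3) by (simp add: d_def field_simps)
  moreover have g_eq: "\<gamma> = 1 / (1 - 1 / q - d)" by (simp add: \<gamma>_def gamma0_def d_def)
  ultimately have \<gamma>: "0 < \<gamma>" "1 / \<gamma> = 1 / q' - d" by (simp_all add: q'inv(1))
  \<comment> \<open>The identity makes integrability of the singularity in the power
    \<open>q'\<close>, that is \<open>d * q' < 1\<close>, a consequence of
    \<open>\<gamma> > 0\<close>. Integration produces \<open>(t - s) powr (q' / \<gamma>)\<close>,
    whose root of order \<open>q'\<close> has the desired exponent
    \<open>1 / \<gamma>\<close>.\<close>
  have beta: "1 - d * q' = q' / \<gamma>" using \<gamma>(2) qq by (simp add: divide_inverse[of q' \<gamma>] inverse_eq_divide right_diff_distrib)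
  have beta1: "d * q' < 1" using beta \<gamma> qq by (metis diff_gt_0_iff_gt divide_pos_pos less_trans zero_less_one)
  obtain e where e: "0 \<le> e" "integral\<^sup>N M Y = ennreal e"
    using Y(2) by (cases "integral\<^sup>N M Y" rule: ennreal_cases) auto
  define H where "H r = (\<integral>\<^sup>+x. ennreal (h r x powr p) \<partial>lborel)" for r
  have [measurable]: "H \<in> borel_measurable borel" unfolding H_def by measurable
  have [measurable]: "(\<lambda>r. ennpowr (H r) (q / p)) \<in> borel_measurable borel"
    unfolding ennpowr_def by measurable
  have finH: "AE r in lborel. r \<in> {0..T} \<longrightarrow> H r < \<infinity>"
  proof -
    have "(\<integral>\<^sup>+r. ennpowr (H r) (q / p) * indicator {0..T} r \<partial>lborel) \<noteq> \<infinity>"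
      using J(2) unfolding H_def by (auto simp: top_unique)
    then have "AE r in lborel. ennpowr (H r) (q / p) * indicator {0..T} r \<noteq> \<infinity>"
      by (intro nn_integral_PInf_AE) auto
    then show ?thesis by eventually_elim (auto simp: ennpowr_def top.not_eq_extremum indicator_def split: if_splits)
  qed
  define G where "G r = enn2real (H r) powr (1 / p)" for r
  define \<phi> where "\<phi> r = (density_const T / peak (r - s)) powr (1 / p)" for r
  have [measurable]: "G \<in> borel_measurable borel" "\<phi> \<in> borel_measurable borel"
    unfolding G_def \<phi>_def peak_def by measurable
  have peak1: "\<phi> r powr q' = (density_const T powr (1 / p) / (2 * pi * lmin) powr d) powr q' * (r - s) powr (- (d * q'))"
    if "s < r" for r
  proof -
    have "peak (r - s) powr (1 / p) = (2 * pi * lmin) powr d * (r - s) powr d"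
    proof -
      have "peak (r - s) powr (1 / p) = (2 * pi * lmin * (r - s)) powr d"
        by (simp add: peak_def powr_powr d_def mult.assoc)
      also have "\<dots> = (2 * pi * lmin) powr d * (r - s) powr d"
        by (rule powr_mult)
      finally show ?thesis .
    qed
    then have "\<phi> r = (density_const T powr (1 / p) / (2 * pi * lmin) powr d) * (r - s) powr (- d)"
      unfolding \<phi>_def using density_const_ge_1[of T] peak_pos[of "r - s"] that
      by (simp add: powr_divide powr_minus field_simps)
    then show ?thesis
      by (simp only: powr_mult[of _ "(r - s) powr (- d)"] powr_powr mult_minus_left)
  qed
  define B where "B = density_const T powr (1 / p) / (2 * pi * lmin) powr d"
  have B0: "0 \<le> B" by (simp add: B_def)
  have "(\<integral>\<^sup>+r\<in>{s..t}. (\<integral>\<^sup>+\<omega>. Y \<omega> * ennreal (h r (X r \<omega>)) \<partial>M) \<partial>lborel)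
    \<le> (\<integral>\<^sup>+r. ennreal ((indicator {s<..t} r * \<phi> r) * (indicator {0..T} r * G r)) * ennreal e \<partial>lborel)"
  proof (rule nn_integral_mono_AE)
    have "AE r in lborel. r \<noteq> s" by (rule AE_lborel_singleton)
    with finH show "AE r in lborel. (\<integral>\<^sup>+\<omega>. Y \<omega> * ennreal (h r (X r \<omega>)) \<partial>M) * indicator {s..t} r
      \<le> ennreal ((indicator {s<..t} r * \<phi> r) * (indicator {0..T} r * G r)) * ennreal e"
    proof eventually_elim
      case (elim r)
      show ?case
      proof (cases "r \<in> {s..t}")
        case True
        with elim s have r: "s < r" "r \<le> t" "r \<le> T" "r \<in> {0..T}" "r \<in> {s<..t}" by auto
        have m: "(\<lambda>x. h r x) \<in> borel_measurable borel"
          using measurable_compose[OF measurable_Pair1'[of r borel borel] h] by simp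
        have fin: "(\<integral>\<^sup>+x. ennreal (h r x powr p) \<partial>lborel) \<le> ennreal (enn2real (H r))"
          using elim r by (simp add: H_def)
        show ?thesis
          using Lp_density_bound[OF s(1) r(1,3) Y m h0 pq(1) _ fin] r True
          by (simp add: \<phi>_def G_def e)
      qed simp
    qed
  qed
  also have "\<dots> = (\<integral>\<^sup>+r. ennreal ((indicator {s<..t} r * \<phi> r) * (indicator {0..T} r * G r)) \<partial>lborel) * ennreal e"
    by (rule nn_integral_multc) measurable
  also have "\<dots> \<le> ennreal ((B powr q' * ((t - s) powr (1 - d * q') / (1 - d * q'))) powr (1 / q') * J powr (1 / q)) * ennreal e"
  proof (rule mult_right_mono[OF nn_integral_Hoelder[OF qq]])
    have "(\<integral>\<^sup>+r. ennreal ((indicator {s<..t} r * \<phi> r) powr q') \<partial>lborel)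
      = (\<integral>\<^sup>+r. ennreal (B powr q') * ennreal (indicator {s<..t} r * (r - s) powr (- (d * q'))) \<partial>lborel)"
      by (intro nn_integral_cong) (auto simp: indicator_def peak1 B_def ennreal_mult)
    also have "\<dots> = ennreal (B powr q') * (\<integral>\<^sup>+r. ennreal (indicator {s<..t} r * (r - s) powr (- (d * q'))) \<partial>lborel)"
      by (rule nn_integral_cmult) measurable
    also have "\<dots> = ennreal (B powr q' * ((t - s) powr (1 - d * q') / (1 - d * q')))"
      unfolding nn_integral_powr_interval[OF beta1 s(2)] using beta1
      by (intro ennreal_mult[symmetric]) auto
    finally show "(\<integral>\<^sup>+r. ennreal ((indicator {s<..t} r * \<phi> r) powr q') \<partial>lborel)
      \<le> ennreal (B powr q' * ((t - s) powr (1 - d * q') / (1 - d * q')))" by simp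
    have "(\<integral>\<^sup>+r. ennreal ((indicator {0..T} r * G r) powr q) \<partial>lborel)
      \<le> (\<integral>\<^sup>+r. ennpowr (H r) (q / p) * indicator {0..T} r \<partial>lborel)"
      using pq by (intro nn_integral_mono) (auto simp: indicator_def G_def ennpowr_def powr_powr)
    also have "\<dots> \<le> ennreal J" using J(2) unfolding H_def .
    finally show "(\<integral>\<^sup>+r. ennreal ((indicator {0..T} r * G r) powr q) \<partial>lborel) \<le> ennreal J" .
    show "0 \<le> indicator {s<..t} r * \<phi> r" "0 \<le> indicator {0..T} r * G r" for r by (auto simp: \<phi>_def G_def)
  qed (use beta1 J in auto)
  also have "(B powr q' * ((t - s) powr (1 - d * q') / (1 - d * q'))) powr (1 / q') * J powr (1 / q)
    = krylov_const T p q * J powr (1 / q) * (t - s) powr (1 / gamma0 CARD('d) p q)"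
  proof -
    have e1: "(t - s) powr (1 - d * q') / (1 - d * q') = (\<gamma> * (1 - 1 / q)) * (t - s) powr (q' / \<gamma>)"
      unfolding beta q'inv(1)[symmetric] by simp
    have "(B powr q' * ((t - s) powr (1 - d * q') / (1 - d * q'))) powr (1 / q')
      = B * ((\<gamma> * (1 - 1 / q)) * (t - s) powr (q' / \<gamma>)) powr (1 / q')"
      unfolding e1 powr_mult[of "B powr q'"] using B0 qq by (simp add: powr_powr)
    also have "((\<gamma> * (1 - 1 / q)) * (t - s) powr (q' / \<gamma>)) powr (1 / q')
      = (\<gamma> * (1 - 1 / q)) powr (1 / q') * (t - s) powr (1 / \<gamma>)"
      using \<gamma> qq s by (simp add: powr_mult[of _ "(t - s) powr (q' / \<gamma>)"] powr_powr)
    finally have e: "(B powr q' * ((t - s) powr (1 - d * q') / (1 - d * q'))) powr (1 / q')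
      = B * ((\<gamma> * (1 - 1 / q)) powr (1 / q') * (t - s) powr (1 / \<gamma>))" .
    show ?thesis unfolding e by (simp add: krylov_const_def B_def d_def \<gamma>_def q'inv(2))
  qed
  finally show ?thesis by (simp add: e)
qed

end

section \<open>Khasminskii's lemma\<close>

text \<open>The interval is open on the left, so that adjacent intervals concatenate without
  overlap; the value is real, so that differences of tails can be formed.\<close>

definition tail_integral :: "real \<Rightarrow> (real \<Rightarrow> real) \<Rightarrow> real \<Rightarrow> real" where
  "tail_integral T H s = (LINT q|lborel. indicator {s<..T} q * H q)"

context
  fixes H :: "real \<Rightarrow> real" and K T :: real
  assumes H [measurable]: "H \<in> borel_measurable borel" and H0: "\<And>q. 0 \<le> H q" and HK: "\<And>q. H q \<le> K"
begin

lemma K_nonneg: "0 \<le> K" using H0[of 0] HK[of 0] by simp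

lemma indicator_mult_integrable: "integrable lborel (\<lambda>q. indicator {a<..c} q * H q)"
proof (rule Bochner_Integration.integrable_bound)
  show "integrable lborel (\<lambda>q. indicator {a<..c} q * K :: real)"
    by (intro integrable_mult_left integrable_real_indicator emeasure_bounded_finite) auto
qed (use H0 HK K_nonneg in \<open>auto simp: indicator_def\<close>)

lemma tail_integral_split:
  assumes "a \<le> c" "c \<le> T"
  shows "tail_integral T H a = (LINT q|lborel. indicator {a<..c} q * H q) + tail_integral T H c"
proof -
  have "indicator {a<..T} q * H q = indicator {a<..c} q * H q + indicator {c<..T} q * H q" for q
    using assms by (auto simp: indicator_def)
  then show ?thesis unfolding tail_integral_def
    by (simp only: Bochner_Integration.integral_add[OF indicator_mult_integrable indicator_mult_integrable])
qed

lemma interval_integral_le: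
  assumes "a \<le> c" shows "(LINT q|lborel. indicator {a<..c} q * H q) \<le> K * (c - a)"
proof -
  have "(LINT q|lborel. indicator {a<..c} q * H q) \<le> (LINT q|lborel. indicator {a<..c} q * K)"
    by (intro integral_mono indicator_mult_integrable integrable_mult_left
        integrable_real_indicator emeasure_bounded_finite) (auto simp: indicator_def HK)
  then show ?thesis using assms by (simp add: mult.commute)
qed

lemma tail_integral_antimono:
  assumes "a \<le> c" "c \<le> T" shows "tail_integral T H c \<le> tail_integral T H a"
  unfolding tail_integral_split[OF assms] by (auto intro!: integral_nonneg simp: H0)

lemma tail_integral_measurable: "tail_integral T H \<in> borel_measurable borel"
proof -
  have "(\<lambda>(s, q). if s < q \<and> q \<le> T then H q else 0) \<in> borel_measurable (borel \<Otimes>\<^sub>M borel)" by measurable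
  also have "(\<lambda>(s, q). if s < q \<and> q \<le> T then H q else 0) = (\<lambda>(s, q). indicator {s<..T} q * H q)"
    by (auto simp: indicator_def)
  finally have "(\<lambda>(s, q). indicator {s<..T} q * H q) \<in> borel_measurable (borel \<Otimes>\<^sub>M lborel)"
    by (simp cong: measurable_cong_sets)
  from lborel.borel_measurable_lebesgue_integral[OF this] show ?thesis
    by (simp add: tail_integral_def[abs_def])
qed

text \<open>Convexity of \<open>exp\<close> gives the increment with the integrand frozen at
  \<open>a\<close>. Moving the exponential from \<open>a\<close> to \<open>r\<close> inside the
  integral costs at most \<open>exp (K * \<Delta>)\<close>, which tends to 1 under
  refinement.\<close>

lemma exp_tail_integral_step:
  assumes ac: "a \<le> c" "c \<le> T" "c - a \<le> \<Delta>"
  shows "ennreal (exp (tail_integral T H a)) \<le> ennreal (exp (tail_integral T H c))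
    + ennreal (exp (K * \<Delta>)) * (\<integral>\<^sup>+r. indicator {a<..c} r * ennreal (H r * exp (tail_integral T H r)) \<partial>lborel)"
proof -
  note [measurable] = tail_integral_measurable
  let ?u = "tail_integral T H" and ?I = "LINT q|lborel. indicator {a<..c} q * H q"
  have I0: "0 \<le> ?I" by (auto intro!: integral_nonneg simp: H0)
  have "?u a - ?u c = ?I" using tail_integral_split[OF ac(1,2)] by simp
  moreover have "exp (?u a) * (1 + (?u c - ?u a)) \<le> exp (?u a) * exp (?u c - ?u a)"
    by (intro mult_left_mono exp_ge_add_one_self) simp
  moreover have "exp (?u a) * exp (?u c - ?u a) = exp (?u c)" by (simp add: mult_exp_exp)
  ultimately have "exp (?u a) \<le> exp (?u c) + ?I * exp (?u a)"
    by (simp add: algebra_simps)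
  then have "ennreal (exp (?u a)) \<le> ennreal (exp (?u c)) + ennreal (?I * exp (?u a))"
    using I0 by (simp add: ennreal_plus[symmetric] ennreal_leI del: ennreal_plus)
  also have "ennreal (?I * exp (?u a)) = (\<integral>\<^sup>+r. ennreal (indicator {a<..c} r * H r) \<partial>lborel) * ennreal (exp (?u a))"
    using I0 by (subst nn_integral_eq_integral[OF indicator_mult_integrable]) (auto simp: H0 ennreal_mult)
  also have "\<dots> = (\<integral>\<^sup>+r. ennreal (indicator {a<..c} r * H r) * ennreal (exp (?u a)) \<partial>lborel)"
    by (rule nn_integral_multc[symmetric]) measurable
  also have "\<dots> \<le> (\<integral>\<^sup>+r. ennreal (exp (K * \<Delta>)) * (indicator {a<..c} r * ennreal (H r * exp (?u r))) \<partial>lborel)"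
  proof (rule nn_integral_mono)
    fix r
    show "ennreal (indicator {a<..c} r * H r) * ennreal (exp (?u a))
      \<le> ennreal (exp (K * \<Delta>)) * (indicator {a<..c} r * ennreal (H r * exp (?u r)))"
    proof (cases "r \<in> {a<..c}")
      case True
      have "?u a \<le> K * (r - a) + ?u r"
        using tail_integral_split[of a r] interval_integral_le[of a r] True ac by simp
      also have "K * (r - a) \<le> K * \<Delta>" using True ac K_nonneg by (intro mult_left_mono) auto
      finally have "exp (?u a) \<le> exp (K * \<Delta>) * exp (?u r)" by (simp add: mult_exp_exp)
      then have "H r * exp (?u a) \<le> exp (K * \<Delta>) * (H r * exp (?u r))"
        using mult_left_mono[of "exp (?u a)" _ "H r"] H0[of r] by (simp add: mult.left_commute)
      then show ?thesis using True H0[of r] by (simp add: ennreal_mult[symmetric] ennreal_leI)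
    qed simp
  qed
  also have "\<dots> = ennreal (exp (K * \<Delta>)) * (\<integral>\<^sup>+r. indicator {a<..c} r * ennreal (H r * exp (?u r)) \<partial>lborel)"
    by (rule nn_integral_cmult) measurable
  finally show ?thesis by (simp add: add_left_mono)
qed

text \<open>The fundamental theorem of calculus for \<open>exp (tail_integral T H)\<close>, by subdivision,
  since \<open>H\<close> is only measurable.\<close>

lemma exp_tail_integral_le:
  assumes ac: "a \<le> c" "c \<le> T"
  shows "ennreal (exp (tail_integral T H a)) \<le> ennreal (exp (tail_integral T H c))
    + (\<integral>\<^sup>+r. indicator {a<..c} r * ennreal (H r * exp (tail_integral T H r)) \<partial>lborel)"
proof -
  note [measurable] = tail_integral_measurable
  let ?u = "tail_integral T H"
  define I where "I c = (\<integral>\<^sup>+r. indicator {a<..c} r * ennreal (H r * exp (?u r)) \<partial>lborel)" for c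
  have fin: "I c < \<infinity>"
  proof -
    have "I c \<le> (\<integral>\<^sup>+r. ennreal (K * exp (?u a)) * indicator {a<..c} r \<partial>lborel)" unfolding I_def
      using tail_integral_antimono[of a] ac K_nonneg
      by (intro nn_integral_mono) (auto simp: indicator_def intro!: ennreal_leI mult_mono HK H0)
    also have "\<dots> < \<infinity>" using ac by (simp add: nn_integral_cmult ennreal_mult_less_top)
    finally show ?thesis .
  qed
  have step: "ennreal (exp (?u a)) \<le> ennreal (exp (?u c)) + ennreal (exp (K * ((c - a) / real (Suc n)))) * I c" for n
  proof -
    define \<Delta> where "\<Delta> = (c - a) / real (Suc n)"
    have \<Delta>: "0 \<le> \<Delta>" "real (Suc n) * \<Delta> = c - a" using ac by (simp_all add: \<Delta>_def)
    have split: "I y = I x + (\<integral>\<^sup>+r. indicator {x<..y} r * ennreal (H r * exp (?u r)) \<partial>lborel)"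
      if "a \<le> x" "x \<le> y" for x y
      unfolding I_def
      by (subst nn_integral_add[symmetric]) (use that in \<open>auto simp: indicator_def intro!: nn_integral_cong\<close>)
    have "ennreal (exp (?u a)) \<le> ennreal (exp (?u (a + real i * \<Delta>))) + ennreal (exp (K * \<Delta>)) * I (a + real i * \<Delta>)"
      if "i \<le> Suc n" for i using that
    proof (induction i)
      case (Suc i)
      let ?x = "a + real i * \<Delta>" and ?y = "a + real (Suc i) * \<Delta>"
      have xy: "a \<le> ?x" "?x \<le> ?y" "?y - ?x \<le> \<Delta>" using \<Delta> by (auto simp: algebra_simps)
      have "real (Suc i) * \<Delta> \<le> real (Suc n) * \<Delta>" using Suc.prems \<Delta> by (intro mult_right_mono) auto
      then have yT: "?y \<le> T" using \<Delta> ac by linarith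
      have "ennreal (exp (?u a)) \<le> ennreal (exp (?u ?x)) + ennreal (exp (K * \<Delta>)) * I ?x"
        using Suc by simp
      also have "\<dots> \<le> (ennreal (exp (?u ?y)) + ennreal (exp (K * \<Delta>))
          * (\<integral>\<^sup>+r. indicator {?x<..?y} r * ennreal (H r * exp (?u r)) \<partial>lborel)) + ennreal (exp (K * \<Delta>)) * I ?x"
        by (rule add_right_mono[OF exp_tail_integral_step[OF xy(2) yT xy(3)]])
      also have "\<dots> = ennreal (exp (?u ?y)) + ennreal (exp (K * \<Delta>)) * I ?y"
        unfolding split[OF xy(1,2)] by (simp only: distrib_left add_ac)
      finally show ?case .
    qed (simp add: I_def)
    from this[of "Suc n"] \<Delta> show ?thesis unfolding \<Delta>_def[symmetric] by simp
  qed
  obtain i where i: "0 \<le> i" "I c = ennreal i" using fin by (cases "I c" rule: ennreal_cases) auto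
  have "(\<lambda>n. (c - a) / real (Suc n)) \<longlonglongrightarrow> 0" by (rule LIMSEQ_Suc[OF lim_const_over_n])
  then have "(\<lambda>n. exp (?u c) + exp (K * ((c - a) / real (Suc n))) * i) \<longlonglongrightarrow> exp (?u c) + exp (K * 0) * i"
    by (intro tendsto_intros)
  then have lim: "(\<lambda>n. ennreal (exp (?u c) + exp (K * ((c - a) / real (Suc n))) * i)) \<longlonglongrightarrow> ennreal (exp (?u c) + i)"
    by (intro tendsto_ennrealI) simp
  have "ennreal (exp (?u a)) \<le> ennreal (exp (?u c) + exp (K * ((c - a) / real (Suc n))) * i)" for n
    using step[of n] i by (simp add: ennreal_mult)
  then have "ennreal (exp (?u a)) \<le> ennreal (exp (?u c) + i)" by (intro LIMSEQ_le_const[OF lim] exI allI impI)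
  then show ?thesis using i by (simp add: I_def[symmetric])
qed

end

text \<open>Below, \<open>C s c\<close> states that the conditional expectation of \<open>exp (u s)\<close> given \<open>F s\<close>
  is at most \<open>c\<close>. Any bound \<open>c\<close> on an interval of length \<open>L\<close> improves to \<open>x + c / 2\<close>, where \<open>x\<close>
  bounds the value at the right end; iterating gives the bound \<open>2 * x\<close>.\<close>

theorem khasminskii:
  fixes H H' :: "real \<Rightarrow> 'w \<Rightarrow> real"
  assumes filt: "filtered_prob_space M F"
    and H [measurable]: "(\<lambda>(r, \<omega>). H r \<omega>) \<in> borel_measurable (borel \<Otimes>\<^sub>M M)"
    and H0: "\<And>r \<omega>. 0 \<le> H r \<omega>" and HK: "\<And>r \<omega>. H r \<omega> \<le> K"
    and H': "\<And>r. 0 \<le> r \<Longrightarrow> H' r \<in> borel_measurable (F r)"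
    and HH': "\<And>r. 0 \<le> r \<Longrightarrow> AE \<omega> in M. H r \<omega> = H' r \<omega>"
    and LT: "0 < L" "0 \<le> T"
    and small: "\<And>s t Y. 0 \<le> s \<Longrightarrow> s < t \<Longrightarrow> t \<le> T \<Longrightarrow> t - s \<le> L \<Longrightarrow> Y \<in> borel_measurable (F s)
      \<Longrightarrow> integral\<^sup>N M Y < \<infinity> \<Longrightarrow>
      (\<integral>\<^sup>+r\<in>{s..t}. (\<integral>\<^sup>+\<omega>. Y \<omega> * ennreal (H' r \<omega>) \<partial>M) \<partial>lborel) \<le> ennreal (1 / 2) * integral\<^sup>N M Y"
  shows "(\<integral>\<^sup>+\<omega>. ennreal (exp (tail_integral T (\<lambda>q. H q \<omega>) 0)) \<partial>M) \<le> ennreal (2 powr (1 + T / L))"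
proof -
  interpret prob_space M using filt by (simp add: filtered_prob_space_def)
  interpret pair: pair_sigma_finite lborel M by unfold_locales
  have K0: "0 \<le> K" using H0[of 0 undefined] HK[of 0 undefined] by simp
  have FM: "Y \<in> borel_measurable M" if "Y \<in> borel_measurable (F s)" "0 \<le> s" for Y :: "'w \<Rightarrow> ennreal" and s
    using filt that by (auto simp: filtered_prob_space_def intro: measurable_from_subalg)
  have Fmono: "Y \<in> borel_measurable (F t)" if "Y \<in> borel_measurable (F s)" "0 \<le> s" "s \<le> t" for Y :: "'w \<Rightarrow> ennreal" and s t
    using filt that by (auto simp: filtered_prob_space_def intro: measurable_from_subalg)
  define u where "u s \<omega> = tail_integral T (\<lambda>q. H q \<omega>) s" for s \<omega>
  have u [measurable]: "(\<lambda>(s, \<omega>). u s \<omega>) \<in> borel_measurable (borel \<Otimes>\<^sub>M M)"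
  proof -
    have [measurable]: "(\<lambda>p. H (snd p) (snd (fst p))) \<in> borel_measurable ((borel \<Otimes>\<^sub>M M) \<Otimes>\<^sub>M borel)"
      using measurable_compose[OF _ H, of "\<lambda>p. (snd p, snd (fst p))"] by simp
    have "(\<lambda>p. if fst (fst p) < snd p \<and> snd p \<le> T then H (snd p) (snd (fst p)) else 0)
        \<in> borel_measurable ((borel \<Otimes>\<^sub>M M) \<Otimes>\<^sub>M borel)" by measurable
    also have "(\<lambda>p. if fst (fst p) < snd p \<and> snd p \<le> T then H (snd p) (snd (fst p)) else 0)
        = (\<lambda>(p, q). indicator {fst p<..T} q * H q (snd p))" by (auto simp: indicator_def)
    finally have "(\<lambda>(p, q). indicator {fst p<..T} q * H q (snd p)) \<in> borel_measurable ((borel \<Otimes>\<^sub>M M) \<Otimes>\<^sub>M lborel)"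
      by (simp cong: measurable_cong_sets)
    from lborel.borel_measurable_lebesgue_integral[OF this]
    show ?thesis by (simp add: u_def tail_integral_def split_beta')
  qed
  have Hm: "(\<lambda>q. H q \<omega>) \<in> borel_measurable borel" if "\<omega> \<in> space M" for \<omega>
    using measurable_compose[OF measurable_Pair2'[OF that] H] by simp
  have um [measurable]: "u s \<in> borel_measurable M" for s
    using measurable_compose[OF measurable_Pair1'[of s borel M] u] by simp
  define C where "C s c \<longleftrightarrow> (\<forall>Y. Y \<in> borel_measurable (F s) \<longrightarrow> integral\<^sup>N M Y < \<infinity> \<longrightarrow>
     (\<integral>\<^sup>+\<omega>. Y \<omega> * ennreal (exp (u s \<omega>)) \<partial>M) \<le> ennreal c * integral\<^sup>N M Y)" for s c
  have C_mono: "C s c'" if "C s c" "c \<le> c'" for s c c'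
    unfolding C_def
  proof (intro allI impI)
    fix Y :: "'w \<Rightarrow> ennreal" assume "Y \<in> borel_measurable (F s)" "integral\<^sup>N M Y < \<infinity>"
    then have "(\<integral>\<^sup>+\<omega>. Y \<omega> * ennreal (exp (u s \<omega>)) \<partial>M) \<le> ennreal c * integral\<^sup>N M Y"
      using that(1) unfolding C_def by blast
    also have "\<dots> \<le> ennreal c' * integral\<^sup>N M Y"
      by (intro mult_right_mono ennreal_leI that(2)) simp
    finally show "(\<integral>\<^sup>+\<omega>. Y \<omega> * ennreal (exp (u s \<omega>)) \<partial>M) \<le> ennreal c' * integral\<^sup>N M Y" .
  qed
  \<comment> \<open>A finite starting value for the iteration, available only because
    \<open>H\<close> is bounded. Its contribution is halved in each round, so \<open>K\<close>
    disappears from the final bound.\<close>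
  have C_crude: "C s (exp (K * T))" if s: "0 \<le> s" "s \<le> T" for s
    unfolding C_def
  proof (intro allI impI)
    fix Y :: "'w \<Rightarrow> ennreal" assume Y: "Y \<in> borel_measurable (F s)"
    have [measurable]: "Y \<in> borel_measurable M" by (rule FM[OF Y s(1)])
    have "(\<integral>\<^sup>+\<omega>. Y \<omega> * ennreal (exp (u s \<omega>)) \<partial>M) \<le> (\<integral>\<^sup>+\<omega>. Y \<omega> * ennreal (exp (K * T)) \<partial>M)"
    proof (intro nn_integral_mono mult_left_mono ennreal_leI)
      fix \<omega> assume \<omega>: "\<omega> \<in> space M"
      have "u s \<omega> \<le> K * (T - s)" unfolding u_def tail_integral_def
        by (rule interval_integral_le[OF Hm[OF \<omega>] H0 HK s(2)])
      also have "\<dots> \<le> K * T" using K0 s by (intro mult_left_mono) auto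
      finally show "exp (u s \<omega>) \<le> exp (K * T)" by simp
    qed simp
    then show "(\<integral>\<^sup>+\<omega>. Y \<omega> * ennreal (exp (u s \<omega>)) \<partial>M) \<le> ennreal (exp (K * T)) * integral\<^sup>N M Y"
      by (simp add: nn_integral_multc mult.commute)
  qed
  have improve: "C s (x + c / 2)"
    if s: "0 \<le> s" "s \<le> t" "t \<le> T" "t - s \<le> L" and x: "0 \<le> x" "C t x"
      and c: "0 \<le> c" "\<And>r. s \<le> r \<Longrightarrow> r \<le> t \<Longrightarrow> C r c" for s t x c
    unfolding C_def
  proof (intro allI impI)
    fix Y :: "'w \<Rightarrow> ennreal" assume Y: "Y \<in> borel_measurable (F s)" "integral\<^sup>N M Y < \<infinity>"
    have [measurable]: "Y \<in> borel_measurable M" by (rule FM[OF Y(1) s(1)])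
    have "(\<integral>\<^sup>+\<omega>. Y \<omega> * ennreal (exp (u s \<omega>)) \<partial>M)
      \<le> (\<integral>\<^sup>+\<omega>. Y \<omega> * (ennreal (exp (u t \<omega>)) + (\<integral>\<^sup>+r. indicator {s<..t} r * ennreal (H r \<omega> * exp (u r \<omega>)) \<partial>lborel)) \<partial>M)"
      unfolding u_def
      by (intro nn_integral_mono mult_left_mono exp_tail_integral_le[OF Hm H0 HK s(2,3)]) auto
    also have "\<dots> = (\<integral>\<^sup>+\<omega>. Y \<omega> * ennreal (exp (u t \<omega>)) \<partial>M)
      + (\<integral>\<^sup>+\<omega>. (\<integral>\<^sup>+r. Y \<omega> * (indicator {s<..t} r * ennreal (H r \<omega> * exp (u r \<omega>))) \<partial>lborel) \<partial>M)"
      by (subst nn_integral_add[symmetric]) (auto simp: distrib_left nn_integral_cmult intro!: nn_integral_cong)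
    also have "(\<integral>\<^sup>+\<omega>. (\<integral>\<^sup>+r. Y \<omega> * (indicator {s<..t} r * ennreal (H r \<omega> * exp (u r \<omega>))) \<partial>lborel) \<partial>M)
      = (\<integral>\<^sup>+r. (\<integral>\<^sup>+\<omega>. Y \<omega> * (indicator {s<..t} r * ennreal (H r \<omega> * exp (u r \<omega>))) \<partial>M) \<partial>lborel)"
      by (rule pair.Fubini') measurable
    also have "\<dots> \<le> (\<integral>\<^sup>+r. ennreal c * ((\<integral>\<^sup>+\<omega>. Y \<omega> * ennreal (H' r \<omega>) \<partial>M) * indicator {s..t} r) \<partial>lborel)"
    proof (rule nn_integral_mono)
      fix r
      show "(\<integral>\<^sup>+\<omega>. Y \<omega> * (indicator {s<..t} r * ennreal (H r \<omega> * exp (u r \<omega>))) \<partial>M)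
        \<le> ennreal c * ((\<integral>\<^sup>+\<omega>. Y \<omega> * ennreal (H' r \<omega>) \<partial>M) * indicator {s..t} r)"
      proof (cases "r \<in> {s<..t}")
        case True
        then have r: "0 \<le> r" "s \<le> r" "r \<le> t" "r \<in> {s..t}" using s by auto
        \<comment> \<open>The product of \<open>Y\<close> with the value at time \<open>r\<close> is
          again a weight, now measurable for \<open>F r\<close>, so \<open>C r c\<close> applies to
          it: this is the tower property. It needs the adapted version \<open>H'\<close>, while
          Fubini's theorem used the jointly measurable \<open>H\<close>.\<close>
        let ?Y = "\<lambda>\<omega>. Y \<omega> * ennreal (H' r \<omega>)"
        have Y': "?Y \<in> borel_measurable (F r)" using Fmono[OF Y(1) s(1) r(2)] H'[OF r(1)] by measurable
        have [measurable]: "?Y \<in> borel_measurable M" by (rule FM[OF Y' r(1)])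
        have "(\<integral>\<^sup>+\<omega>. ?Y \<omega> \<partial>M) \<le> (\<integral>\<^sup>+\<omega>. ennreal K * Y \<omega> \<partial>M)"
        proof (rule nn_integral_mono_AE)
          show "AE \<omega> in M. ?Y \<omega> \<le> ennreal K * Y \<omega>"
            using HH'[OF r(1)]
          proof eventually_elim
            case (elim \<omega>)
            then have "ennreal (H' r \<omega>) \<le> ennreal K" using HK[of r \<omega>] by (intro ennreal_leI) simp
            then show ?case unfolding mult.commute[of "ennreal K"] by (intro mult_left_mono) auto
          qed
        qed
        also have "\<dots> < \<infinity>" using Y by (simp add: nn_integral_cmult ennreal_mult_less_top)
        finally have fin: "(\<integral>\<^sup>+\<omega>. ?Y \<omega> \<partial>M) < \<infinity>" .
        have "(\<integral>\<^sup>+\<omega>. Y \<omega> * (indicator {s<..t} r * ennreal (H r \<omega> * exp (u r \<omega>))) \<partial>M)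
          = (\<integral>\<^sup>+\<omega>. ?Y \<omega> * ennreal (exp (u r \<omega>)) \<partial>M)"
        proof (rule nn_integral_cong_AE)
          show "AE \<omega> in M. Y \<omega> * (indicator {s<..t} r * ennreal (H r \<omega> * exp (u r \<omega>))) = ?Y \<omega> * ennreal (exp (u r \<omega>))"
            using HH'[OF r(1)]
          proof eventually_elim
            case (elim \<omega>)
            then show ?case using True H0[of r \<omega>] by (simp add: ennreal_mult mult.assoc)
          qed
        qed
        also have "\<dots> \<le> ennreal c * (\<integral>\<^sup>+\<omega>. ?Y \<omega> \<partial>M)"
          using c(2)[OF r(2,3)] Y' fin by (simp add: C_def)
        finally show ?thesis using r by simp
      qed simp
    qed
    also have "\<dots> \<le> ennreal c * (ennreal (1 / 2) * integral\<^sup>N M Y)"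
    proof -
      have QQ: "(\<integral>\<^sup>+\<omega>. Y \<omega> * ennreal (H' r \<omega>) \<partial>M) * indicator {s..t} r
        = (\<integral>\<^sup>+\<omega>. Y \<omega> * ennreal (H r \<omega>) \<partial>M) * indicator {s..t} r" for r
      proof (cases "r \<in> {s..t}")
        case True
        then have "AE \<omega> in M. H r \<omega> = H' r \<omega>" using s by (intro HH') auto
        then have "(\<integral>\<^sup>+\<omega>. Y \<omega> * ennreal (H' r \<omega>) \<partial>M) = (\<integral>\<^sup>+\<omega>. Y \<omega> * ennreal (H r \<omega>) \<partial>M)"
          by (intro nn_integral_cong_AE) (auto elim!: eventually_mono)
        then show ?thesis by simp
      qed simp
      have "(\<integral>\<^sup>+r. ennreal c * ((\<integral>\<^sup>+\<omega>. Y \<omega> * ennreal (H' r \<omega>) \<partial>M) * indicator {s..t} r) \<partial>lborel)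
        = ennreal c * (\<integral>\<^sup>+r\<in>{s..t}. (\<integral>\<^sup>+\<omega>. Y \<omega> * ennreal (H r \<omega>) \<partial>M) \<partial>lborel)"
        unfolding QQ by (rule nn_integral_cmult) measurable
      also have "\<dots> \<le> ennreal c * (ennreal (1 / 2) * integral\<^sup>N M Y)"
      proof (cases "s = t")
        case True
        have "(\<integral>\<^sup>+r\<in>{s..t}. (\<integral>\<^sup>+\<omega>. Y \<omega> * ennreal (H r \<omega>) \<partial>M) \<partial>lborel) = 0"
          by (rule nn_integral_null_set) (simp add: True null_sets_def)
        then show ?thesis by simp
      next
        case False
        then show ?thesis unfolding QQ[symmetric]
          by (intro mult_left_mono small) (use s Y in auto)
      qed
      finally show ?thesis .
    qed
    also have "(\<integral>\<^sup>+\<omega>. Y \<omega> * ennreal (exp (u t \<omega>)) \<partial>M) + ennreal c * (ennreal (1 / 2) * integral\<^sup>N M Y)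
      \<le> ennreal x * integral\<^sup>N M Y + ennreal c * (ennreal (1 / 2) * integral\<^sup>N M Y)"
      using x(2) Fmono[OF Y(1) s(1,2)] Y(2) by (intro add_right_mono) (simp add: C_def)
    also have "\<dots> = (ennreal x + ennreal c * ennreal (1 / 2)) * integral\<^sup>N M Y"
      by (simp only: distrib_right mult.assoc)
    also have "ennreal x + ennreal c * ennreal (1 / 2) = ennreal (x + c / 2)"
    proof -
      have "ennreal c * ennreal (1 / 2) = ennreal (c * (1 / 2))" using c by (intro ennreal_mult[symmetric]) auto
      then show ?thesis using x c by simp
    qed
    finally show "(\<integral>\<^sup>+\<omega>. Y \<omega> * ennreal (exp (u s \<omega>)) \<partial>M) \<le> ennreal (x + c / 2) * integral\<^sup>N M Y"
      by (simp add: add_left_mono)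
  qed
  have main: "C s (2 ^ j)" if "0 \<le> s" "s \<le> T" "T - real j * L \<le> s" for j s
    using that
  proof (induction j arbitrary: s)
    case 0
    then have "s = T" by simp
    then have "u s \<omega> = 0" for \<omega> by (simp add: u_def tail_integral_def)
    then show ?case by (simp add: C_def)
  next
    case (Suc j)
    \<comment> \<open>The map \<open>c \<mapsto> 2 ^ j + c / 2\<close> has the fixed point
      \<open>2 ^ Suc j\<close>, and each application halves the distance to it.\<close>
    have iter: "C s (2 ^ Suc j + exp (K * T) / 2 ^ n)" if "0 \<le> s" "s \<le> T" "T - real (Suc j) * L \<le> s" for n s
      using that
    proof (induction n arbitrary: s)
      case 0
      have "C s (exp (K * T))" using C_crude 0 by auto
      then have "C s (2 ^ Suc j + exp (K * T))" by (rule C_mono) simp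
      then show ?case by simp
    next
      case (Suc n)
      \<comment> \<open>The right end of the interval lies in the range of the outer induction,
        which supplies \<open>2 ^ j\<close> there; intermediate times are served by the inner
        induction.\<close>
      define t where "t = min T (s + L)"
      have t: "s \<le> t" "t \<le> T" "t - s \<le> L" "0 \<le> t"
        using Suc.prems(1,2) LT by (auto simp: t_def)
      have "real (Suc j) * L = real j * L + L" by (simp add: distrib_right)
      moreover have "0 \<le> real j * L" using LT by simp
      ultimately have tj: "T - real j * L \<le> t" using Suc.prems(3) unfolding t_def by (simp add: min_def)
      have "C s (2 ^ j + (2 ^ Suc j + exp (K * T) / 2 ^ n) / 2)"
      proof (rule improve[OF Suc.prems(1) t(1-3) _ \<open>\<And>s. \<lbrakk>0 \<le> s; s \<le> T; T - real j * L \<le> s\<rbrakk> \<Longrightarrow> C s (2 ^ j)\<close>[OF t(4,2) tj]])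
        fix r assume "s \<le> r" "r \<le> t"
        then show "C r (2 ^ Suc j + exp (K * T) / 2 ^ n)" using Suc t by (intro Suc.IH) auto
      qed auto
      then show ?case by (simp add: add_divide_distrib mult.commute)
    qed
    show ?case unfolding C_def
    proof (intro allI impI)
      fix Y :: "'w \<Rightarrow> ennreal" assume Y: "Y \<in> borel_measurable (F s)" "integral\<^sup>N M Y < \<infinity>"
      obtain e where e: "0 \<le> e" "integral\<^sup>N M Y = ennreal e"
        using Y(2) by (cases "integral\<^sup>N M Y" rule: ennreal_cases) auto
      have "(\<lambda>n. (1 / 2 :: real) ^ n) \<longlonglongrightarrow> 0" by (rule LIMSEQ_power_zero) simp
      then have "(\<lambda>n. (2 ^ Suc j + exp (K * T) * (1 / 2) ^ n) * e) \<longlonglongrightarrow> (2 ^ Suc j + exp (K * T) * 0) * e"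
        by (intro tendsto_mult tendsto_add tendsto_const)
      then have lim: "(\<lambda>n. ennreal ((2 ^ Suc j + exp (K * T) / 2 ^ n) * e)) \<longlonglongrightarrow> ennreal (2 ^ Suc j * e)"
        by (intro tendsto_ennrealI) (simp only: power_one_over times_divide_eq_right mult_1_right mult_zero_right add_0_right)
      have "(\<integral>\<^sup>+\<omega>. Y \<omega> * ennreal (exp (u s \<omega>)) \<partial>M) \<le> ennreal ((2 ^ Suc j + exp (K * T) / 2 ^ n) * e)" for n
      proof -
        have "(\<integral>\<^sup>+\<omega>. Y \<omega> * ennreal (exp (u s \<omega>)) \<partial>M) \<le> ennreal (2 ^ Suc j + exp (K * T) / 2 ^ n) * ennreal e"
          using iter[OF Suc.prems, of n] Y unfolding C_def e(2)[symmetric] by blast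
        also have "\<dots> = ennreal ((2 ^ Suc j + exp (K * T) / 2 ^ n) * e)"
          using e by (intro ennreal_mult[symmetric]) auto
        finally show ?thesis .
      qed
      then have "(\<integral>\<^sup>+\<omega>. Y \<omega> * ennreal (exp (u s \<omega>)) \<partial>M) \<le> ennreal (2 ^ Suc j * e)"
        by (intro LIMSEQ_le_const[OF lim] exI allI impI)
      also have "\<dots> = ennreal (2 ^ Suc j) * ennreal e" using e by (intro ennreal_mult) auto
      finally show "(\<integral>\<^sup>+\<omega>. Y \<omega> * ennreal (exp (u s \<omega>)) \<partial>M) \<le> ennreal (2 ^ Suc j) * integral\<^sup>N M Y"
        by (simp only: e(2))
    qed
  qed
  \<comment> \<open>Rounding \<open>T / L\<close> up to an integer is the origin of the summand 1 in
    the exponent.\<close>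
  define j where "j = nat \<lceil>T / L\<rceil>"
  have "0 \<le> T / L" using LT by simp
  then have j: "T / L \<le> real j" "real j \<le> 1 + T / L" unfolding j_def by linarith+
  have "T - real j * L \<le> 0" using j(1) LT by (simp add: field_simps)
  then have "C 0 (2 ^ j)" using main[of 0 j] LT by simp
  then have "(\<integral>\<^sup>+\<omega>. 1 * ennreal (exp (u 0 \<omega>)) \<partial>M) \<le> ennreal (2 ^ j) * (\<integral>\<^sup>+\<omega>. 1 \<partial>M)"
    unfolding C_def by (elim allE[of _ "\<lambda>_. 1"] impE) (auto simp: emeasure_space_1)
  then have "(\<integral>\<^sup>+\<omega>. ennreal (exp (u 0 \<omega>)) \<partial>M) \<le> ennreal (2 ^ j)" by (simp add: emeasure_space_1)
  also have "(2::real) ^ j = 2 powr real j" by (simp add: powr_realpow)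
  also have "ennreal (2 powr real j) \<le> ennreal (2 powr (1 + T / L))" using j by (intro ennreal_leI powr_mono) auto
  finally show ?thesis unfolding u_def .
qed

section \<open>Comparison of the constants\<close>

lemma Gamma_half_ge: "Gamma (3 / 2 :: real) * fact k \<le> Gamma (real k + 3 / 2)"
proof (induction k)
  case (Suc k)
  have G: "0 < Gamma (3 / 2 :: real)" by (rule Gamma_real_pos) simp
  have "Gamma (3 / 2 :: real) * fact (Suc k) = (real k + 1) * (Gamma (3 / 2) * fact k)" by (simp add: algebra_simps)
  also have "\<dots> \<le> (real k + 3 / 2) * Gamma (real k + 3 / 2)" using Suc G by (intro mult_mono) auto
  also have "\<dots> = Gamma (real k + 3 / 2 + 1)" by (subst Gamma_plus1) auto
  finally show ?case by (simp add: add_ac)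
qed simp

text \<open>The right-hand side is the Mittag-Leffler function of order \<open>1 / 2\<close>, and
  its even terms already sum to \<open>exp (z\<^sup>2)\<close>. The odd terms are estimated only for
  summability, without which the infinite sum would carry no information.\<close>

lemma Mittag_Leffler_half:
  assumes z: "0 \<le> z"
  shows "exp (z\<^sup>2) \<le> (\<Sum>i. z ^ i / Gamma (1 + real i / 2))"
proof -
  define a where "a i = z ^ i / Gamma (1 + real i / 2)" for i
  have a0: "0 \<le> a i" for i unfolding a_def using z by (intro divide_nonneg_pos Gamma_real_pos) auto
  have G: "0 < Gamma (3 / 2 :: real)" by (rule Gamma_real_pos) simp
  have even: "a (2 * k) = (z\<^sup>2) ^ k / fact k" for k
    using Gamma_fact[of k, where 'a=real] by (simp add: a_def power_mult)
  have odd: "a (2 * k + 1) \<le> z / Gamma (3 / 2) * ((z\<^sup>2) ^ k / fact k)" for k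
  proof -
    have "1 + real (2 * k + 1) / 2 = real k + 3 / 2" by (simp add: field_simps)
    then have "a (2 * k + 1) = z * (z\<^sup>2) ^ k / Gamma (real k + 3 / 2)" by (simp add: a_def power_mult)
    also have "\<dots> \<le> z * (z\<^sup>2) ^ k / (Gamma (3 / 2) * fact k)"
      using z G Gamma_half_ge[of k] by (intro divide_left_mono) (auto intro!: mult_pos_pos Gamma_real_pos)
    finally show ?thesis by simp
  qed
  have pair: "(\<Sum>i<2 * n. a i) = (\<Sum>k<n. a (2 * k) + a (2 * k + 1))" for n
    by (induction n) (auto simp: numeral_2_eq_2)
  have exp_sums: "summable (\<lambda>k. (z\<^sup>2) ^ k / fact k)" "(\<Sum>k. (z\<^sup>2) ^ k / fact k) = exp (z\<^sup>2)"
    using summable_exp[of "z\<^sup>2"] by (simp_all add: exp_def divide_inverse mult.commute)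
  have part: "(\<Sum>k<n. (z\<^sup>2) ^ k / fact k) \<le> exp (z\<^sup>2)" for n
    unfolding exp_sums(2)[symmetric] by (rule sum_le_suminf[OF exp_sums(1)]) (auto simp: z)
  have "summable a"
  proof (rule summableI_nonneg_bounded[OF a0])
    fix n
    have "(\<Sum>i<n. a i) \<le> (\<Sum>i<2 * n. a i)" using a0 by (intro sum_mono2) auto
    also have "\<dots> \<le> (\<Sum>k<n. (1 + z / Gamma (3 / 2)) * ((z\<^sup>2) ^ k / fact k))"
      unfolding pair distrib_right even by (intro sum_mono add_mono odd) simp
    also have "\<dots> = (1 + z / Gamma (3 / 2)) * (\<Sum>k<n. (z\<^sup>2) ^ k / fact k)"
      by (simp only: sum_distrib_left)
    also have "\<dots> \<le> (1 + z / Gamma (3 / 2)) * exp (z\<^sup>2)" using z G part by (intro mult_left_mono) auto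
    finally show "(\<Sum>i<n. a i) \<le> (1 + z / Gamma (3 / 2)) * exp (z\<^sup>2)" .
  qed
  have "exp (z\<^sup>2) \<le> (\<Sum>i. a i)"
    unfolding exp_sums(2)[symmetric]
  proof (rule suminf_le_const[OF exp_sums(1)])
    fix n
    have "(\<Sum>k<n. (z\<^sup>2) ^ k / fact k) \<le> (\<Sum>i<2 * n. a i)" unfolding pair
      by (intro sum_mono) (use a0 in \<open>simp add: even\<close>)
    also have "\<dots> \<le> (\<Sum>i. a i)" by (rule sum_le_suminf[OF \<open>summable a\<close>]) (auto simp: a0)
    finally show "(\<Sum>k<n. (z\<^sup>2) ^ k / fact k) \<le> (\<Sum>i. a i)" .
  qed
  then show ?thesis by (simp add: a_def)
qed

text \<open>Equality holds for \<open>d = 1\<close>. Otherwise one of the factors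
  \<open>1 + 24 * d\<close> absorbs \<open>24 * d\<close>, another absorbs
  \<open>2 * sqrt 8\<close>, and each of the rest a \<open>sqrt 8\<close>.\<close>

lemma power_24_ge:
  assumes "1 \<le> d" shows "25 * real d * sqrt 8 ^ (d - 1) \<le> (1 + 24 * real d) ^ d"
proof (cases "d = 1")
  case False
  then obtain k where d: "d = Suc (Suc k)" using assms by (metis One_nat_def not0_implies_Suc not_one_le_zero)
  have s8: "sqrt 8 \<le> 3" by (rule real_le_lsqrt) auto
  have "2 * sqrt 8 ^ (d - 1) = (2 * sqrt 8) * sqrt 8 ^ k" by (simp add: d)
  also have "\<dots> \<le> (1 + 24 * real d) * (1 + 24 * real d) ^ k"
    using s8 by (intro mult_mono power_mono) (auto simp: d)
  finally have step: "2 * sqrt 8 ^ (d - 1) \<le> (1 + 24 * real d) * (1 + 24 * real d) ^ k" .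
  have "(24 * real d) * (2 * sqrt 8 ^ (d - 1)) \<le> (1 + 24 * real d) * ((1 + 24 * real d) * (1 + 24 * real d) ^ k)"
    by (rule mult_mono[OF _ step]) auto
  moreover have "25 * real d * sqrt 8 ^ (d - 1) \<le> (24 * real d) * (2 * sqrt 8 ^ (d - 1))"
  proof -
    have "25 * (real d * sqrt 8 ^ (d - 1)) \<le> 48 * (real d * sqrt 8 ^ (d - 1))" by (intro mult_right_mono) auto
    then show ?thesis by simp
  qed
  moreover have "(1 + 24 * real d) * ((1 + 24 * real d) * (1 + 24 * real d) ^ k) = (1 + 24 * real d) ^ d"
    by (simp add: d)
  ultimately show ?thesis by linarith
qed simp

text \<open>From \<open>ln y \<ge> 1 - 1 / y\<close> follows
  \<open>u * ln (u * R) \<ge> u - 1 / R\<close>. The bound is uniform as \<open>u\<close> tends to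
  0, which is the case of \<open>p\<close> near 1.\<close>

lemma self_power_ge:
  assumes "0 < u" "50 \<le> (R::real)" shows "49 / 50 \<le> (u * R) powr u"
proof -
  have "- (1 / 50) \<le> - (1 / R)" using assms by (simp add: field_simps)
  also have "\<dots> \<le> u * (1 - 1 / (u * R))" using assms by (simp add: field_simps)
  also have "1 - 1 / (u * R) \<le> ln (u * R)"
    using ln_le_minus_one[of "1 / (u * R)"] assms by (simp add: ln_div ln_mult)
  finally have "- (1 / 50) \<le> u * ln (u * R)" using assms by (simp add: mult_left_mono)
  then have "exp (- (1 / 50)) \<le> (u * R) powr u" using assms by (simp add: powr_def)
  then show ?thesis using exp_ge_add_one_self[of "- (1 / 50) :: real"] by simp
qed

context euler_scheme
begin

text \<open>The comparison is with \<open>Lambda1A\<close>, whose summands in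
  \<open>nb / sqrt lmin\<close> and \<open>L0\<close> match those of
  \<open>parametrix_const\<close>. The extra factor \<open>sqrt (2 * d)\<close> on the left,
  \<open>d\<close> the dimension, is spent later on the power \<open>d / 2\<close> in
  \<open>chain_const\<close>.\<close>

lemma growth_const_le:
  assumes T: "0 \<le> T"
  shows "growth_const * sqrt (2 * real CARD('d))
    \<le> Lambda1 CARD('d) CARD('m) nb lmin lmax L0 T * sqrt pi * ((1 + 24 * real CARD('d)) * lmax / lmin) ^ CARD('d)"
proof -
  define d where "d = CARD('d)"
  define \<kappa> where "\<kappa> = lmax / lmin"
  define n where "n = nb / sqrt lmin"
  define w where "w = sqrt 8 ^ d"
  have d: "1 \<le> d" by (simp add: d_def Suc_leI)
  have \<kappa>: "1 \<le> \<kappa>" using lmin_le_lmax constants_pos by (simp add: \<kappa>_def)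
  have n: "0 \<le> n" using nb_nonneg constants_pos by (simp add: n_def)
  have w: "0 \<le> w" by (simp add: w_def)
  have s1: "sqrt \<kappa> ^ d \<le> \<kappa> ^ d"
  proof (rule power_mono)
    show "sqrt \<kappa> \<le> \<kappa>" using \<kappa> by (intro real_le_lsqrt) (auto simp: power2_eq_square)
  qed (use \<kappa> in simp)
  have s2: "sqrt \<kappa> * sqrt \<kappa> ^ d \<le> \<kappa> ^ d"
  proof -
    have "sqrt \<kappa> ^ Suc d \<le> sqrt \<kappa> ^ (2 * d)" using \<kappa> d by (intro power_increasing) auto
    also have "\<dots> = \<kappa> ^ d" using \<kappa> by (simp add: power_mult)
    finally show ?thesis by simp
  qed
  \<comment> \<open>The number \<open>44 / 5\<close> satisfies
    \<open>44 / 5 * sqrt 8 \<le> 25\<close>, the constant of \<open>power_24_ge\<close>.\<close>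
  have A: "44 / 5 * (real d * w * \<kappa> ^ d) \<le> ((1 + 24 * real d) * \<kappa>) ^ d"
  proof -
    have "44 / 5 * sqrt 8 \<le> 25"
    proof -
      have "(44 / 5 * sqrt 8)\<^sup>2 \<le> (25::real)\<^sup>2" by (simp add: power_mult_distrib power2_eq_square)
      then show ?thesis by (rule power2_le_imp_le) simp
    qed
    then have "44 / 5 * sqrt 8 * sqrt 8 ^ (d - 1) \<le> 25 * sqrt 8 ^ (d - 1)" by (intro mult_right_mono) auto
    moreover have "w = sqrt 8 * sqrt 8 ^ (d - 1)" using d unfolding w_def by (metis Suc_diff_le diff_Suc_1 power_Suc)
    ultimately have "44 / 5 * w \<le> 25 * sqrt 8 ^ (d - 1)" by simp
    then have "real d * (44 / 5 * w) \<le> real d * (25 * sqrt 8 ^ (d - 1))" by (intro mult_left_mono) auto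
    also have "\<dots> \<le> (1 + 24 * real d) ^ d" using power_24_ge[OF d] by simp
    finally have "real d * (44 / 5 * w) * \<kappa> ^ d \<le> (1 + 24 * real d) ^ d * \<kappa> ^ d" using \<kappa> by (intro mult_right_mono) auto
    then show ?thesis by (simp add: power_mult_distrib mult_ac)
  qed
  have spi: "17 / 10 \<le> sqrt pi"
    by (rule real_le_rsqrt) (use pi_gt3 in \<open>simp add: power2_eq_square\<close>)
  have s2': "sqrt 2 \<le> 1415 / 1000" by (rule real_le_lsqrt) (auto simp: power2_eq_square)
  have sd: "sqrt (real d) \<le> real d" using d by (intro real_le_lsqrt) (auto simp: power2_eq_square)
  have L1: "2 * n + 4 * sqrt (real d) * L0 * \<kappa>\<^sup>2 \<le> Lambda1 CARD('d) CARD('m) nb lmin lmax L0 T"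
  proof -
    have "2 * n + 4 * sqrt (real d) * L0 * \<kappa>\<^sup>2 = 2 * (n + 2 * sqrt (real d) * L0 * \<kappa>\<^sup>2) * 1" by simp
    also have "\<dots> \<le> 2 * (n + 2 * sqrt (real d) * L0 * \<kappa>\<^sup>2 + real d powr (real d / 2 + 1) * fact d * \<kappa> ^ d * L0) * exp (nb\<^sup>2 * T / lmax)"
      using n \<kappa> constants_pos T by (intro mult_mono) auto
    also have "\<dots> = Lambda1A CARD('d) nb lmin lmax L0 T" by (simp add: Lambda1A_def d_def n_def \<kappa>_def)
    also have "\<dots> \<le> Lambda1 CARD('d) CARD('m) nb lmin lmax L0 T" by (simp add: Lambda1_def)
    finally show ?thesis .
  qed
  have G: "growth_const * sqrt (2 * real d) = (38 * (real d * sqrt (real d) * L0 * \<kappa>\<^sup>2) * (w * sqrt \<kappa> ^ d)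
      + 4 * (sqrt (real d) * n) * (w * (sqrt \<kappa> * sqrt \<kappa> ^ d))) * sqrt 2"
  proof -
    have "(8 * \<kappa>) powr (real d / 2) = w * sqrt \<kappa> ^ d"
      using \<kappa> by (simp add: w_def powr_mult powr_half_sqrt[symmetric] powr_realpow[symmetric] powr_powr)
    then show ?thesis
      by (simp add: growth_const_def parametrix_const_def d_def[symmetric] \<kappa>_def[symmetric] n_def real_sqrt_mult algebra_simps)
  qed
  define p where "p = real d * sqrt (real d) * L0 * \<kappa>\<^sup>2 * (w * \<kappa> ^ d)"
  define q where "q = real d * n * (w * \<kappa> ^ d)"
  have pq: "0 \<le> p" "0 \<le> q" using n w \<kappa> constants_pos by (auto simp: p_def q_def)
  have "real d * sqrt (real d) * L0 * \<kappa>\<^sup>2 * (w * sqrt \<kappa> ^ d) \<le> p"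
    unfolding p_def using w constants_pos \<kappa> s1 by (intro mult_left_mono) auto
  moreover have "sqrt (real d) * n * (w * (sqrt \<kappa> * sqrt \<kappa> ^ d)) \<le> q"
    unfolding q_def using w n \<kappa> s2 sd by (intro mult_mono mult_left_mono mult_right_mono) auto
  ultimately have le: "38 * (real d * sqrt (real d) * L0 * \<kappa>\<^sup>2) * (w * sqrt \<kappa> ^ d)
      + 4 * (sqrt (real d) * n) * (w * (sqrt \<kappa> * sqrt \<kappa> ^ d)) \<le> 38 * p + 4 * q" by (simp add: mult.assoc)
  have "growth_const * sqrt (2 * real d) \<le> (38 * p + 4 * q) * (1415 / 1000)"
    unfolding G using pq by (intro mult_mono[OF le s2']) auto
  also have "\<dots> \<le> 748 / 25 * q + 1496 / 25 * p" using pq by simp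
  also have "\<dots> = (2 * n + 4 * sqrt (real d) * L0 * \<kappa>\<^sup>2) * (17 / 10) * (44 / 5 * (real d * w * \<kappa> ^ d))"
    by (simp add: p_def q_def algebra_simps)
  also have "\<dots> \<le> Lambda1 CARD('d) CARD('m) nb lmin lmax L0 T * sqrt pi * ((1 + 24 * real d) * \<kappa>) ^ d"
    using n constants_pos \<kappa> w order_trans[OF _ L1, of 0] by (intro mult_mono L1 spi A) (auto intro!: mult_nonneg_nonneg)
  finally show ?thesis by (simp add: d_def \<kappa>_def)
qed

text \<open>A power of order \<open>d / 2\<close> in \<open>T\<close> is absorbed by an exponential:
  \<open>Lambda2\<close> is at least \<open>exp (z\<^sup>2)\<close>, and \<open>z\<^sup>2\<close> is
  at least \<open>2 * d * growth_const\<^sup>2 * T\<close>.\<close>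

lemma chain_const_le:
  assumes T: "0 < T"
  shows "chain_const T \<le> 8 powr (real CARD('d) / 2) * Lambda2 CARD('d) CARD('m) nb lmin lmax L0 T"
proof -
  define d where "d = real CARD('d)"
  define h where "h = d / 2"
  define z where "z = Lambda1 CARD('d) CARD('m) nb lmin lmax L0 T * sqrt (pi * T)
     * ((1 + 24 * real CARD('d)) * lmax / lmin) ^ CARD('d)"
  have d: "1 \<le> d" by (simp add: d_def Suc_leI)
  have h: "1 / 2 \<le> h" "0 \<le> h" using d by (auto simp: h_def)
  have Gz: "growth_const * sqrt T * sqrt (2 * d) \<le> z"
    using mult_right_mono[OF growth_const_le[of T], of "sqrt T"] T
    by (simp add: z_def d_def real_sqrt_mult mult_ac)
  have G0: "0 \<le> growth_const * sqrt T * sqrt (2 * d)" using growth_const_bounds(1) T d by simp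
  have z0: "0 \<le> z" using Gz G0 by linarith
  have "(growth_const * sqrt T * sqrt (2 * d))\<^sup>2 \<le> z\<^sup>2" using Gz G0 by (intro power_mono)
  then have Gz2: "growth_const\<^sup>2 * T * (2 * d) \<le> z\<^sup>2" using T d by (simp add: power_mult_distrib)
  have L2: "exp (z\<^sup>2) \<le> Lambda2 CARD('d) CARD('m) nb lmin lmax L0 T"
  proof -
    have "1 * exp (z\<^sup>2) \<le> exp (nb * T / (2 * lmax)) * (\<Sum>i. z ^ i / Gamma (1 + real i / 2))"
      using Mittag_Leffler_half[OF z0] nb_nonneg T constants_pos by (intro mult_mono) auto
    then show ?thesis by (simp add: Lambda2_def z_def)
  qed
  have two: "2 \<le> 4 powr h"
  proof -
    have "(2::real) = 4 powr (1 / 2)" by (simp add: powr_half_sqrt)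
    also have "\<dots> \<le> 4 powr h" using h by (intro powr_mono) auto
    finally show ?thesis .
  qed
  have "chain_const T \<le> 8 powr h * exp (z\<^sup>2)"
  proof (cases "16 * growth_const\<^sup>2 * T \<le> 1")
    case True
    have "2 * 1 \<le> 8 powr h * exp (z\<^sup>2)"
      using order_trans[OF two powr_mono2[of h 4 8]] h by (intro mult_mono) auto
    then show ?thesis using True by (simp add: chain_const_def max_def)
  next
    case False
    \<comment> \<open>Dividing by \<open>d\<close> turns \<open>exp (2 * y) powr (d / 2)\<close>
      into exactly \<open>exp (z\<^sup>2)\<close>, so the absorption
      \<open>4 * y \<le> exp (2 * y)\<close> costs only a constant to the power
      \<open>d / 2\<close>.\<close>
    define y where "y = z\<^sup>2 / d"
    have y: "0 \<le> y" using d by (simp add: y_def)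
    have "4 * y \<le> (1 + y)\<^sup>2" using zero_le_power2[of "1 - y"] by (simp add: power2_eq_square algebra_simps)
    also have "\<dots> \<le> (exp y)\<^sup>2" using y by (intro power_mono exp_ge_add_one_self) auto
    also have "\<dots> = exp (2 * y)" by (simp add: exp_double)
    finally have ey: "8 * y \<le> 2 * exp (2 * y)" by simp
    have "16 * growth_const\<^sup>2 * T \<le> 8 * y" using Gz2 d by (simp add: y_def field_simps)
    then have "16 * growth_const\<^sup>2 * T \<le> 2 * exp (2 * y)" using ey by simp
    then have "(16 * growth_const\<^sup>2 * T) powr h \<le> (2 * exp (2 * y)) powr h"
      using h T by (intro powr_mono2) auto
    also have "\<dots> = 2 powr h * exp (z\<^sup>2)"
      using d by (simp add: powr_mult exp_powr_real h_def y_def)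
    finally have "2 * (16 * growth_const\<^sup>2 * T) powr h \<le> 4 powr h * (2 powr h * exp (z\<^sup>2))"
      using two by (intro mult_mono) auto
    also have "\<dots> = 8 powr h * exp (z\<^sup>2)" by (simp add: powr_mult[symmetric] mult.assoc[symmetric])
    finally show ?thesis using False by (simp add: chain_const_def max_def h_def d_def)
  qed
  also have "\<dots> \<le> 8 powr h * Lambda2 CARD('d) CARD('m) nb lmin lmax L0 T" using L2 by (intro mult_left_mono) auto
  finally show ?thesis by (simp add: h_def d_def)
qed

text \<open>The second summand of \<open>alpha0\<close> alone suffices.\<close>

lemma krylov_const_le_alpha0:
  assumes T: "0 < T" and pq: "1 < p" "1 < q" "real CARD('d) / p + 2 / q < 2"
  shows "krylov_const T p q \<le> alpha0 CARD('d) CARD('m) nb lmin lmax L0 T p q"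
    "0 < alpha0 CARD('d) CARD('m) nb lmin lmax L0 T p q"
proof -
  define h where "h = real CARD('d) / 2"
  define u where "u = 1 - 1 / p"
  define \<kappa> where "\<kappa> = lmax / lmin"
  define R where "R = kappa0 CARD('d) lmax / (2 * lmin)"
  define g where "g = (gamma0 CARD('d) p q * (1 - 1 / q)) powr ((q - 1) / q)"
  define E where "E = exp (nb\<^sup>2 / (2 * lmax))"
  define \<Lambda>2 where "\<Lambda>2 = Lambda2 CARD('d) CARD('m) nb lmin lmax L0 T"
  define \<Lambda>3 where "\<Lambda>3 = Lambda3 CARD('d) CARD('m) nb lmin lmax L0 T"
  have h: "0 \<le> h" by (simp add: h_def)
  have u: "0 < u" using pq by (simp add: u_def)
  have \<kappa>: "1 \<le> \<kappa>" using lmin_le_lmax constants_pos by (simp add: \<kappa>_def)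
  have d1: "1 \<le> real CARD('d)" by (simp add: Suc_leI)
  have R: "R = 2 * (1 + 24 * real CARD('d)) * \<kappa>" using constants_pos by (simp add: R_def kappa0_def \<kappa>_def field_simps)
  have R50: "50 * \<kappa> \<le> R" unfolding R using \<kappa> d1 by (intro mult_right_mono) auto
  have \<Lambda>3: "\<Lambda>3 = \<Lambda>2 * E * R powr h"
    by (simp add: \<Lambda>3_def Lambda3_def \<Lambda>2_def E_def R_def h_def)
  \<comment> \<open>The bases multiply to \<open>8 * 2 * 3 = 48\<close>; raising this to 49 fits
    \<open>49 / 50 * R\<close> with \<open>R \<ge> 50 * \<kappa>\<close> below.\<close>
  have K: "density_const T \<le> \<Lambda>2 * E * (49 * \<kappa>) powr h"
  proof -
    have L0': "0 \<le> \<Lambda>2"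
      using chain_const_le[OF T] chain_const_ge_2[of T] unfolding \<Lambda>2_def[symmetric]
      by (smt (verit) mult_nonneg_nonpos powr_ge_zero)
    have "density_const T = chain_const T * ((2 * \<kappa>) powr h * E * 3 powr h)"
      by (simp add: density_const_def spread_const_def \<kappa>_def h_def E_def)
    also have "\<dots> = chain_const T * (E * (6 * \<kappa>) powr h)"
      by (simp add: powr_mult[symmetric] mult_ac)
    also have "\<dots> \<le> (8 powr h * \<Lambda>2) * (E * (6 * \<kappa>) powr h)"
      using chain_const_le[OF T] by (intro mult_right_mono) (auto simp: \<Lambda>2_def h_def E_def)
    also have "\<dots> = \<Lambda>2 * E * (48 * \<kappa>) powr h"
      using powr_mult[of 8 "6 * \<kappa>" h] by (simp add: mult_ac)
    also have "\<dots> \<le> \<Lambda>2 * E * (49 * \<kappa>) powr h"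
      using L0' \<kappa> h by (intro mult_left_mono powr_mono2) (auto simp: E_def)
    finally show ?thesis .
  qed
  have \<Lambda>2_pos: "0 < \<Lambda>2"
  proof -
    have "0 < \<Lambda>2 * E * (49 * \<kappa>) powr h" using K density_const_ge_1[of T] by linarith
    then show ?thesis using \<kappa> by (simp add: E_def zero_less_mult_iff)
  qed
  have "density_const T powr (1 / p) \<le> density_const T powr 1"
    using density_const_ge_1[of T] pq by (intro powr_mono) auto
  also have "\<dots> \<le> \<Lambda>2 * E * (49 * \<kappa>) powr h" using K density_const_ge_1[of T] by simp
  \<comment> \<open>The factor \<open>R\<close> belongs to \<open>Lambda3\<close>. The factor
    \<open>(u * R) powr u\<close> collects the powers of order \<open>1 - 1 / p\<close> in
    \<open>alpha0\<close>; it can fall slightly below 1, but not below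
    \<open>49 / 50\<close>.\<close>
  also have "\<dots> \<le> \<Lambda>2 * E * (R * (u * R) powr u) powr h"
  proof (intro mult_left_mono powr_mono2)
    have "49 * \<kappa> \<le> R * (49 / 50)" using R50 by simp
    also have "\<dots> \<le> R * (u * R) powr u"
      using self_power_ge[OF u, of R] R50 \<kappa> by (intro mult_left_mono) auto
    finally show "49 * \<kappa> \<le> R * (u * R) powr u" .
  qed (use h \<kappa> \<Lambda>2_pos in \<open>auto simp: E_def\<close>)
  also have "\<dots> = \<Lambda>3 * (u * R) powr (h * u)"
    by (simp add: \<Lambda>3 powr_mult[of R "(u * R) powr u"] powr_powr mult.commute[of u h])
  finally have main: "density_const T powr (1 / p) \<le> \<Lambda>3 * (u * R) powr (h * u)" .
  have split: "(2 * pi * lmin) powr (real CARD('d) / (2 * p)) = (2 * pi) powr (h * (1 / p)) * lmin powr h / lmin powr (h * u)"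
  proof -
    have "(2 * pi * lmin) powr (real CARD('d) / (2 * p)) = (2 * pi) powr (h * (1 / p)) * lmin powr (h * (1 / p))"
      by (simp add: h_def powr_mult[of "2 * pi"])
    also have "h * (1 / p) = h - h * u" by (simp add: u_def algebra_simps)
    then have "lmin powr (h * (1 / p)) = lmin powr h / lmin powr (h * u)" by (simp add: powr_diff)
    finally show ?thesis by simp
  qed
  have kap: "(u * R) powr (h * u) = u powr (h * u) * (kappa0 CARD('d) lmax / 2) powr (h * u) / lmin powr (h * u)"
  proof -
    have "u * R = u * (kappa0 CARD('d) lmax / 2) / lmin" by (simp add: R_def)
    then show ?thesis by (simp only: powr_divide powr_mult)
  qed
  have g0: "0 \<le> g" by (simp add: g_def)
  have denom: "(lmin * (2 * pi) powr (1 / p)) powr h = lmin powr h * (2 * pi) powr (h * (1 / p))"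
    by (simp add: powr_mult powr_powr mult.commute)
  have lp: "0 < lmin powr (h * u)" "0 < lmin powr h" "0 < (2 * pi) powr (h * (1 / p))" using constants_pos by auto
  have "krylov_const T p q = density_const T powr (1 / p) / ((2 * pi) powr (h * (1 / p)) * lmin powr h / lmin powr (h * u)) * g"
    by (simp only: krylov_const_def split g_def)
  also have "\<dots> \<le> (\<Lambda>3 * (u * R) powr (h * u)) / ((2 * pi) powr (h * (1 / p)) * lmin powr h / lmin powr (h * u)) * g"
    using main lp g0 by (intro mult_right_mono divide_right_mono) auto
  also have "\<dots> = u powr (h * u) / (lmin powr h * (2 * pi) powr (h * (1 / p))) * (\<Lambda>3 * g * (kappa0 CARD('d) lmax / 2) powr (h * u))"
    unfolding kap using lp by (simp add: field_simps)
  finally have 1: "krylov_const T p q \<le> u powr (h * u) / (lmin powr h * (2 * pi) powr (h * (1 / p))) * (\<Lambda>3 * g * (kappa0 CARD('d) lmax / 2) powr (h * u))" .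
  have a: "alpha0 CARD('d) CARD('m) nb lmin lmax L0 T p q = u powr (h * u) / (lmin powr h * (2 * pi) powr (h * (1 / p)))
     * (lmax powr (h * u) + \<Lambda>3 * g * (kappa0 CARD('d) lmax / 2) powr (h * u))"
    unfolding denom[symmetric] by (simp add: alpha0_def u_def h_def \<Lambda>3_def g_def)
  have c0: "0 < u powr (h * u) / (lmin powr h * (2 * pi) powr (h * (1 / p)))" using u lp by simp
  have \<Lambda>30: "0 \<le> \<Lambda>3 * g * (kappa0 CARD('d) lmax / 2) powr (h * u)" using \<Lambda>2_pos g0 by (simp add: \<Lambda>3 E_def)
  show "krylov_const T p q \<le> alpha0 CARD('d) CARD('m) nb lmin lmax L0 T p q"
    unfolding a using c0 by (intro order_trans[OF 1] mult_left_mono) auto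
  have "0 < lmax powr (h * u)" using constants_pos by simp
  then show "0 < alpha0 CARD('d) CARD('m) nb lmin lmax L0 T p q"
    unfolding a using c0 \<Lambda>30 by (intro mult_pos_pos add_pos_nonneg) auto
qed

end

section \<open>Paths of the scheme\<close>

lemma grid_floor_eq:
  assumes "0 < \<delta>" "real k * \<delta> \<le> t" "t < real (k + 1) * \<delta>"
  shows "\<lfloor>t / \<delta>\<rfloor> = int k" "grid_floor \<delta> t = real k * \<delta>"
proof -
  show "\<lfloor>t / \<delta>\<rfloor> = int k" using assms by (intro floor_unique) (auto simp: field_simps)
  then show "grid_floor \<delta> t = real k * \<delta>" by (simp add: grid_floor_def)
qed

lemma drift_integral_diff:
  fixes \<beta> :: "real \<Rightarrow> 'a::euclidean_space"
  assumes \<delta>: "0 < \<delta>" and bound: "\<And>t. norm (\<beta> t) \<le> B"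
    and s: "real k * \<delta> \<le> s" "s \<le> r" "r \<le> real (k + 1) * \<delta>"
  shows "(LINT t:{0..r}|lborel. \<beta> (grid_floor \<delta> t)) = (LINT t:{0..s}|lborel. \<beta> (grid_floor \<delta> t)) + (r - s) *\<^sub>R \<beta> (real k * \<delta>)"
proof -
  have "(\<lambda>t. \<beta> (of_int \<lfloor>t / \<delta>\<rfloor> * \<delta>)) \<in> borel_measurable borel"
    by (rule measurable_compose[where g="\<lambda>n. \<beta> (of_int n * \<delta>)" and N="count_space UNIV"]) measurable
  then have m [measurable]: "(\<lambda>t. \<beta> (grid_floor \<delta> t)) \<in> borel_measurable borel" by (simp add: grid_floor_def)
  have int: "set_integrable lborel A (\<lambda>t. \<beta> (grid_floor \<delta> t))" if "A \<in> sets borel" "bounded A" for A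
    unfolding set_integrable_def
  proof (rule Bochner_Integration.integrable_bound)
    show "integrable lborel (\<lambda>t. indicator A t * B :: real)"
      using that by (intro integrable_mult_left integrable_real_indicator emeasure_bounded_finite) auto
    show "AE t in lborel. norm (indicat_real A t *\<^sub>R \<beta> (grid_floor \<delta> t)) \<le> norm (indicat_real A t * B)"
      using order_trans[OF bound abs_ge_self] by (auto simp: indicator_def)
  qed (use that in measurable)
  have "0 \<le> real k * \<delta>" using \<delta> by simp
  then have s0: "0 \<le> s" using s by linarith
  have "(LINT t:{0..r}|lborel. \<beta> (grid_floor \<delta> t)) = (LINT t:{0..s} \<union> {s<..r}|lborel. \<beta> (grid_floor \<delta> t))"
    using s0 s by (simp add: ivl_disj_un_two_touch ivl_disj_un)
  also have "\<dots> = (LINT t:{0..s}|lborel. \<beta> (grid_floor \<delta> t)) + (LINT t:{s<..r}|lborel. \<beta> (grid_floor \<delta> t))"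
    by (intro set_integral_Un int) auto
  also have "(LINT t:{s<..r}|lborel. \<beta> (grid_floor \<delta> t)) = (LINT t:{s<..r}|lborel. \<beta> (real k * \<delta>))"
    unfolding set_lebesgue_integral_def
  proof (rule integral_cong_AE)
    \<comment> \<open>If \<open>r = real (k + 1) * \<delta>\<close>, the grid point of
      \<open>t = r\<close> is already the next one; a single time is a null set.\<close>
    show "AE t in lborel. indicat_real {s<..r} t *\<^sub>R \<beta> (grid_floor \<delta> t) = indicat_real {s<..r} t *\<^sub>R \<beta> (real k * \<delta>)"
      using AE_lborel_singleton[of r]
      by eventually_elim (use s in \<open>auto simp: indicator_def grid_floor_eq(2)[OF \<delta>, of k]\<close>)
  qed measurable
  also have "\<dots> = (r - s) *\<^sub>R \<beta> (real k * \<delta>)" using s by (simp add: set_lebesgue_integral_def)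
  finally show ?thesis .
qed

lemma elementary_ito_integral_eq:
  assumes \<delta>: "0 < \<delta>" and t: "real k * \<delta> \<le> t" "t \<le> real (k + 1) * \<delta>"
  shows "elementary_ito_integral \<delta> H W t \<omega>
    = (\<Sum>j<k. H (real j * \<delta>) \<omega> *v (W (real (j + 1) * \<delta>) \<omega> - W (real j * \<delta>) \<omega>))
      + H (real k * \<delta>) \<omega> *v (W t \<omega> - W (real k * \<delta>) \<omega>)"
proof -
  define f where "f j = H (real j * \<delta>) \<omega> *v (W (min t (real (j + 1) * \<delta>)) \<omega> - W (min t (real j * \<delta>)) \<omega>)" for j
  have "(\<Sum>j<k. f j) = (\<Sum>j<k. H (real j * \<delta>) \<omega> *v (W (real (j + 1) * \<delta>) \<omega> - W (real j * \<delta>) \<omega>))"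
  proof (rule sum.cong[OF refl])
    fix j assume "j \<in> {..<k}"
    then have "real (j + 1) * \<delta> \<le> real k * \<delta>" "real j * \<delta> \<le> real k * \<delta>" using \<delta> by (auto intro!: mult_right_mono)
    then have "min t (real (j + 1) * \<delta>) = real (j + 1) * \<delta>" "min t (real j * \<delta>) = real j * \<delta>" using t by linarith+
    then show "f j = H (real j * \<delta>) \<omega> *v (W (real (j + 1) * \<delta>) \<omega> - W (real j * \<delta>) \<omega>)" by (simp only: f_def)
  qed
  moreover have "f k = H (real k * \<delta>) \<omega> *v (W t \<omega> - W (real k * \<delta>) \<omega>)"
    using t by (simp add: f_def min_absorb1 min_absorb2)
  moreover have "elementary_ito_integral \<delta> H W t \<omega> = (\<Sum>j<k. f j) + f k"
  proof (cases "t < real (k + 1) * \<delta>")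
    case True
    then have "nat \<lfloor>t / \<delta>\<rfloor> = k" using grid_floor_eq(1)[OF \<delta> t(1)] by simp
    then show ?thesis by (simp add: elementary_ito_integral_def f_def lessThan_Suc_atMost[symmetric])
  next
    \<comment> \<open>At the right end of the cell the floor has already jumped and the sum has one
      more summand, which vanishes because both truncated times equal \<open>t\<close>.\<close>
    case False
    then have te: "t = real (k + 1) * \<delta>" using t by simp
    then have "nat \<lfloor>t / \<delta>\<rfloor> = k + 1" using \<delta> by simp
    then have "elementary_ito_integral \<delta> H W t \<omega> = (\<Sum>j<Suc (k + 1). f j)"
      by (simp only: elementary_ito_integral_def f_def lessThan_Suc_atMost)
    moreover have "f (Suc k) = 0"
    proof -
      have "t \<le> real (Suc k + 1) * \<delta>" using \<delta> by (simp add: te algebra_simps)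
      then have "min t (real (Suc k + 1) * \<delta>) = t" "min t (real (Suc k) * \<delta>) = t" by (simp_all add: te)
      then show ?thesis by (simp only: f_def) simp
    qed
    ultimately show ?thesis by simp
  qed
  ultimately show ?thesis by simp
qed

text \<open>One null set serves all \<open>k\<close>, \<open>s\<close>, \<open>r\<close>: on every
  path that solves the integral equation the identity is deterministic. The modification below has
  to agree with \<open>X\<close> at all times simultaneously.\<close>

lemma euler_maruyama_increment:
  assumes em: "euler_maruyama M F W b \<sigma> \<delta> x X" and \<delta>: "0 < \<delta>" and b: "\<And>x. norm (b x) \<le> B"
  shows "AE \<omega> in M. \<forall>k s r. real k * \<delta> \<le> s \<and> s \<le> r \<and> r \<le> real (k + 1) * \<delta> \<longrightarrow>
    X r \<omega> = X s \<omega> + (r - s) *\<^sub>R b (X (real k * \<delta>) \<omega>) + \<sigma> (X (real k * \<delta>) \<omega>) *v (W r \<omega> - W s \<omega>)"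
proof -
  have "AE \<omega> in M. \<forall>t\<ge>0. X t \<omega> = x + (LINT s:{0..t}|lborel. b (X (grid_floor \<delta> s) \<omega>))
     + elementary_ito_integral \<delta> (\<lambda>s \<omega>. \<sigma> (X s \<omega>)) W t \<omega>"
    using em by (simp add: euler_maruyama_def)
  then show ?thesis
  proof eventually_elim
    case (elim \<omega>)
    show ?case
    proof (intro allI impI, elim conjE)
      fix k s r
      assume s: "real k * \<delta> \<le> s" "s \<le> r" "r \<le> real (k + 1) * \<delta>"
      have "0 \<le> real k * \<delta>" using \<delta> by simp
      then have s0: "0 \<le> s" "0 \<le> r" and sr: "s \<le> real (k + 1) * \<delta>" "real k * \<delta> \<le> r" using s by linarith+
      have "\<sigma> (X (real k * \<delta>) \<omega>) *v (W r \<omega> - W (real k * \<delta>) \<omega>)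
        = \<sigma> (X (real k * \<delta>) \<omega>) *v (W s \<omega> - W (real k * \<delta>) \<omega>) + \<sigma> (X (real k * \<delta>) \<omega>) *v (W r \<omega> - W s \<omega>)"
        by (simp add: matrix_vector_mult_diff_distrib)
      then show "X r \<omega> = X s \<omega> + (r - s) *\<^sub>R b (X (real k * \<delta>) \<omega>) + \<sigma> (X (real k * \<delta>) \<omega>) *v (W r \<omega> - W s \<omega>)"
        using elim[rule_format, OF s0(1)] elim[rule_format, OF s0(2)]
          drift_integral_diff[OF \<delta>, of "\<lambda>t. b (X t \<omega>)" B k s r, OF b s]
        by (simp add: elementary_ito_integral_eq[OF \<delta> s(1) sr(1)] elementary_ito_integral_eq[OF \<delta> sr(2) s(3)])
    qed
  qed
qed

text \<open>The process is set to 0 on a null set containing the discontinuous paths and extended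
  constantly to negative times. It is then everywhere the limit of its samples on the grid of mesh
  \<open>1 / (n + 1)\<close>, and these are jointly measurable.\<close>

lemma joint_measurable_modification:
  fixes W :: "real \<Rightarrow> 'w \<Rightarrow> 'e::euclidean_space"
  assumes meas: "\<And>t. 0 \<le> t \<Longrightarrow> W t \<in> borel_measurable M"
    and cont: "AE \<omega> in M. continuous_on {0..} (\<lambda>t. W t \<omega>)"
  obtains W' where "(\<lambda>(t, \<omega>). W' t \<omega>) \<in> borel_measurable (borel \<Otimes>\<^sub>M M)"
    "AE \<omega> in M. \<forall>t\<ge>0. W' t \<omega> = W t \<omega>"
proof -
  from cont obtain N where N: "{\<omega> \<in> space M. \<not> continuous_on {0..} (\<lambda>t. W t \<omega>)} \<subseteq> N" "N \<in> sets M" "emeasure M N = 0"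
    by (rule AE_E)
  define W' where "W' t \<omega> = (if \<omega> \<in> N then 0 else W (max 0 t) \<omega>)" for t \<omega>
  have W'm [measurable]: "W' t \<in> borel_measurable M" for t
    unfolding W'_def using N(2) meas[of "max 0 t"] by measurable
  have W'c: "continuous_on UNIV (\<lambda>t. W' t \<omega>)" if "\<omega> \<in> space M" for \<omega>
  proof (cases "\<omega> \<in> N")
    case False
    then have "continuous_on {0..} (\<lambda>t. W t \<omega>)" using N(1) that by auto
    then have "continuous_on UNIV (\<lambda>t. W (max 0 t) \<omega>)"
      by (rule continuous_on_compose2) (auto intro!: continuous_intros)
    then show ?thesis using False by (simp add: W'_def)
  qed (simp add: W'_def)
  have "(\<lambda>(t, \<omega>). W' t \<omega>) \<in> borel_measurable (borel \<Otimes>\<^sub>M M)"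
  proof (rule borel_measurable_LIMSEQ_metric)
    fix n :: nat
    have "(\<lambda>p. (\<lambda>i p. W' (of_int i / real (Suc n)) (snd p)) \<lfloor>fst p * real (Suc n)\<rfloor> p) \<in> borel_measurable (borel \<Otimes>\<^sub>M M)"
      by (rule measurable_compose_countable) measurable
    then show "(\<lambda>p. W' (of_int \<lfloor>fst p * real (Suc n)\<rfloor> / real (Suc n)) (snd p)) \<in> borel_measurable (borel \<Otimes>\<^sub>M M)" .
  next
    fix p :: "real \<times> 'w" assume "p \<in> space (borel \<Otimes>\<^sub>M M)"
    then have c: "continuous_on UNIV (\<lambda>t. W' t (snd p))" by (intro W'c) (auto simp: space_pair_measure)
    have "(\<lambda>n. of_int \<lfloor>fst p * real (Suc n)\<rfloor> / real (Suc n)) \<longlonglongrightarrow> fst p"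
    proof (rule tendsto_sandwich)
      show "\<forall>\<^sub>F n in sequentially. fst p - 1 / real (Suc n) \<le> of_int \<lfloor>fst p * real (Suc n)\<rfloor> / real (Suc n)"
      proof (rule always_eventually, rule allI)
        fix n
        have "fst p * real (Suc n) - 1 \<le> of_int \<lfloor>fst p * real (Suc n)\<rfloor>" by linarith
        then have "(fst p * real (Suc n) - 1) / real (Suc n) \<le> of_int \<lfloor>fst p * real (Suc n)\<rfloor> / real (Suc n)"
          by (rule divide_right_mono) simp
        then show "fst p - 1 / real (Suc n) \<le> of_int \<lfloor>fst p * real (Suc n)\<rfloor> / real (Suc n)"
          by (simp add: diff_divide_distrib del: of_nat_Suc)
      qed
      show "\<forall>\<^sub>F n in sequentially. of_int \<lfloor>fst p * real (Suc n)\<rfloor> / real (Suc n) \<le> fst p"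
      proof (rule always_eventually, rule allI)
        fix n
        have "of_int \<lfloor>fst p * real (Suc n)\<rfloor> \<le> fst p * real (Suc n)" by linarith
        then have "of_int \<lfloor>fst p * real (Suc n)\<rfloor> / real (Suc n) \<le> fst p * real (Suc n) / real (Suc n)"
          by (rule divide_right_mono) simp
        then show "of_int \<lfloor>fst p * real (Suc n)\<rfloor> / real (Suc n) \<le> fst p" by (simp del: of_nat_Suc)
      qed
      have "(\<lambda>n. fst p - 1 / real (Suc n)) \<longlonglongrightarrow> fst p - 0" by (intro tendsto_diff tendsto_const LIMSEQ_Suc[OF lim_1_over_n])
      then show "(\<lambda>n. fst p - 1 / real (Suc n)) \<longlonglongrightarrow> fst p" by simp
    qed simp
    then show "(\<lambda>n. W' (of_int \<lfloor>fst p * real (Suc n)\<rfloor> / real (Suc n)) (snd p)) \<longlonglongrightarrow> (case p of (t, \<omega>) \<Rightarrow> W' t \<omega>)"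
      using continuous_on_tendsto_compose[OF c] by (simp add: split_beta)
  qed
  moreover have "AE \<omega> in M. \<omega> \<notin> N" using N by (intro AE_not_in) (auto simp: null_sets_def)
  then have "AE \<omega> in M. \<forall>t\<ge>0. W' t \<omega> = W t \<omega>" by eventually_elim (auto simp: W'_def max_def)
  ultimately show ?thesis by (rule that)
qed

context euler_scheme
begin

text \<open>Inside a cell \<open>X\<close> is an explicit measurable function of time, of its value
  at the grid point and of \<open>W\<close>, so a jointly measurable version of \<open>W\<close>
  provides one of \<open>X\<close>.\<close>

lemma X_modification:
  assumes inc: "AE \<omega> in M. \<forall>k s r. real k * \<delta> \<le> s \<and> s \<le> r \<and> r \<le> real (k + 1) * \<delta> \<longrightarrow>
    X r \<omega> = X s \<omega> + (r - s) *\<^sub>R b (X (real k * \<delta>) \<omega>) + \<sigma> (X (real k * \<delta>) \<omega>) *v (W r \<omega> - W s \<omega>)"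
  obtains X' where "(\<lambda>(t, \<omega>). X' t \<omega>) \<in> borel_measurable (borel \<Otimes>\<^sub>M M)"
    "AE \<omega> in M. \<forall>t\<ge>0. X' t \<omega> = X t \<omega>"
proof -
  have "W t \<in> borel_measurable M" if "0 \<le> t" for t
    using brownian that subalg(2)[OF that]
    by (auto simp: brownian_motion_def adapted_to_def intro: measurable_from_subalg)
  moreover have "AE \<omega> in M. continuous_on {0..} (\<lambda>t. W t \<omega>)" using brownian by (simp add: brownian_motion_def)
  ultimately obtain W' where W': "(\<lambda>(t, \<omega>). W' t \<omega>) \<in> borel_measurable (borel \<Otimes>\<^sub>M M)"
    "AE \<omega> in M. \<forall>t\<ge>0. W' t \<omega> = W t \<omega>" by (rule joint_measurable_modification)
  have k0: "0 \<le> real k * \<delta>" for k using \<delta> by simp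
  note [measurable] = X_M[OF k0]
  have [measurable]: "(\<lambda>p. W' (fst p) (snd p)) \<in> borel_measurable (borel \<Otimes>\<^sub>M M)"
    using W'(1) by (simp add: split_beta')
  have [measurable]: "W' s \<in> borel_measurable M" for s
    using measurable_compose[OF measurable_Pair1'[of s borel M] W'(1)] by simp
  define G where "G k p = X (real k * \<delta>) (snd p) + (fst p - real k * \<delta>) *\<^sub>R b (X (real k * \<delta>) (snd p))
     + \<sigma> (X (real k * \<delta>) (snd p)) *v (W' (fst p) (snd p) - W' (real k * \<delta>) (snd p))" for k :: nat and p
  define X' where "X' t \<omega> = G (nat \<lfloor>t / \<delta>\<rfloor>) (t, \<omega>)" for t \<omega>
  have Gm: "G k \<in> borel_measurable (borel \<Otimes>\<^sub>M M)" for k unfolding G_def by measurable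
  have "(\<lambda>p. G (nat \<lfloor>fst p / \<delta>\<rfloor>) p) \<in> borel_measurable (borel \<Otimes>\<^sub>M M)"
    by (rule measurable_compose_countable[OF Gm]) measurable
  then have "(\<lambda>(t, \<omega>). X' t \<omega>) \<in> borel_measurable (borel \<Otimes>\<^sub>M M)" by (simp add: X'_def split_beta')
  moreover have "AE \<omega> in M. \<forall>t\<ge>0. X' t \<omega> = X t \<omega>"
    using inc W'(2)
  proof eventually_elim
    case (elim \<omega>)
    show ?case
    proof (intro allI impI)
      fix t :: real assume t: "0 \<le> t"
      define k where "k = nat \<lfloor>t / \<delta>\<rfloor>"
      have "real k \<le> t / \<delta>" "t / \<delta> < real k + 1" using t \<delta> by (auto simp: k_def)
      then have "real k * \<delta> \<le> t" "t \<le> real (k + 1) * \<delta>" using \<delta> by (auto simp: field_simps)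
      then show "X' t \<omega> = X t \<omega>"
        using elim(1)[rule_format, of k "real k * \<delta>" t] elim(2)[rule_format, OF t] elim(2)[rule_format, OF k0[of k]]
        by (simp add: X'_def k_def[symmetric] G_def)
    qed
  qed
  ultimately show ?thesis by (rule that)
qed

text \<open>The case of a bounded integrand, with \<open>lam\<close> already included in
  \<open>h\<close>. The bound does not involve \<open>K\<close>, so the truncation can be removed by
  monotone convergence.\<close>

theorem exp_moment_bounded:
  fixes h :: "real \<Rightarrow> real ^ 'd \<Rightarrow> real"
  assumes T: "0 < T"
    and h [measurable]: "(\<lambda>(t, x). h t x) \<in> borel_measurable (borel \<Otimes>\<^sub>M borel)"
    and h0: "\<And>t x. 0 \<le> h t x" and hK: "\<And>t x. h t x \<le> K"
    and pq: "1 < p" "1 < q" "real CARD('d) / p + 2 / q < 2"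
    and J: "0 \<le> J" "(\<integral>\<^sup>+t\<in>{0..T}. ennpowr (\<integral>\<^sup>+x. ennreal (h t x powr p) \<partial>lborel) (q / p) \<partial>lborel) \<le> ennreal J"
    and X': "(\<lambda>(t, \<omega>). X' t \<omega>) \<in> borel_measurable (borel \<Otimes>\<^sub>M M)" "AE \<omega> in M. \<forall>t\<ge>0. X' t \<omega> = X t \<omega>"
  shows "(\<integral>\<^sup>+\<omega>. ennreal (exp (tail_integral T (\<lambda>t. h t (X' t \<omega>)) 0)) \<partial>M)
    \<le> ennreal (2 powr (1 + T * (2 * alpha0 CARD('d) CARD('m) nb lmin lmax L0 T p q * J powr (1 / q)) powr gamma0 CARD('d) p q))"
proof -
  define \<alpha> where "\<alpha> = alpha0 CARD('d) CARD('m) nb lmin lmax L0 T p q"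
  define \<gamma> where "\<gamma> = gamma0 CARD('d) p q"
  define N where "N = J powr (1 / q)"
  have \<alpha>: "0 < \<alpha>" "krylov_const T p q \<le> \<alpha>" using krylov_const_le_alpha0[OF T pq] by (auto simp: \<alpha>_def)
  have "1 - 1 / q - real CARD('d) / (2 * p) > 0" using pq by (simp add: field_simps)
  then have \<gamma>: "0 < \<gamma>" by (simp add: \<gamma>_def gamma0_def)
  have N: "0 \<le> N" by (simp add: N_def)
  have hm: "(\<lambda>x. h t x) \<in> borel_measurable borel" for t
    using measurable_compose[OF measurable_Pair1'[of t borel borel] h] by simp
  let ?E = "\<integral>\<^sup>+\<omega>. ennreal (exp (tail_integral T (\<lambda>t. h t (X' t \<omega>)) 0)) \<partial>M"
  \<comment> \<open>\<open>J\<close> may vanish, so that \<open>\<epsilon>\<close> is needed to choose a finite \<open>L\<close>\<close>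
  have step: "?E \<le> ennreal (2 powr (1 + T * (2 * \<alpha> * (N + \<epsilon>)) powr \<gamma>))" if \<epsilon>: "0 < \<epsilon>" for \<epsilon>
  proof -
    define c where "c = 2 * \<alpha> * (N + \<epsilon>)"
    have c: "0 < c" using \<alpha> N \<epsilon> by (simp add: c_def)
    \<comment> \<open>Solves
      \<open>\<alpha> * (N + \<epsilon>) * L powr (1 / \<gamma>) = 1 / 2\<close>: on intervals of
      this length the Krylov bound is at most \<open>1 / 2\<close>, and \<open>T / L\<close> is the
      exponent of the claim.\<close>
    define L where "L = c powr (- \<gamma>)"
    have L: "0 < L" "T / L = T * c powr \<gamma>" using c by (auto simp: L_def powr_minus divide_inverse)
    have "?E \<le> ennreal (2 powr (1 + T / L))"
    proof (rule khasminskii[OF filtered])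
      have [measurable]: "(\<lambda>p. X' (fst p) (snd p)) \<in> borel_measurable (borel \<Otimes>\<^sub>M M)"
        using X'(1) by (simp add: split_beta')
      show "(\<lambda>(r, \<omega>). h r (X' r \<omega>)) \<in> borel_measurable (borel \<Otimes>\<^sub>M M)"
        using measurable_compose[OF _ h, of "\<lambda>p. (fst p, X' (fst p) (snd p))" "borel \<Otimes>\<^sub>M M"]
        by (simp add: split_beta')
      show "(\<lambda>\<omega>. h r (X r \<omega>)) \<in> borel_measurable (F r)" if "0 \<le> r" for r
        by (rule measurable_compose[OF X_F[OF that order.refl] hm])
      show "AE \<omega> in M. h r (X' r \<omega>) = h r (X r \<omega>)" if "0 \<le> r" for r
        using X'(2) by eventually_elim (simp add: that)
      fix s t :: real and Y :: "'w \<Rightarrow> ennreal"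
      assume s: "0 \<le> s" "s < t" "t \<le> T" "t - s \<le> L"
        and Y: "Y \<in> borel_measurable (F s)" "integral\<^sup>N M Y < \<infinity>"
      have "(\<integral>\<^sup>+r\<in>{s..t}. (\<integral>\<^sup>+\<omega>. Y \<omega> * ennreal (h r (X r \<omega>)) \<partial>M) \<partial>lborel)
        \<le> ennreal (krylov_const T p q * N * (t - s) powr (1 / \<gamma>)) * integral\<^sup>N M Y"
        unfolding N_def \<gamma>_def by (rule krylov_estimate[OF h h0 pq J s(1-3) Y])
      also have "\<dots> \<le> ennreal (1 / 2) * integral\<^sup>N M Y"
      proof (intro mult_right_mono ennreal_leI)
        have "(t - s) powr (1 / \<gamma>) \<le> L powr (1 / \<gamma>)" using s \<gamma> by (intro powr_mono2) auto
        also have "\<dots> = 1 / c" using c \<gamma> unfolding L_def powr_powr by (simp add: powr_minus_divide)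
        finally have "krylov_const T p q * N * (t - s) powr (1 / \<gamma>) \<le> (\<alpha> * (N + \<epsilon>)) * (1 / c)"
          using \<alpha> N \<epsilon> by (intro mult_mono) auto
        also have "\<dots> = 1 / 2" using c by (simp add: c_def field_simps)
        finally show "krylov_const T p q * N * (t - s) powr (1 / \<gamma>) \<le> 1 / 2" .
      qed simp
      finally show "(\<integral>\<^sup>+r\<in>{s..t}. (\<integral>\<^sup>+\<omega>. Y \<omega> * ennreal (h r (X r \<omega>)) \<partial>M) \<partial>lborel) \<le> ennreal (1 / 2) * integral\<^sup>N M Y" .
    qed (use h0 hK L T in auto)
    then show ?thesis by (simp add: L c_def)
  qed
  have "(\<lambda>n. 1 / real (Suc n)) \<longlonglongrightarrow> 0" by (rule LIMSEQ_Suc[OF lim_1_over_n])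
  then have l: "(\<lambda>n. (2 * \<alpha> * (N + 1 / real (Suc n))) powr \<gamma>) \<longlonglongrightarrow> (2 * \<alpha> * (N + 0)) powr \<gamma>"
    using \<alpha> \<gamma> N by (intro tendsto_powr' tendsto_mult tendsto_add tendsto_const) auto
  have "(\<lambda>n. 2 powr (1 + T * (2 * \<alpha> * (N + 1 / real (Suc n))) powr \<gamma>)) \<longlonglongrightarrow> 2 powr (1 + T * (2 * \<alpha> * (N + 0)) powr \<gamma>)"
    by (intro tendsto_powr[OF tendsto_const] tendsto_add[OF tendsto_const] tendsto_mult[OF tendsto_const l]) auto
  then have lim: "(\<lambda>n. ennreal (2 powr (1 + T * (2 * \<alpha> * (N + 1 / real (Suc n))) powr \<gamma>))) \<longlonglongrightarrow> ennreal (2 powr (1 + T * (2 * \<alpha> * N) powr \<gamma>))"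
    by (intro tendsto_ennrealI) simp
  have "?E \<le> ennreal (2 powr (1 + T * (2 * \<alpha> * (N + 1 / real (Suc n))) powr \<gamma>))" for n by (rule step) simp
  then have "?E \<le> ennreal (2 powr (1 + T * (2 * \<alpha> * N) powr \<gamma>))" by (intro LIMSEQ_le_const[OF lim] exI allI impI)
  then show ?thesis by (simp add: \<alpha>_def N_def \<gamma>_def)
qed

end

text \<open>Continuity of \<open>exp\<close> along increasing sequences, including the value
  infinity, since the time integral may diverge on some paths. In that case
  \<open>x \<le> exp x\<close> already forces the supremum to be infinite.\<close>

lemma ennexp_le_SUP:
  assumes inc: "incseq a" and fin: "\<And>n. a n < \<infinity>"
  shows "ennexp (SUP n. a n) \<le> (SUP n::nat. ennreal (exp (enn2real (a n))))"
proof -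
  define S where "S = (SUP n. ennreal (exp (enn2real (a n))))"
  have up: "ennreal (exp (enn2real (a n))) \<le> S" for n unfolding S_def by (rule SUP_upper) simp
  have lim: "a \<longlonglongrightarrow> (SUP n. a n)" by (rule LIMSEQ_SUP[OF inc])
  show ?thesis unfolding S_def[symmetric]
  proof (cases "(SUP n. a n) = \<infinity>")
    case True
    have "ennreal r \<le> S" if "0 \<le> r" for r
    proof -
      have "ennreal r < (SUP n. a n)" unfolding True by simp
      then obtain n where "ennreal r < a n" unfolding less_SUP_iff by blast
      then have "r \<le> enn2real (a n)" using fin[of n] that
        by (cases "a n" rule: ennreal_cases) (auto simp: ennreal_less_iff)
      also have "\<dots> \<le> exp (enn2real (a n))" using exp_ge_add_one_self[of "enn2real (a n)"] by linarith
      finally show ?thesis using up[of n] by (meson ennreal_leI order_trans)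
    qed
    then have "S = \<infinity>" by (metis ennreal_cases ennreal_less_iff gt_ex infinity_ennreal_def le_less_trans less_irrefl less_le_not_le order.trans)
    then show "ennexp (SUP n. a n) \<le> S" by simp
  next
    case False
    have "(SUP n. a n) = ennreal (enn2real (SUP n. a n))"
      using False by (cases "SUP n. a n" rule: ennreal_cases) auto
    then have "(\<lambda>n. enn2real (a n)) \<longlonglongrightarrow> enn2real (SUP n. a n)"
      using lim by (intro tendsto_enn2real) auto
    then have "(\<lambda>n. ennreal (exp (enn2real (a n)))) \<longlonglongrightarrow> ennreal (exp (enn2real (SUP n. a n)))"
      by (intro tendsto_ennrealI tendsto_exp)
    then have "ennreal (exp (enn2real (SUP n. a n))) \<le> S" by (rule LIMSEQ_le_const2) (use up in auto)
    then show "ennexp (SUP n. a n) \<le> S" using False unfolding ennexp_def by (simp only: if_False)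
  qed
qed

lemma ennpowr_mono: "u \<le> v \<Longrightarrow> 0 \<le> a \<Longrightarrow> ennpowr u a \<le> ennpowr v a"
  by (auto simp: ennpowr_def top_unique top.not_eq_extremum intro!: ennreal_leI powr_mono2 enn2real_mono)

lemma ennpowr_mult: "0 < c \<Longrightarrow> ennpowr (ennreal c * u) a = ennreal (c powr a) * ennpowr u a"
  by (cases u rule: ennreal_cases)
     (auto simp: ennpowr_def ennreal_mult_top ennreal_mult[symmetric] powr_mult)

theorem lemma2p3:
  fixes M :: "'w measure" and F :: "real \<Rightarrow> 'w measure"
    and W :: "real \<Rightarrow> 'w \<Rightarrow> real ^ 'm"
    and b :: "real ^ 'd \<Rightarrow> real ^ 'd" and \<sigma> :: "real ^ 'd \<Rightarrow> real ^ 'm ^ 'd"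
    and lmin lmax L0 T \<delta> p q lam :: real
    and x :: "real ^ 'd" and X :: "real \<Rightarrow> 'w \<Rightarrow> real ^ 'd"
    and f :: "real \<Rightarrow> real ^ 'd \<Rightarrow> real ^ 'd"
  assumes "filtered_prob_space M F"
    and "brownian_motion M F W"
    and "T > 0"
    and "assumption_A1 b"
    and "assumption_A3 \<sigma> lmin lmax L0"
    and "0 < \<delta>" and "\<delta> < 1"
    and "euler_maruyama M F W b \<sigma> \<delta> x X"
    and "1 < p" and "1 < q" and "real CARD('d) / p + 2 / q < 2"
    and "f \<in> Lpq_class p q T"
    and "lam > 0"
  shows "(\<integral>\<^sup>+\<omega>. ennexp (ennreal lam * (\<integral>\<^sup>+t\<in>{0..T}. ennreal (norm (f t (X t \<omega>))) \<partial>lborel)) \<partial>M)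
    \<le> ennreal (2 powr (1 + T *
        (2 * lam * alpha0 CARD('d) CARD('m) (sup_norm b) lmin lmax L0 T p q
           * enn2real (Lpq_norm p q T f)) powr gamma0 CARD('d) p q))"
proof -
  define nb where "nb = sup_norm b"
  have bdd: "bdd_above (range (\<lambda>x. norm (b x)))" and bm: "b \<in> borel_measurable borel"
    using \<open>assumption_A1 b\<close> by (auto simp: assumption_A1_def)
  have nb: "norm (b x) \<le> nb" for x unfolding nb_def sup_norm_def by (rule cSUP_upper[OF _ bdd]) simp
  note inc = euler_maruyama_increment[OF \<open>euler_maruyama M F W b \<sigma> \<delta> x X\<close> \<open>0 < \<delta>\<close> nb]
  interpret euler_scheme M F W b \<sigma> lmin lmax L0 nb \<delta> X
  proof
    show "adapted_to F X" using \<open>euler_maruyama M F W b \<sigma> \<delta> x X\<close> by (simp add: euler_maruyama_def)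
    fix k s r assume "real k * \<delta> \<le> s" "s \<le> r" "r \<le> real (k + 1) * \<delta>"
    then show "AE \<omega> in M. X r \<omega> = X s \<omega> + (r - s) *\<^sub>R b (X (real k * \<delta>) \<omega>) + \<sigma> (X (real k * \<delta>) \<omega>) *v (W r \<omega> - W s \<omega>)"
      using inc by (auto elim!: eventually_mono)
  qed (use assms nb bm in auto)
  obtain X' where X': "(\<lambda>(t, \<omega>). X' t \<omega>) \<in> borel_measurable (borel \<Otimes>\<^sub>M M)"
    "AE \<omega> in M. \<forall>t\<ge>0. X' t \<omega> = X t \<omega>"
    by (rule X_modification[OF inc])
  \<comment> \<open>Measurability of \<open>f\<close> is known on \<open>[0, T]\<close> only, so
    \<open>h\<close> is cut off outside; it also absorbs \<open>lam\<close>, which thereby ends up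
    as a factor of the norm.\<close>
  define h where "h t x = indicator {0..T} t * (lam * norm (f t x))" for t x
  have h0: "0 \<le> h t x" for t x using \<open>lam > 0\<close> by (simp add: h_def)
  have "(\<lambda>(t, x). f t x) \<in> borel_measurable (restrict_space borel ({0..T} \<times> UNIV))"
    using \<open>f \<in> Lpq_class p q T\<close> by (simp add: Lpq_class_def)
  then have "(\<lambda>z. indicator ({0..T} \<times> UNIV) z *\<^sub>R (case z of (t, x) \<Rightarrow> f t x)) \<in> borel_measurable borel"
    by (subst (asm) borel_measurable_restrict_space_iff) (auto simp: closed_Times intro!: borel_closed)
  then have [measurable]: "(\<lambda>z. indicator ({0..T} \<times> UNIV) z *\<^sub>R (case z of (t, x) \<Rightarrow> f t x)) \<in> borel_measurable (borel \<Otimes>\<^sub>M borel)"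
    by (simp add: borel_prod)
  have "(\<lambda>z. lam * norm (indicator ({0..T} \<times> UNIV) z *\<^sub>R (case z of (t, x) \<Rightarrow> f t x))) \<in> borel_measurable (borel \<Otimes>\<^sub>M borel)"
    by measurable
  also have "(\<lambda>z. lam * norm (indicator ({0..T} \<times> UNIV) z *\<^sub>R (case z of (t, x) \<Rightarrow> f t x))) = (\<lambda>(t, x). h t x)"
    by (auto simp: h_def indicator_def)
  finally have hm: "(\<lambda>(t, x). h t x) \<in> borel_measurable (borel \<Otimes>\<^sub>M borel)" .
  define If where "If t = (\<integral>\<^sup>+x. ennreal (norm (f t x) powr p) \<partial>lborel)" for t
  define j where "j = enn2real (\<integral>\<^sup>+t\<in>{0..T}. ennpowr (If t) (q / p) \<partial>lborel)"
  have "ennpowr (\<integral>\<^sup>+t\<in>{0..T}. ennpowr (If t) (q / p) \<partial>lborel) (1 / q) < \<infinity>"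
    using \<open>f \<in> Lpq_class p q T\<close> by (simp add: Lpq_class_def Lpq_norm_def If_def)
  then have fin: "(\<integral>\<^sup>+t\<in>{0..T}. ennpowr (If t) (q / p) \<partial>lborel) \<noteq> \<infinity>" by (auto simp: ennpowr_def)
  then have j: "(\<integral>\<^sup>+t\<in>{0..T}. ennpowr (If t) (q / p) \<partial>lborel) = ennreal j" "0 \<le> j"
    by (simp_all add: j_def top.not_eq_extremum)
  have Nf: "enn2real (Lpq_norm p q T f) = j powr (1 / q)"
    using fin by (simp add: Lpq_norm_def If_def[symmetric] ennpowr_def j_def)
  define J where "J = lam powr q * j"
  have J: "0 \<le> J" "J powr (1 / q) = lam * j powr (1 / q)"
    using j \<open>lam > 0\<close> \<open>1 < q\<close> by (simp_all add: J_def powr_mult powr_powr)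
  have hJ: "(\<integral>\<^sup>+t\<in>{0..T}. ennpowr (\<integral>\<^sup>+x. ennreal (h t x powr p) \<partial>lborel) (q / p) \<partial>lborel) \<le> ennreal J"
  proof -
    have meas: "(\<lambda>t. ennpowr (\<integral>\<^sup>+x. ennreal (h t x powr p) \<partial>lborel) (q / p) * indicator {0..T} t) \<in> borel_measurable lborel"
    proof -
      have [measurable]: "(\<lambda>z. h (fst z) (snd z)) \<in> borel_measurable (borel \<Otimes>\<^sub>M borel)" using hm by (simp add: split_beta')
      have [measurable]: "(\<lambda>t. \<integral>\<^sup>+x. ennreal (h t x powr p) \<partial>lborel) \<in> borel_measurable borel" by measurable
      show ?thesis unfolding ennpowr_def by measurable
    qed
    have eq: "ennpowr (\<integral>\<^sup>+x. ennreal (h t x powr p) \<partial>lborel) (q / p) * indicator {0..T} t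
      = ennreal (lam powr q) * (ennpowr (If t) (q / p) * indicator {0..T} t)" for t
    proof (cases "t \<in> {0..T}")
      case True
      have "(\<lambda>x. h t x) \<in> borel_measurable borel"
        using measurable_compose[OF measurable_Pair1'[of t borel borel] hm] by simp
      then have "(\<lambda>x. h t x / lam) \<in> borel_measurable borel" by measurable
      then have [measurable]: "(\<lambda>x. norm (f t x)) \<in> borel_measurable borel" using True \<open>lam > 0\<close> by (simp add: h_def)
      have "(\<integral>\<^sup>+x. ennreal (h t x powr p) \<partial>lborel) = (\<integral>\<^sup>+x. ennreal (lam powr p) * ennreal (norm (f t x) powr p) \<partial>lborel)"
        using True \<open>lam > 0\<close> by (intro nn_integral_cong) (simp add: h_def powr_mult ennreal_mult)
      also have "\<dots> = ennreal (lam powr p) * If t" unfolding If_def by (rule nn_integral_cmult) measurable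
      finally have "ennpowr (\<integral>\<^sup>+x. ennreal (h t x powr p) \<partial>lborel) (q / p) = ennreal ((lam powr p) powr (q / p)) * ennpowr (If t) (q / p)"
        using \<open>lam > 0\<close> by (simp add: ennpowr_mult)
      then show ?thesis using True \<open>1 < p\<close> by (simp add: powr_powr)
    qed simp
    have "(\<integral>\<^sup>+t\<in>{0..T}. ennpowr (\<integral>\<^sup>+x. ennreal (h t x powr p) \<partial>lborel) (q / p) \<partial>lborel)
      = ennreal (lam powr q) * (\<integral>\<^sup>+t\<in>{0..T}. ennpowr (If t) (q / p) \<partial>lborel)"
      unfolding eq
    proof (rule nn_integral_cmult)
      \<comment> \<open>Since \<open>f\<close> is uncontrolled outside \<open>[0, T]\<close>,
        measurability is taken over from the side of \<open>h\<close> by dividing by the positive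
        constant.\<close>
      have "(\<lambda>t. ennpowr (If t) (q / p) * indicator {0..T} t)
        = (\<lambda>t. ennreal (1 / lam powr q) * (ennpowr (\<integral>\<^sup>+x. ennreal (h t x powr p) \<partial>lborel) (q / p) * indicator {0..T} t))"
        unfolding eq mult.assoc[symmetric] using \<open>lam > 0\<close> by (simp add: ennreal_mult[symmetric])
      then show "(\<lambda>t. ennpowr (If t) (q / p) * indicator {0..T} t) \<in> borel_measurable lborel" using meas by simp
    qed
    also have "\<dots> = ennreal J" using j by (simp add: J_def ennreal_mult)
    finally show ?thesis by simp
  qed
  \<comment> \<open>Truncation at height \<open>n\<close> supplies the bound that Khasminskii's
    lemma requires, and keeps the space-time norm below that of \<open>h\<close>.\<close>
  define hn where "hn n t x = min (h t x) (real n)" for n t x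
  have hn: "0 \<le> hn n t x" "hn n t x \<le> real n" "hn n t x \<le> h t x" for n t x using h0[of t x] by (auto simp: hn_def)
  have hnm: "(\<lambda>(t, x). hn n t x) \<in> borel_measurable (borel \<Otimes>\<^sub>M borel)" for n
    using hm by (simp add: hn_def split_beta')
  have hnJ: "(\<integral>\<^sup>+t\<in>{0..T}. ennpowr (\<integral>\<^sup>+x. ennreal (hn n t x powr p) \<partial>lborel) (q / p) \<partial>lborel) \<le> ennreal J" for n
    by (rule order_trans[OF _ hJ])
       (use hn \<open>1 < p\<close> \<open>1 < q\<close> in \<open>auto intro!: nn_integral_mono mult_right_mono ennpowr_mono ennreal_leI powr_mono2\<close>)
  define B where "B = 2 powr (1 + T * (2 * alpha0 CARD('d) CARD('m) nb lmin lmax L0 T p q * J powr (1 / q)) powr gamma0 CARD('d) p q)"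
  have bound: "(\<integral>\<^sup>+\<omega>. ennreal (exp (tail_integral T (\<lambda>t. hn n t (X' t \<omega>)) 0)) \<partial>M) \<le> ennreal B" for n
    unfolding B_def by (rule exp_moment_bounded[OF \<open>T > 0\<close> hnm hn(1,2) assms(9-11) J(1) hnJ X'])
  define u where "u n \<omega> = (\<integral>\<^sup>+t. ennreal (hn n t (X' t \<omega>)) \<partial>lborel)" for n \<omega>
  have path: "(\<lambda>t. h t (X' t \<omega>)) \<in> borel_measurable borel" "(\<lambda>t. hn n t (X' t \<omega>)) \<in> borel_measurable borel"
    if "\<omega> \<in> space M" for n \<omega>
  proof -
    have "(\<lambda>t. X' t \<omega>) \<in> borel_measurable borel"
      using measurable_compose[OF measurable_Pair2'[OF that] X'(1)] by simp
    then have *: "(\<lambda>t. (t, X' t \<omega>)) \<in> borel \<rightarrow>\<^sub>M borel \<Otimes>\<^sub>M borel" by measurable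
    show "(\<lambda>t. h t (X' t \<omega>)) \<in> borel_measurable borel" using measurable_compose[OF * hm] by simp
    show "(\<lambda>t. hn n t (X' t \<omega>)) \<in> borel_measurable borel" using measurable_compose[OF * hnm] by simp
  qed
  have tail: "u n \<omega> = ennreal (tail_integral T (\<lambda>t. hn n t (X' t \<omega>)) 0)" "0 \<le> tail_integral T (\<lambda>t. hn n t (X' t \<omega>)) 0"
    if \<omega>: "\<omega> \<in> space M" for n \<omega>
  proof -
    have "u n \<omega> = (\<integral>\<^sup>+t. ennreal (indicator {0<..T} t * hn n t (X' t \<omega>)) \<partial>lborel)"
      unfolding u_def
    proof (rule nn_integral_cong_AE)
      show "AE t in lborel. ennreal (hn n t (X' t \<omega>)) = ennreal (indicator {0<..T} t * hn n t (X' t \<omega>))"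
        using AE_lborel_singleton[of "0::real"]
        by eventually_elim (auto simp: hn_def h_def indicator_def)
    qed
    also have "\<dots> = ennreal (tail_integral T (\<lambda>t. hn n t (X' t \<omega>)) 0)"
      unfolding tail_integral_def
      by (rule nn_integral_eq_integral[OF indicator_mult_integrable[OF path(2)[OF \<omega>] hn(1,2)]]) (simp add: hn)
    finally show "u n \<omega> = ennreal (tail_integral T (\<lambda>t. hn n t (X' t \<omega>)) 0)" .
    show "0 \<le> tail_integral T (\<lambda>t. hn n t (X' t \<omega>)) 0"
      unfolding tail_integral_def by (auto intro!: integral_nonneg simp: hn)
  qed
  have inc_u: "incseq (\<lambda>n. u n \<omega>)" for \<omega>
    unfolding u_def by (intro incseq_SucI nn_integral_mono ennreal_leI) (auto simp: hn_def)
  have E_eq: "ennreal (exp (enn2real (u n \<omega>))) = ennreal (exp (tail_integral T (\<lambda>t. hn n t (X' t \<omega>)) 0))"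
    if "\<omega> \<in> space M" for n \<omega>
    using tail[OF that, of n] by simp
  have meas_u: "(\<lambda>\<omega>. ennreal (exp (enn2real (u n \<omega>)))) \<in> borel_measurable M" for n
  proof -
    have [measurable]: "(\<lambda>z. X' (fst z) (snd z)) \<in> borel_measurable (borel \<Otimes>\<^sub>M M)" using X'(1) by (simp add: split_beta')
    have "(\<lambda>z. hn n (fst z) (X' (fst z) (snd z))) \<in> borel_measurable (borel \<Otimes>\<^sub>M M)"
      using measurable_compose[OF _ hnm, of "\<lambda>z. (fst z, X' (fst z) (snd z))" "borel \<Otimes>\<^sub>M M"] by simp
    from measurable_compose[OF measurable_pair_swap' this]
    have "(\<lambda>z. hn n (snd z) (X' (snd z) (fst z))) \<in> borel_measurable (M \<Otimes>\<^sub>M borel)" by (simp add: split_beta')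
    then have [measurable]: "(\<lambda>(\<omega>, t). ennreal (hn n t (X' t \<omega>))) \<in> borel_measurable (M \<Otimes>\<^sub>M lborel)"
      by (simp add: split_beta' cong: measurable_cong_sets)
    have "(\<lambda>\<omega>. u n \<omega>) \<in> borel_measurable M" unfolding u_def
      by (rule lborel.borel_measurable_nn_integral) measurable
    then show ?thesis by measurable
  qed
  have "(\<integral>\<^sup>+\<omega>. ennexp (ennreal lam * (\<integral>\<^sup>+t\<in>{0..T}. ennreal (norm (f t (X t \<omega>))) \<partial>lborel)) \<partial>M)
    \<le> (\<integral>\<^sup>+\<omega>. (SUP n. ennreal (exp (enn2real (u n \<omega>)))) \<partial>M)"
  proof (rule nn_integral_mono_AE)
    show "AE \<omega> in M. ennexp (ennreal lam * (\<integral>\<^sup>+t\<in>{0..T}. ennreal (norm (f t (X t \<omega>))) \<partial>lborel))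
      \<le> (SUP n. ennreal (exp (enn2real (u n \<omega>))))"
      using X'(2) AE_space
    proof eventually_elim
      case (elim \<omega>)
      have eq: "ennreal (norm (f t (X t \<omega>))) * indicator {0..T} t = ennreal (1 / lam) * ennreal (h t (X' t \<omega>))" for t
        using elim \<open>lam > 0\<close> by (auto simp: h_def indicator_def ennreal_mult[symmetric])
      have "(\<integral>\<^sup>+t\<in>{0..T}. ennreal (norm (f t (X t \<omega>))) \<partial>lborel) = ennreal (1 / lam) * (\<integral>\<^sup>+t. ennreal (h t (X' t \<omega>)) \<partial>lborel)"
        unfolding eq using path(1)[OF elim(2)] by (intro nn_integral_cmult) measurable
      then have "ennreal lam * (\<integral>\<^sup>+t\<in>{0..T}. ennreal (norm (f t (X t \<omega>))) \<partial>lborel) = (\<integral>\<^sup>+t. ennreal (h t (X' t \<omega>)) \<partial>lborel)"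
        using \<open>lam > 0\<close> by (simp add: mult.assoc[symmetric] ennreal_mult[symmetric])
      also have "\<dots> = (\<integral>\<^sup>+t. (SUP n. ennreal (hn n t (X' t \<omega>))) \<partial>lborel)"
      proof (rule nn_integral_cong)
        fix t
        obtain N where N: "h t (X' t \<omega>) \<le> real N" using real_arch_simple by blast
        show "ennreal (h t (X' t \<omega>)) = (SUP n. ennreal (hn n t (X' t \<omega>)))"
        proof (rule antisym)
          have "ennreal (h t (X' t \<omega>)) = ennreal (hn N t (X' t \<omega>))" using N by (simp add: hn_def)
          then show "ennreal (h t (X' t \<omega>)) \<le> (SUP n. ennreal (hn n t (X' t \<omega>)))"
            using SUP_upper[of N UNIV "\<lambda>n. ennreal (hn n t (X' t \<omega>))"] by simp
        qed (intro SUP_least ennreal_leI hn)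
      qed
      also have "\<dots> = (SUP n. u n \<omega>)"
        unfolding u_def
      proof (rule nn_integral_monotone_convergence_SUP)
        show "incseq (\<lambda>n t. ennreal (hn n t (X' t \<omega>)))"
          by (intro incseq_SucI le_funI ennreal_leI) (auto simp: hn_def)
        show "(\<lambda>t. ennreal (hn n t (X' t \<omega>))) \<in> borel_measurable lborel" for n
          using path(2)[OF elim(2), of n] by measurable
      qed
      finally have "ennreal lam * (\<integral>\<^sup>+t\<in>{0..T}. ennreal (norm (f t (X t \<omega>))) \<partial>lborel) = (SUP n. u n \<omega>)" .
      then show ?case
        using ennexp_le_SUP[OF inc_u[of \<omega>]] tail(1)[OF elim(2)] by simp
    qed
  qed
  also have "\<dots> = (SUP n. \<integral>\<^sup>+\<omega>. ennreal (exp (enn2real (u n \<omega>))) \<partial>M)"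
  proof (rule nn_integral_monotone_convergence_SUP_AE)
    fix n
    show "AE \<omega> in M. ennreal (exp (enn2real (u n \<omega>))) \<le> ennreal (exp (enn2real (u (Suc n) \<omega>)))"
    proof (rule AE_I2)
      fix \<omega> assume \<omega>: "\<omega> \<in> space M"
      have "enn2real (u n \<omega>) \<le> enn2real (u (Suc n) \<omega>)"
      proof (rule enn2real_mono)
        show "u n \<omega> \<le> u (Suc n) \<omega>" using inc_u[of \<omega>] by (simp add: incseq_Suc_iff)
        show "u (Suc n) \<omega> < top" unfolding tail(1)[OF \<omega>] by simp
      qed
      then show "ennreal (exp (enn2real (u n \<omega>))) \<le> ennreal (exp (enn2real (u (Suc n) \<omega>)))" by (intro ennreal_leI) simp
    qed
  qed (rule meas_u)
  also have "\<dots> \<le> ennreal B"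
  proof (rule SUP_least)
    fix n
    have "(\<integral>\<^sup>+\<omega>. ennreal (exp (enn2real (u n \<omega>))) \<partial>M) = (\<integral>\<^sup>+\<omega>. ennreal (exp (tail_integral T (\<lambda>t. hn n t (X' t \<omega>)) 0)) \<partial>M)"
      by (intro nn_integral_cong E_eq)
    then show "(\<integral>\<^sup>+\<omega>. ennreal (exp (enn2real (u n \<omega>))) \<partial>M) \<le> ennreal B" using bound by simp
  qed
  finally show ?thesis by (simp add: B_def J Nf nb_def mult_ac)
qed

end
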